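(* Let $f$ be a function on $\mathbb{R}^n$. Then (i) $\displaystyle (R_k^*R_{p,q}^kR_jf)(x)=c\,(I_n^{j+l}f)(x)=c\,(I_n^{k+q}f)(x)$, (ii) $\displaystyle (R_j^*R_{p,l}^jR_kf)(x)=c\,(I_n^{j+l}f)(x)=c\,(I_n^{k+q}f)(x)$, where $$c=\frac{2^{j+l}\pi^{(j+l)/2}\,\Gamma(n/2)}{\Gamma((n-j-l)/2)};$$ both equalities hold provided that the Riesz potential $I_n^{k+q}f$ exists in the Lebesgue sense.
   Context: Standing assumptions: $n,p,q,l$ are integers with $p>0$, $q>0$, $l>0$, $p+q+l<n$; set $j=p+q$ and $k=p+l$ (so $j+l=k+q$). For a linear subspace $X\subset\mathbb{R}^n$, $G_m(X)$ is the set of $m$-dimensional linear subspaces of $X$ with its rotation-invariant probability measure; $G_{n,m}=G_m(\mathbb{R}^n)$. $G(n,m)$ is the set of all affine $m$-planes in $\mathbb{R}^n$; each element is written $(\xi,u)=\xi+u$ with $\xi\in G_{n,m}$, $u\in\xi^\perp$. For mutually orthogonal subspaces $P,Q$, $[P,Q]=P\oplus Q$. The Strichartz transform (of $\varphi$ on $G(n,j)$) and its dual (of $\psi$ on $G(n,k)$) are $$(R_{p,q}^k \varphi)(\eta,v)=\int_{G_q(\eta^\perp)}dQ\int_{G_p(\eta)}dP\int_{P^\perp\cap\eta} \varphi([P,Q]+u+v)\,du,\qquad(\eta,v)\in G(n,k),$$ $$(R_{p,l}^j \psi)(\xi,u)=\int_{G_l(\xi^\perp)}dL\int_{G_p(\xi)}dP\int_{P^\perp\cap\xi}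 \psi([P,L]+u+v)\,dv,\qquad(\xi,u)\in G(n,j),$$ with $dQ,dP,dL$ the invariant probability measures. For $1\le m\le n-1$ the $m$-plane transform and its dual are $$(R_mf)(\eta,v)=\int_\eta f(u+v)\,du,\quad(\eta,v)\in G(n,m);\qquad (R_m^*\varphi)(x)=\int_{O(n)}\varphi(\rho\eta_0+x)\,d\rho,$$ where $\eta_0$ is a fixed $m$-dimensional linear subspace and $d\rho$ is Haar probability measure on $O(n)$. The Riesz potential is $(I_n^\alpha f)(x)=\dfrac{1}{\gamma_n(\alpha)}\displaystyle\int_{\mathbb{R}^n}\frac{f(y)\,dy}{|x-y|^{n-\alpha}}$, $\gamma_n(\alpha)=\dfrac{2^\alpha\pi^{n/2}\Gamma(\alpha/2)}{\Gamma((n-\alpha)/2)}$. "Exists in the Lebesgue sense" means that the integral converges absolutely. *)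

theory Defs
  imports "HOL-Analysis.Analysis"
begin

section \<open>Lebesgue integration on a linear subspace\<close>

text \<open>
  Lebesgue measure on the subspace \<open>S\<close>, as a measure on the whole space concentrated on \<open>S\<close>: the
  image of the product Lebesgue measure under the coordinates of an orthonormal basis of \<open>S\<close> (compare
  the definition of \<^const>\<open>lborel\<close>). It does not depend on the basis chosen. Here and
  below measures are completed, so that Lebesgue measurable functions which are not Borel measurable
  are integrated correctly.
\<close>

definition orthonormal_basis :: "'a::euclidean_space set \<Rightarrow> 'a set \<Rightarrow> bool" where
  "orthonormal_basis S B \<longleftrightarrow> pairwise orthogonal B \<and> (\<forall>b\<in>B. norm b = 1) \<and> span B = S"

definition subspace_lebesgue :: "'a::euclidean_space set \<Rightarrow> 'a measure" where
  "subspace_lebesgue S = completion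
     (let B = SOME B. orthonormal_basis S B
      in distr (\<Pi>\<^sub>M b\<in>B. lborel) borel (\<lambda>t. \<Sum>b\<in>B. t b *\<^sub>R b))"


section \<open>Haar measure on the orthogonal group\<close>

definition orthogonal_group :: "(real^'n^'n) set" where
  "orthogonal_group = {A. orthogonal_matrix A}"

definition is_haar_prob :: "(real^'n^'n) measure \<Rightarrow> bool" where
  "is_haar_prob M \<longleftrightarrow>
     sets M = sets (restrict_space borel orthogonal_group) \<and>
     emeasure M (space M) = 1 \<and>
     (\<forall>A\<in>orthogonal_group. distr M M (\<lambda>B. A ** B) = M)"

definition haar_prob :: "(real^'n^'n) measure" where
  "haar_prob = completion (THE M. is_haar_prob M)"


section \<open>Grassmannians of linear subspaces\<close>

definition grassmannian :: "nat \<Rightarrow> (real^'n) set \<Rightarrow> (real^'n) set set" where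
  "grassmannian m X = {\<xi>. subspace \<xi> \<and> \<xi> \<subseteq> X \<and> dim \<xi> = m}"

text \<open>
  The topology of the Grassmannian is the one that makes the map sending a subspace to the matrix of
  its orthogonal projection (\<^term>\<open>closest_point \<xi>\<close>) an embedding; its Borel sets are
  therefore the preimages of the Borel sets of matrices.
\<close>

definition grassmannian_borel :: "nat \<Rightarrow> (real^'n) set \<Rightarrow> (real^'n) set measure" where
  "grassmannian_borel m X =
     vimage_algebra (grassmannian m X) (\<lambda>\<xi>. matrix (closest_point \<xi>)) borel"

text \<open>
  Every orthogonal transformation of \<open>X\<close> is the restriction of an orthogonal matrix that maps
  \<open>X\<close> onto itself, and these act transitively on the \<open>m\<close>-dimensional subspaces of
  \<open>X\<close>. Hence there is exactly one invariant probability measure when \<open>X\<close> is a subspace and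
  \<^term>\<open>m \<le> dim X\<close>.
\<close>

definition is_invariant_prob :: "nat \<Rightarrow> (real^'n) set \<Rightarrow> (real^'n) set measure \<Rightarrow> bool" where
  "is_invariant_prob m X M \<longleftrightarrow>
     sets M = sets (grassmannian_borel m X) \<and>
     emeasure M (space M) = 1 \<and>
     (\<forall>A\<in>orthogonal_group. (*v) A ` X = X \<longrightarrow> distr M M (\<lambda>\<xi>. (*v) A ` \<xi>) = M)"

definition grassmannian_prob :: "nat \<Rightarrow> (real^'n) set \<Rightarrow> (real^'n) set measure" where
  "grassmannian_prob m X = completion (THE M. is_invariant_prob m X M)"


section \<open>Affine planes\<close>

definition affine_grassmannian :: "nat \<Rightarrow> (real^'n) set set" where
  "affine_grassmannian m = {\<zeta>. affine \<zeta> \<and> aff_dim \<zeta> = int m}"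

text \<open>
  The coordinates \<open>(\<eta>, v)\<close> of an affine plane: its direction \<open>\<eta>\<close> and its point
  \<open>v\<close> orthogonal to \<open>\<eta>\<close>.
\<close>

definition plane_direction :: "(real^'n) set \<Rightarrow> (real^'n) set" where
  "plane_direction \<zeta> = {a - b | a b. a \<in> \<zeta> \<and> b \<in> \<zeta>}"

definition plane_foot :: "(real^'n) set \<Rightarrow> real^'n" where
  "plane_foot \<zeta> = (THE v. v \<in> \<zeta> \<and> v \<in> (plane_direction \<zeta>)\<^sup>\<bottom>)"

lemma plane_coordinates:
  fixes \<eta> :: "(real^'n) set"
  assumes "subspace \<eta>" "v \<in> \<eta>\<^sup>\<bottom>"
  shows "plane_direction ((+) v ` \<eta>) = \<eta>" "plane_foot ((+) v ` \<eta>) = v"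
proof -
  show dir: "plane_direction ((+) v ` \<eta>) = \<eta>"
  proof
    show "plane_direction ((+) v ` \<eta>) \<subseteq> \<eta>"
      using assms(1) by (auto simp: plane_direction_def subspace_diff)
    show "\<eta> \<subseteq> plane_direction ((+) v ` \<eta>)"
    proof
      fix a assume "a \<in> \<eta>"
      then have "a = (v + a) - (v + 0)" "v + a \<in> (+) v ` \<eta>" "v + 0 \<in> (+) v ` \<eta>"
        using subspace_0[OF assms(1)] by (simp, blast, blast)
      then show "a \<in> plane_direction ((+) v ` \<eta>)"
        unfolding plane_direction_def by blast
    qed
  qed
  show "plane_foot ((+) v ` \<eta>) = v"
    unfolding plane_foot_def dir
  proof (rule the_equality)
    show "v \<in> (+) v ` \<eta> \<and> v \<in> \<eta>\<^sup>\<bottom>"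
      using assms subspace_0[OF assms(1)] by force
  next
    fix w assume w: "w \<in> (+) v ` \<eta> \<and> w \<in> \<eta>\<^sup>\<bottom>"
    then obtain a where a: "a \<in> \<eta>" "w = v + a" by auto
    have "a \<bullet> (v + a) = 0" "a \<bullet> v = 0"
      using w a assms(2) by (auto simp: orthogonal_comp_def orthogonal_def)
    then have "a = 0" by (simp add: inner_add_right)
    with a show "w = v" by simp
  qed
qed

lemma affine_grassmannian_iff:
  fixes \<zeta> :: "(real^'n) set"
  shows "\<zeta> \<in> affine_grassmannian m \<longleftrightarrow>
    (\<exists>\<eta>\<in>grassmannian m UNIV. \<exists>v\<in>\<eta>\<^sup>\<bottom>. \<zeta> = (+) v ` \<eta>)"
proof
  assume "\<zeta> \<in> affine_grassmannian m"
  then have aff: "affine \<zeta>" and ad: "aff_dim \<zeta> = int m"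
    by (auto simp: affine_grassmannian_def)
  then obtain a where "a \<in> \<zeta>"
    using aff_dim_empty by fastforce
  define \<eta> where "\<eta> = (+) (- a) ` \<zeta>"
  have sub: "subspace \<eta>"
    using \<open>a \<in> \<zeta>\<close> aff unfolding \<eta>_def by (rule affine_diffs_subspace[rotated])
  have \<zeta>: "\<zeta> = (+) a ` \<eta>"
    by (simp add: \<eta>_def image_image)
  have "dim \<eta> = m"
    using ad aff_dim_subspace[OF sub] aff_dim_translation_eq[of a \<eta>] by (simp add: \<zeta>)
  obtain y v where y: "y \<in> span \<eta>" and v: "\<And>w. w \<in> span \<eta> \<Longrightarrow> orthogonal v w" and a: "a = y + v"
    using orthogonal_subspace_decomp_exists[of \<eta> a] by metis
  have "y \<in> \<eta>" using y sub by (metis span_eq_iff)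
  have "(+) a ` \<eta> = (+) v ` \<eta>"
  proof -
    have "(+) y ` \<eta> = \<eta>"
    proof
      show "(+) y ` \<eta> \<subseteq> \<eta>" using sub \<open>y \<in> \<eta>\<close> by (auto intro: subspace_add)
      show "\<eta> \<subseteq> (+) y ` \<eta>"
      proof
        fix z assume "z \<in> \<eta>"
        then have "z - y \<in> \<eta>" "z = y + (z - y)" using sub \<open>y \<in> \<eta>\<close> by (auto intro: subspace_diff)
        then show "z \<in> (+) y ` \<eta>" by blast
      qed
    qed
    then have "(+) v ` \<eta> = (+) v ` (+) y ` \<eta>" by simp
    then show ?thesis by (simp add: a image_image add_ac)
  qed
  moreover have "v \<in> \<eta>\<^sup>\<bottom>"
    using v by (auto simp: orthogonal_comp_def orthogonal_commute span_base)
  ultimately show "\<exists>\<eta>\<in>grassmannian m UNIV. \<exists>v\<in>\<eta>\<^sup>\<bottom>. \<zeta> = (+) v ` \<eta>"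
    using sub \<open>dim \<eta> = m\<close> \<zeta> by (auto simp: grassmannian_def)
next
  assume "\<exists>\<eta>\<in>grassmannian m UNIV. \<exists>v\<in>\<eta>\<^sup>\<bottom>. \<zeta> = (+) v ` \<eta>"
  then obtain \<eta> v where "subspace \<eta>" "dim \<eta> = m" "\<zeta> = (+) v ` \<eta>"
    by (auto simp: grassmannian_def)
  then show "\<zeta> \<in> affine_grassmannian m"
    by (simp add: affine_grassmannian_def affine_translation[symmetric] subspace_imp_affine
        aff_dim_translation_eq aff_dim_subspace)
qed


section \<open>The plane transform, its dual, and the Strichartz transform\<close>

definition plane_transform :: "nat \<Rightarrow> (real^'n \<Rightarrow> complex) \<Rightarrow> (real^'n) set \<Rightarrow> complex" where
  "plane_transform m f = (\<lambda>\<zeta>\<in>affine_grassmannian m.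
     \<integral>u. f (u + plane_foot \<zeta>) \<partial>subspace_lebesgue (plane_direction \<zeta>))"

definition dual_plane_transform ::
    "(real^'n) set \<Rightarrow> ((real^'n) set \<Rightarrow> complex) \<Rightarrow> real^'n \<Rightarrow> complex" where
  "dual_plane_transform \<eta>\<^sub>0 \<phi> x = (\<integral>\<rho>. \<phi> ((+) x ` ((*v) \<rho> ` \<eta>\<^sub>0)) \<partial>haar_prob)"

text \<open>
  \<open>strichartz k p q\<close> is the transform \<open>R_{p,q}^k\<close>, taking functions on affine
  \<open>(p+q)\<close>-planes to functions on affine \<open>k\<close>-planes. The dual transform \<open>R_{p,l}^j\<close> is given by the
  same formula and is \<open>strichartz j p l\<close>. Since \<open>P\<close> and \<open>Q\<close> are orthogonal, the set sum
  \<open>P + Q\<close> is their direct sum \<open>[P, Q]\<close>.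
\<close>

definition strichartz ::
    "nat \<Rightarrow> nat \<Rightarrow> nat \<Rightarrow> ((real^'n) set \<Rightarrow> complex) \<Rightarrow> (real^'n) set \<Rightarrow> complex" where
  "strichartz k p q \<phi> = (\<lambda>\<zeta>\<in>affine_grassmannian k.
     let \<eta> = plane_direction \<zeta>; v = plane_foot \<zeta> in
     \<integral>Q. (\<integral>P. (\<integral>u. \<phi> ((+) (u + v) ` (P + Q))
        \<partial>subspace_lebesgue (P\<^sup>\<bottom> \<inter> \<eta>)) \<partial>grassmannian_prob p \<eta>) \<partial>grassmannian_prob q (\<eta>\<^sup>\<bottom>))"


section \<open>Riesz potentials\<close>

definition riesz_gamma :: "nat \<Rightarrow> real \<Rightarrow> real" where
  "riesz_gamma n \<alpha> =
     2 powr \<alpha> * pi powr (real n / 2) * Gamma (\<alpha> / 2) / Gamma ((real n - \<alpha>) / 2)"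

definition riesz_kernel :: "real \<Rightarrow> (real^'n \<Rightarrow> complex) \<Rightarrow> real^'n \<Rightarrow> real^'n \<Rightarrow> complex" where
  "riesz_kernel \<alpha> f x y = f y / of_real (norm (x - y) powr (real CARD('n) - \<alpha>))"

definition riesz_potential :: "real \<Rightarrow> (real^'n \<Rightarrow> complex) \<Rightarrow> real^'n \<Rightarrow> complex" where
  "riesz_potential \<alpha> f x =
     of_real (1 / riesz_gamma CARD('n) \<alpha>) * (\<integral>y. riesz_kernel \<alpha> f x y \<partial>lebesgue)"

text \<open>
  Absolute convergence of the integral at the point \<open>x\<close>. It contains the Lebesgue measurability of
  \<open>f\<close>, because the kernel vanishes nowhere except at \<open>x\<close>.
\<close>

definition riesz_potential_exists :: "real \<Rightarrow> (real^'n \<Rightarrow> complex) \<Rightarrow> real^'n \<Rightarrow> bool" where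
  "riesz_potential_exists \<alpha> f x \<longleftrightarrow> integrable lebesgue (riesz_kernel \<alpha> f x)"

end

theory Submission
  imports Defs
begin

text \<open>
  Write \<open>m = k + q\<close>, call every orthogonal map a rotation, and let \<open>\<eta>\<close> be a linear \<open>k\<close>-plane, \<open>Q\<close> a \<open>q\<close>-plane orthogonal to \<open>\<eta>\<close> and \<open>P\<close> a
  \<open>p\<close>-plane in \<open>\<eta>\<close>. The translates of \<open>P + Q\<close> by the vectors of \<open>P\<^sup>\<bottom> \<inter> \<eta>\<close> fill \<open>\<eta> + Q\<close>, so by Fubini
  the two innermost integrals amount to the integral of \<open>f (x + z)\<close> over \<open>z \<in> \<eta> + Q\<close>, whatever \<open>P\<close>
  is (\<open>strichartz_inner_integral\<close>), and averaging over \<open>P\<close> keeps this value. The left-hand side is thus an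
  average of the integrals of \<open>f (x + z)\<close> over random \<open>m\<close>-planes. With a fixed \<open>Q\<^sub>0\<close> orthogonal to \<open>\<eta>\<^sub>0\<close>
  and \<open>S = \<eta>\<^sub>0 + Q\<^sub>0\<close>, the random plane is \<open>\<rho> A S\<close>, where \<open>\<rho>\<close> is a Haar distributed rotation and \<open>A\<close> a
  random rotation preserving \<open>\<eta>\<^sub>0\<close> (\<open>grassmannian_prob_orbit\<close>); right invariance of the Haar measure
  absorbs \<open>A\<close>. Averaging over rotations replaces a function by its spherical means, which are
  integrated against \<open>r^(m-1) dr\<close> over an \<open>m\<close>-plane and against \<open>r^(n-1) dr\<close> over the whole space, up to
  the areas of the unit spheres. Hence the average is the integral of \<open>f (x + z)\<close> against
  \<open>|z|^(m-n)\<close>, times the ratio of the two areas (\<open>haar_average_plane_measure\<close>), and that ratio is the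
  constant \<open>c\<close> divided by \<open>\<gamma>\<^sub>n(m)\<close> (\<open>sphere_ratio_riesz_gamma\<close>). The second identity is the first one
  with \<open>q\<close> and \<open>l\<close> interchanged.

  The invariant measures in the definitions are given by definite descriptions, so their existence
  and uniqueness are needed. The group of rotations preserving a subspace \<open>X\<close> gets a left invariant
  probability by pushing Lebesgue measure on matrices through a left equivariant retraction onto that
  group, namely the limit of the Newton iteration for the orthogonal polar factor
  (\<open>left_invariant_prob_exists\<close>). A Fubini exchange shows that a left invariant and a right invariant
  probability coincide (\<open>left_right_invariant_prob_eq\<close>), which gives uniqueness and bi-invariance; the
  Grassmannian of \<open>X\<close> inherits both, being an orbit of the group.

  The other tool is to regard Lebesgue measure on a subspace \<open>S\<close> as the projection to \<open>S\<close> of Lebesgue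
  measure on the slab of points within distance 1 of \<open>S\<close>, suitably normalised (\<open>plane_measure_slab\<close>).
  In this form it visibly does not depend on a basis, is carried along by orthogonal maps, and depends measurably
  on the projection matrix of \<open>S\<close>. Since \<open>f\<close> is only Lebesgue measurable, it is replaced by a Borel
  function equal to it outside a null set; the averaging identity applied to that null set shows that
  almost no plane sees the difference.
\<close>

section \<open>Translation invariant measures\<close>

lemma unit_ball_vol_neq_0 [simp]: "unit_ball_vol (real n) \<noteq> 0"
  using unit_ball_vol_pos[of "real n"] by (metis less_irrefl of_nat_0_le_iff)

text \<open>
  Integrate \<open>indicator E x * indicator (cball 0 1) (y - x)\<close> over \<open>x\<close> with \<open>M\<close> and \<open>y\<close> with \<open>N\<close>. Doing
  \<open>y\<close> first gives \<open>M(E)\<close> times the \<open>N\<close>-measure of the ball; after a shift of \<open>x\<close>, doing \<open>y\<close> first gives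
  \<open>N(E)\<close> times the \<open>M\<close>-measure of the ball. The symmetry of the ball makes the two shifts compatible.
\<close>

lemma translation_invariant_measure_unique:
  fixes M N :: "'a::euclidean_space measure"
  assumes sf: "sigma_finite_measure M" "sigma_finite_measure N"
    and sets_M[measurable_cong]: "sets M = sets borel"
    and sets_N[measurable_cong]: "sets N = sets borel"
    and M_trans: "\<And>a. distr M borel ((+) a) = M"
    and N_trans: "\<And>a. distr N borel ((+) a) = N"
    and ball: "emeasure M (cball 0 1) = emeasure N (cball 0 1)"
      "emeasure N (cball 0 1) \<noteq> 0" "emeasure N (cball 0 1) \<noteq> \<infinity>"
  shows "M = N"
proof (rule measure_eqI)
  show "sets M = sets N" by (simp add: sets_M sets_N)
next
  fix E assume "E \<in> sets M"
  then have [measurable]: "E \<in> sets borel" by (simp add: sets_M)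
  interpret M: sigma_finite_measure M by fact
  interpret N: sigma_finite_measure N by fact
  interpret pair_sigma_finite M N ..
  let ?c = "emeasure N (cball 0 1)"
  define g :: "'a \<Rightarrow> ennreal" where "g = indicator (cball 0 1)"
  define h :: "'a \<Rightarrow> ennreal" where "h = indicator E"
  have [measurable]: "g \<in> borel_measurable borel" "h \<in> borel_measurable borel"
    by (auto simp: g_def h_def intro!: borel_measurable_indicator borel_closed)
  have gM: "(\<integral>\<^sup>+x. g x \<partial>M) = ?c" and hM: "(\<integral>\<^sup>+x. h x \<partial>M) = emeasure M E"
    by (simp_all add: g_def h_def sets_M ball)
  have near: "(\<integral>\<^sup>+y. g (y - x) \<partial>N) = ?c" for x
  proof -
    have "(\<integral>\<^sup>+y. g (y - x) \<partial>N)
        = (\<integral>\<^sup>+y. g (y - x) \<partial>distr N borel ((+) x))"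
      by (simp only: N_trans)
    also have "\<dots> = (\<integral>\<^sup>+y. g y \<partial>N)"
      by (subst nn_integral_distr) auto
    finally show ?thesis by (simp add: g_def sets_N)
  qed
  have shift: "(\<integral>\<^sup>+x. h x * g (y - x) \<partial>M)
      = (\<integral>\<^sup>+x. h (y + x) * g x \<partial>M)" for y
  proof -
    have "(\<integral>\<^sup>+x. h x * g (y - x) \<partial>M)
        = (\<integral>\<^sup>+x. h x * g (y - x) \<partial>distr M borel ((+) y))"
      by (simp only: M_trans)
    also have "\<dots> = (\<integral>\<^sup>+x. h (y + x) * g (- x) \<partial>M)"
      by (subst nn_integral_distr) auto
    finally show ?thesis by (simp add: g_def indicator_def)
  qed
  have hit: "(\<integral>\<^sup>+y. h (y + x) \<partial>N) = emeasure N E" for x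
  proof -
    have "emeasure N E = (\<integral>\<^sup>+y. h y \<partial>distr N borel ((+) x))"
      by (simp add: N_trans h_def sets_N)
    also have "\<dots> = (\<integral>\<^sup>+y. h (y + x) \<partial>N)"
      by (subst nn_integral_distr) (auto simp: add.commute)
    finally show ?thesis ..
  qed
  have "?c * emeasure M E = (\<integral>\<^sup>+x. h x * ?c \<partial>M)"
    by (subst nn_integral_multc) (auto simp: mult.commute hM)
  also have "\<dots> = (\<integral>\<^sup>+x. (\<integral>\<^sup>+y. h x * g (y - x) \<partial>N) \<partial>M)"
    by (subst nn_integral_cmult) (auto simp: near)
  also have "\<dots> = (\<integral>\<^sup>+y. (\<integral>\<^sup>+x. h x * g (y - x) \<partial>M) \<partial>N)"
    by (rule Fubini'[symmetric]) measurable
  also have "\<dots> = (\<integral>\<^sup>+y. (\<integral>\<^sup>+x. h (y + x) * g x \<partial>M) \<partial>N)"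
    by (simp only: shift)
  also have "\<dots> = (\<integral>\<^sup>+x. (\<integral>\<^sup>+y. h (y + x) * g x \<partial>N) \<partial>M)"
    by (rule Fubini') measurable
  also have "\<dots> = (\<integral>\<^sup>+x. emeasure N E * g x \<partial>M)"
    by (subst nn_integral_multc) (auto simp: hit)
  also have "\<dots> = emeasure N E * ?c"
    by (subst nn_integral_cmult) (auto simp: gM)
  finally show "emeasure M E = emeasure N E"
    using ball by (simp add: mult.commute[of "emeasure N E"] ennreal_mult_cancel_left)
qed

lemma lborel_translation: "distr lborel borel ((+) a) = (lborel :: 'a::euclidean_space measure)"
  using lborel_affine[of 1 a] by (simp add: density_1)

lemma sigma_finite_if_cballs_finite:
  fixes M :: "'a::euclidean_space measure"
  assumes "sets M = sets borel" "\<And>r. r > 0 \<Longrightarrow> emeasure M (cball 0 r) \<noteq> \<infinity>"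
  shows "sigma_finite_measure M"
proof
  have "x \<in> (\<Union>i::nat. cball 0 (real (Suc i)))" for x :: 'a
  proof -
    obtain i where "norm x \<le> real i" using real_arch_simple by blast
    then show ?thesis by (intro UN_I[of i]) auto
  qed
  then have "(\<Union>i::nat. cball 0 (real (Suc i))) = (UNIV :: 'a set)" by auto
  then show "\<exists>A. countable A \<and> A \<subseteq> sets M \<and> \<Union> A = space M \<and> (\<forall>a\<in>A. emeasure M a \<noteq> \<infinity>)"
    using assms sets_eq_imp_space_eq[OF assms(1)]
    by (intro exI[of _ "range (\<lambda>i::nat. cball 0 (real (Suc i)))"]) auto
qed

text \<open>
  The image measure is again translation invariant and gives the unit ball the same mass.
\<close>

lemma lborel_isometry:
  fixes T :: "'a::euclidean_space \<Rightarrow> 'a"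
  assumes T: "orthogonal_transformation T"
  shows "distr lborel borel T = lborel"
proof -
  have lin: "linear T" using T by (rule orthogonal_transformation_linear)
  have [measurable]: "T \<in> borel_measurable borel"
    using lin by (intro borel_measurable_continuous_onI linear_continuous_on linear_conv_bounded_linear[THEN iffD1])
  have vim: "T -` cball 0 r = cball 0 r" for r
    using orthogonal_transformation_norm[OF T] by auto
  have em: "emeasure (distr lborel borel T) (cball 0 r) = emeasure lborel (cball (0::'a) r)" for r
    by (subst emeasure_distr) (auto simp: vim)
  show ?thesis
  proof (rule translation_invariant_measure_unique)
    show "sigma_finite_measure (distr lborel borel T)"
      by (rule sigma_finite_if_cballs_finite) (use em emeasure_lborel_cball_finite in \<open>auto simp: less_top\<close>)
    show "distr (distr lborel borel T) borel ((+) a) = distr lborel borel T" for a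
    proof -
      obtain b where b: "a = T b" using orthogonal_transformation_surj[OF T] by (metis surjD)
      have "distr (distr lborel borel T) borel ((+) a) = distr lborel borel (\<lambda>x. T (b + x))"
        by (subst distr_distr) (auto simp: b comp_def linear_add[OF lin])
      also have "\<dots> = distr (distr lborel borel ((+) b)) borel T"
        by (subst distr_distr) (auto simp: comp_def)
      finally show ?thesis by (simp add: lborel_translation)
    qed
    show "emeasure lborel (cball (0::'a) 1) \<noteq> 0"
      by (simp add: emeasure_cball)
    show "emeasure lborel (cball (0::'a) 1) \<noteq> \<infinity>" by (simp add: emeasure_cball)
  qed (auto simp: em lborel_translation lborel.sigma_finite_measure_axioms)
qed

section \<open>Orthogonal projections and orthonormal frames\<close>

lemma closest_point_subspace:
  fixes S :: "'a::euclidean_space set"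
  assumes "subspace S"
  shows closest_point_in_subspace: "closest_point S x \<in> S"
    and diff_closest_point_orthogonal: "x - closest_point S x \<in> S\<^sup>\<bottom>"
    and closest_point_subspaceI: "p \<in> S \<Longrightarrow> x - p \<in> S\<^sup>\<bottom> \<Longrightarrow> closest_point S x = p"
proof -
  have S: "convex S" "closed S" "S \<noteq> {}"
    using assms subspace_0 by (auto simp: subspace_imp_convex closed_subspace)
  show unique: "closest_point S x = p" if p: "p \<in> S" "x - p \<in> S\<^sup>\<bottom>" for p
  proof (rule closest_point_unique[OF S(1,2) p(1), symmetric], rule ballI)
    fix z assume "z \<in> S"
    then have "orthogonal (x - p) (p - z)"
      using p assms by (auto simp: orthogonal_comp_def orthogonal_commute subspace_diff)
    then have "(norm (x - z))\<^sup>2 = (norm (x - p))\<^sup>2 + (norm (p - z))\<^sup>2"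
      using norm_add_Pythagorean[of "x - p" "p - z"] by simp
    then show "dist x p \<le> dist x z"
      unfolding dist_norm by (metis norm_ge_zero power2_le_imp_le le_add_same_cancel1 zero_le_power2)
  qed
  obtain y z where yz: "y \<in> span S" "\<And>w. w \<in> span S \<Longrightarrow> orthogonal z w" "x = y + z"
    using orthogonal_subspace_decomp_exists[of S x] by metis
  then have "y \<in> S" using assms by (metis span_eq_iff)
  moreover have "x - y \<in> S\<^sup>\<bottom>"
    using yz by (auto simp: orthogonal_comp_def orthogonal_commute span_base)
  ultimately show "closest_point S x \<in> S" "x - closest_point S x \<in> S\<^sup>\<bottom>"
    using unique[of y] by auto
qed

lemma linear_closest_point:
  fixes S :: "'a::euclidean_space set"
  assumes S: "subspace S"
  shows "linear (closest_point S)"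
proof (rule linearI)
  note P = closest_point_in_subspace[OF S] diff_closest_point_orthogonal[OF S]
  have S': "subspace (S\<^sup>\<bottom>)" by (rule subspace_orthogonal_comp)
  fix x y
  have "x + y - (closest_point S x + closest_point S y)
      = (x - closest_point S x) + (y - closest_point S y)" by simp
  then have "x + y - (closest_point S x + closest_point S y) \<in> S\<^sup>\<bottom>"
    using subspace_add[OF S' P(2)[of x] P(2)[of y]] by metis
  then show "closest_point S (x + y) = closest_point S x + closest_point S y"
    by (intro closest_point_subspaceI[OF S]) (auto intro!: subspace_add S P)
next
  note P = closest_point_in_subspace[OF S] diff_closest_point_orthogonal[OF S]
  have S': "subspace (S\<^sup>\<bottom>)" by (rule subspace_orthogonal_comp)
  fix c x
  have "c *\<^sub>R x - c *\<^sub>R closest_point S x \<in> S\<^sup>\<bottom>"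
    using subspace_scale[OF S' P(2)[of x], of c] by (simp add: scaleR_diff_right)
  then show "closest_point S (c *\<^sub>R x) = c *\<^sub>R closest_point S x"
    by (intro closest_point_subspaceI[OF S]) (auto intro!: subspace_scale S P)
qed

lemma closest_point_add_orthogonal:
  fixes S :: "'a::euclidean_space set"
  assumes "subspace S" "x \<in> S" "z \<in> S\<^sup>\<bottom>"
  shows "closest_point S (x + z) = x"
  using assms by (intro closest_point_subspaceI) auto

lemma continuous_on_closest_point_subspace:
  fixes S :: "'a::euclidean_space set"
  assumes "subspace S"
  shows "continuous_on UNIV (closest_point S)"
  using linear_closest_point[OF assms] linear_continuous_on linear_conv_bounded_linear by blast

lemma borel_measurable_closest_point:
  fixes S :: "'a::euclidean_space set"
  assumes "subspace S"
  shows "closest_point S \<in> borel_measurable borel"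
  by (rule borel_measurable_continuous_onI[OF continuous_on_closest_point_subspace[OF assms]])

definition orthonormal :: "'a::euclidean_space set \<Rightarrow> bool" where
  "orthonormal B \<longleftrightarrow> pairwise orthogonal B \<and> (\<forall>b\<in>B. norm b = 1)"

lemma orthonormal_independent: "orthonormal B \<Longrightarrow> independent B"
  by (intro pairwise_orthogonal_independent) (auto simp: orthonormal_def)

lemma orthonormal_finite: "orthonormal B \<Longrightarrow> finite B"
  by (simp add: orthonormal_independent independent_imp_finite)

lemma orthonormal_card: "orthonormal B \<Longrightarrow> card B = dim (span B)"
  by (simp add: dim_eq_card_independent orthonormal_independent)

lemma norm_orthonormal_sum:
  assumes "orthonormal B"
  shows "norm (\<Sum>b\<in>B. t b *\<^sub>R b) = sqrt (\<Sum>b\<in>B. (t b)\<^sup>2)"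
proof -
  have "(norm (\<Sum>b\<in>B. t b *\<^sub>R b))\<^sup>2 = (\<Sum>b\<in>B. (norm (t b *\<^sub>R b))\<^sup>2)"
    using assms by (intro norm_sum_Pythagorean orthonormal_finite pairwise_ortho_scaleR)
      (auto simp: orthonormal_def)
  also have "\<dots> = (\<Sum>b\<in>B. (t b)\<^sup>2)"
    using assms by (intro sum.cong) (auto simp: orthonormal_def)
  finally show ?thesis by (simp add: real_sqrt_unique)
qed

lemma subspace_orthonormal_basis:
  fixes S :: "'a::euclidean_space set"
  assumes "subspace S"
  obtains B where "orthonormal B" "span B = S"
  using orthonormal_basis_subspace[OF assms] unfolding orthonormal_def by metis

lemma orthonormal_basis_iff: "orthonormal_basis S B \<longleftrightarrow> orthonormal B \<and> span B = S"
  by (auto simp: orthonormal_basis_def orthonormal_def)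

section \<open>Lebesgue measure spanned by an orthonormal frame\<close>

definition frame_measure :: "'a::euclidean_space set \<Rightarrow> 'a measure" where
  "frame_measure B = distr (\<Pi>\<^sub>M b\<in>B. lborel) borel (\<lambda>t. \<Sum>b\<in>B. t b *\<^sub>R b)"

lemma sets_frame_measure [simp, measurable_cong]: "sets (frame_measure B) = sets borel"
  and space_frame_measure [simp]: "space (frame_measure B) = UNIV"
  by (simp_all add: frame_measure_def)

lemma measurable_frame_sum [measurable]:
  "(\<lambda>t. \<Sum>b\<in>B. t b *\<^sub>R b) \<in> (\<Pi>\<^sub>M b\<in>B. lborel) \<rightarrow>\<^sub>M (borel :: 'a::euclidean_space measure)"
  by (intro borel_measurable_sum borel_measurable_scaleR) auto

lemma AE_frame_measure_span: "AE x in frame_measure B. x \<in> span B"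
proof -
  have "{x. x \<in> span B} \<in> sets borel"
    by (simp add: borel_closed closed_subspace)
  then show ?thesis
    unfolding frame_measure_def
    by (subst AE_distr_iff) (simp_all add: span_sum span_scale span_base)
qed

lemma emeasure_frame_measure_cball:
  assumes "orthonormal B" "r > 0"
  shows "emeasure (frame_measure B) (cball 0 r) = ennreal (unit_ball_vol (real (card B)) * r ^ card B)"
proof -
  have "(\<lambda>t. \<Sum>b\<in>B. t b *\<^sub>R b) -` cball 0 r = {t. sqrt (\<Sum>b\<in>B. (t b)\<^sup>2) \<le> r}"
    by (auto simp: norm_orthonormal_sum[OF assms(1)])
  then show ?thesis
    using emeasure_cball_aux[OF orthonormal_finite[OF assms(1)] assms(2)]
    unfolding frame_measure_def by (subst emeasure_distr) auto
qed

lemma sigma_finite_frame_measure: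
  "orthonormal B \<Longrightarrow> sigma_finite_measure (frame_measure B)"
  by (rule sigma_finite_if_cballs_finite) (auto simp: emeasure_frame_measure_cball)

lemma PiM_lborel_translation:
  fixes c :: "'i \<Rightarrow> real"
  assumes "finite I"
  shows "distr (\<Pi>\<^sub>M i\<in>I. lborel) (\<Pi>\<^sub>M i\<in>I. lborel) (\<lambda>t. \<lambda>i\<in>I. c i + t i) = (\<Pi>\<^sub>M i\<in>I. lborel)"
proof -
  interpret product_sigma_finite "\<lambda>_::'i. lborel :: real measure"
    by (rule product_sigma_finite.intro) (rule lborel.sigma_finite_measure_axioms)
  show ?thesis
  proof (rule PiM_eqI)
    fix A :: "'i \<Rightarrow> real set" assume A: "\<And>i. i \<in> I \<Longrightarrow> A i \<in> sets lborel"
    have [measurable]: "(\<lambda>t. \<lambda>i\<in>I. c i + t i) \<in> (\<Pi>\<^sub>M i\<in>I. lborel) \<rightarrow>\<^sub>M (\<Pi>\<^sub>M i\<in>I. lborel)"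
      by (intro measurable_restrict) auto
    have "(\<lambda>t. \<lambda>i\<in>I. c i + t i) -` Pi\<^sub>E I A \<inter> space (\<Pi>\<^sub>M i\<in>I. lborel) = Pi\<^sub>E I (\<lambda>i. (+) (c i) -` A i)"
      by (auto simp: space_PiM PiE_def Pi_def extensional_def)
    then have "emeasure (distr (\<Pi>\<^sub>M i\<in>I. lborel) (\<Pi>\<^sub>M i\<in>I. lborel) (\<lambda>t. \<lambda>i\<in>I. c i + t i)) (Pi\<^sub>E I A)
        = emeasure (\<Pi>\<^sub>M i\<in>I. lborel) (Pi\<^sub>E I (\<lambda>i. (+) (c i) -` A i))"
      using A assms by (subst emeasure_distr) (auto intro!: sets_PiM_I_finite)
    also have "\<dots> = (\<Prod>i\<in>I. emeasure lborel ((+) (c i) -` A i))"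
      using A assms by (intro emeasure_PiM) (auto intro!: measurable_sets[of "(+) _" borel borel, simplified])
    also have "\<dots> = (\<Prod>i\<in>I. emeasure lborel (A i))"
    proof (intro prod.cong refl)
      fix i assume "i \<in> I"
      then have "emeasure (distr lborel borel ((+) (c i))) (A i) = emeasure lborel ((+) (c i) -` A i)"
        using A by (subst emeasure_distr) auto
      then show "emeasure lborel ((+) (c i) -` A i) = emeasure lborel (A i)"
        by (simp add: lborel_translation)
    qed
    finally show "emeasure (distr (\<Pi>\<^sub>M i\<in>I. lborel) (\<Pi>\<^sub>M i\<in>I. lborel) (\<lambda>t. \<lambda>i\<in>I. c i + t i)) (Pi\<^sub>E I A)
      = (\<Prod>i\<in>I. emeasure lborel (A i))" .
  qed (use assms in auto)
qed

lemma frame_measure_translation: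
  assumes B: "orthonormal B" and u: "u \<in> span B"
  shows "distr (frame_measure B) borel ((+) u) = frame_measure B"
proof -
  have fin: "finite B" using B by (rule orthonormal_finite)
  obtain c where c: "u = (\<Sum>b\<in>B. c b *\<^sub>R b)"
    using u fin by (auto simp: span_finite)
  have [measurable]: "(\<lambda>t. \<lambda>i\<in>B. c i + t i) \<in> (\<Pi>\<^sub>M i\<in>B. lborel) \<rightarrow>\<^sub>M (\<Pi>\<^sub>M i\<in>B. lborel)"
    by (intro measurable_restrict) auto
  have "frame_measure B = distr (distr (\<Pi>\<^sub>M i\<in>B. lborel) (\<Pi>\<^sub>M i\<in>B. lborel) (\<lambda>t. \<lambda>i\<in>B. c i + t i))
      borel (\<lambda>t. \<Sum>b\<in>B. t b *\<^sub>R b)"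
    by (simp add: PiM_lborel_translation[OF fin] frame_measure_def)
  also have "\<dots> = distr (\<Pi>\<^sub>M i\<in>B. lborel) borel (\<lambda>t. \<Sum>b\<in>B. (c b + t b) *\<^sub>R b)"
    by (subst distr_distr) (auto simp: comp_def intro!: distr_cong)
  also have "\<dots> = distr (frame_measure B) borel ((+) u)"
    unfolding frame_measure_def
    by (subst distr_distr) (auto simp: comp_def c scaleR_add_left sum.distrib)
  finally show ?thesis ..
qed

text \<open>
  Both measures are translation invariant, and the volume formula for balls in product spaces
  agrees with the one in Euclidean space.
\<close>

lemma frame_measure_whole_space:
  assumes B: "orthonormal B" and "span B = UNIV"
  shows "frame_measure B = lborel"
proof -
  have card: "card B = DIM('a)"
    using orthonormal_card[OF B] assms(2) by (simp add: dim_UNIV)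
  show ?thesis
  proof (rule translation_invariant_measure_unique)
    show "sigma_finite_measure (frame_measure B)" by (rule sigma_finite_frame_measure[OF B])
    show "distr (frame_measure B) borel ((+) a) = frame_measure B" for a
      using assms by (intro frame_measure_translation) auto
    show "emeasure (frame_measure B) (cball 0 1) = emeasure lborel (cball (0::'a) 1)"
      using B by (simp add: emeasure_frame_measure_cball emeasure_cball card)
  qed (auto simp: emeasure_cball lborel_translation lborel.sigma_finite_measure_axioms)
qed

lemma frame_measure_Un:
  fixes B C :: "'a::euclidean_space set"
  assumes B: "orthonormal B" and C: "orthonormal C" and disj: "B \<inter> C = {}"
  shows "frame_measure (B \<union> C) = distr (frame_measure B \<Otimes>\<^sub>M frame_measure C) borel (\<lambda>(x, y). x + y)"
proof -
  interpret product_sigma_finite "\<lambda>_::'a. lborel :: real measure"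
    by (rule product_sigma_finite.intro) (rule lborel.sigma_finite_measure_axioms)
  have fin: "finite B" "finite C" using B C by (auto intro: orthonormal_finite)
  let ?P = "\<lambda>B. \<Pi>\<^sub>M b\<in>B. lborel :: real measure"
  let ?s = "\<lambda>B t. \<Sum>b\<in>B. t b *\<^sub>R (b::'a)"
  have pair: "frame_measure B \<Otimes>\<^sub>M frame_measure C
      = distr (?P B \<Otimes>\<^sub>M ?P C) (borel \<Otimes>\<^sub>M borel) (\<lambda>(t, u). (?s B t, ?s C u))"
    unfolding frame_measure_def
    by (rule pair_measure_distr)
      (use sigma_finite_frame_measure[OF C] in \<open>auto simp: frame_measure_def\<close>)
  have sum_merge: "?s (B \<union> C) (merge B C (t, u)) = ?s B t + ?s C u" for t u
    using fin disj by (subst sum.union_disjoint) (auto simp: merge_def intro!: arg_cong2[where f="(+)"] sum.cong)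
  have "frame_measure (B \<union> C)
      = distr (distr (?P B \<Otimes>\<^sub>M ?P C) (?P (B \<union> C)) (merge B C)) borel (?s (B \<union> C))"
    by (simp add: frame_measure_def distr_merge[OF disj fin])
  also have "\<dots> = distr (?P B \<Otimes>\<^sub>M ?P C) borel (\<lambda>(t, u). ?s B t + ?s C u)"
    by (subst distr_distr) (auto simp: comp_def sum_merge case_prod_unfold[abs_def] intro!: distr_cong)
  also have "\<dots> = distr (frame_measure B \<Otimes>\<^sub>M frame_measure C) borel (\<lambda>(x, y). x + y)"
    unfolding pair by (subst distr_distr) (auto simp: comp_def case_prod_unfold)
  finally show ?thesis .
qed

lemma nn_integral_frame_measure_Un:
  fixes B C :: "'a::euclidean_space set"
  assumes B: "orthonormal B" and C: "orthonormal C" and disj: "B \<inter> C = {}"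
    and [measurable]: "h \<in> borel_measurable borel"
  shows "(\<integral>\<^sup>+x. h x \<partial>frame_measure (B \<union> C))
    = (\<integral>\<^sup>+x. (\<integral>\<^sup>+y. h (x + y) \<partial>frame_measure C) \<partial>frame_measure B)"
proof -
  interpret C: sigma_finite_measure "frame_measure C" by (rule sigma_finite_frame_measure[OF C])
  show ?thesis
    unfolding frame_measure_Un[OF B C disj]
    by (subst nn_integral_distr, simp_all, subst C.nn_integral_fst[symmetric]) simp_all
qed

lemma orthonormal_Un:
  assumes "orthonormal B" "orthonormal C" "span C \<subseteq> (span B)\<^sup>\<bottom>"
  shows "orthonormal (B \<union> C)" "B \<inter> C = {}"
proof -
  have orth: "orthogonal b c" if "b \<in> B" "c \<in> C" for b c
    using assms(3) that by (auto simp: orthogonal_comp_def intro: span_base)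
  then have "orthogonal c b" if "b \<in> B" "c \<in> C" for b c
    using that by (simp add: orthogonal_commute)
  with orth show "orthonormal (B \<union> C)"
    using assms(1,2) by (auto simp: orthonormal_def pairwise_def)
  show "B \<inter> C = {}"
    using orth assms(1) by (fastforce simp: orthonormal_def orthogonal_def)
qed

text \<open>
  Complete the frame by a frame of \<open>S\<^sup>\<bottom>\<close>. Lebesgue measure becomes a product, and the slab of
  points within distance 1 of \<open>S\<close> is the product of \<open>S\<close> and the unit ball of \<open>S\<^sup>\<bottom>\<close>, whose
  volume is the factor on the right.
\<close>

lemma nn_integral_frame_measure_slab:
  fixes B :: "'a::euclidean_space set"
  assumes B: "orthonormal B" and S: "span B = S" and [measurable]: "h \<in> borel_measurable borel"
  shows "(\<integral>\<^sup>+y. h (closest_point S y) * indicator (cball 0 1) (y - closest_point S y) \<partial>lborel)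
    = ennreal (unit_ball_vol (real (DIM('a) - dim S))) * (\<integral>\<^sup>+x. h x \<partial>frame_measure B)"
proof -
  have sub: "subspace S" using S by (metis subspace_span)
  have [measurable]: "closest_point S \<in> borel_measurable borel"
    by (rule borel_measurable_closest_point[OF sub])
  obtain C where C: "orthonormal C" "span C = S\<^sup>\<bottom>"
    using subspace_orthonormal_basis[OF subspace_orthogonal_comp] by metis
  have BC: "orthonormal (B \<union> C)" "B \<inter> C = {}"
    using orthonormal_Un[OF B C(1)] by (auto simp: C S)
  have span: "span (B \<union> C) = UNIV"
  proof -
    have "x \<in> span (B \<union> C)" for x
    proof -
      have "closest_point S x + (x - closest_point S x) \<in> span (B \<union> C)"
        using closest_point_in_subspace[OF sub, of x] diff_closest_point_orthogonal[OF sub, of x]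
          span_mono[of B "B \<union> C"] span_mono[of C "B \<union> C"]
        by (intro span_add) (auto simp: S C)
      then show ?thesis by simp
    qed
    then show ?thesis by auto
  qed
  have card: "card C = DIM('a) - dim S"
  proof -
    have "card (B \<union> C) = DIM('a)"
      using orthonormal_card[OF BC(1)] span by (simp add: dim_UNIV)
    moreover have "card (B \<union> C) = dim S + card C"
      using BC(2) B C orthonormal_card[OF B] S
      by (subst card_Un_disjoint) (auto intro: orthonormal_finite)
    ultimately show ?thesis by simp
  qed
  have ball: "(\<integral>\<^sup>+z. indicator (cball 0 1) z \<partial>frame_measure C) = ennreal (unit_ball_vol (real (DIM('a) - dim S)))"
    using emeasure_frame_measure_cball[OF C(1), of 1] by (simp add: card)
  have [measurable]: "(indicator (cball 0 1) :: 'a \<Rightarrow> ennreal) \<in> borel_measurable borel"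
    by (intro borel_measurable_indicator) simp
  have "(\<integral>\<^sup>+y. h (closest_point S y) * indicator (cball 0 1) (y - closest_point S y) \<partial>lborel)
      = (\<integral>\<^sup>+x. (\<integral>\<^sup>+z. h (closest_point S (x + z)) * indicator (cball 0 1) (x + z - closest_point S (x + z))
          \<partial>frame_measure C) \<partial>frame_measure B)"
    unfolding frame_measure_whole_space[OF BC(1) span, symmetric]
    by (rule nn_integral_frame_measure_Un[OF B C(1) BC(2)]) measurable
  also have "\<dots> = (\<integral>\<^sup>+x. (\<integral>\<^sup>+z. h x * indicator (cball 0 1) z \<partial>frame_measure C) \<partial>frame_measure B)"
  proof (rule nn_integral_cong_AE)
    show "AE x in frame_measure B.
        (\<integral>\<^sup>+z. h (closest_point S (x + z)) * indicator (cball 0 1) (x + z - closest_point S (x + z)) \<partial>frame_measure C)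
      = (\<integral>\<^sup>+z. h x * indicator (cball 0 1) z \<partial>frame_measure C)"
      using AE_frame_measure_span[of B]
    proof eventually_elim
      case (elim x)
      show ?case
      proof (rule nn_integral_cong_AE)
        show "AE z in frame_measure C. h (closest_point S (x + z)) * indicator (cball 0 1) (x + z - closest_point S (x + z))
          = h x * indicator (cball 0 1) z"
          using AE_frame_measure_span[of C]
          by eventually_elim (use elim in \<open>simp add: closest_point_add_orthogonal[OF sub] S C\<close>)
      qed
    qed
  qed
  also have "\<dots> = (\<integral>\<^sup>+x. h x * ennreal (unit_ball_vol (real (DIM('a) - dim S))) \<partial>frame_measure B)"
    by (subst nn_integral_cmult) (simp_all add: ball del: nn_integral_indicator)
  also have "\<dots> = (\<integral>\<^sup>+x. h x \<partial>frame_measure B) * ennreal (unit_ball_vol (real (DIM('a) - dim S)))"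
    by (rule nn_integral_multc) simp
  finally show ?thesis by (simp add: mult.commute)
qed

section \<open>Lebesgue measure on a subspace\<close>

text \<open>
  The uncompleted version of \<^const>\<open>subspace_lebesgue\<close>: image measures, products and Fubini apply to it
  directly.
\<close>

definition plane_measure :: "'a::euclidean_space set \<Rightarrow> 'a measure" where
  "plane_measure S = frame_measure (SOME B. orthonormal_basis S B)"

lemma subspace_lebesgue_plane_measure: "subspace_lebesgue S = completion (plane_measure S)"
  by (simp add: subspace_lebesgue_def plane_measure_def frame_measure_def Let_def)

lemma sets_plane_measure [simp, measurable_cong]: "sets (plane_measure S) = sets borel"
  and space_plane_measure [simp]: "space (plane_measure S) = UNIV"
  by (simp_all add: plane_measure_def)

lemma plane_measure_frame:
  assumes "subspace S"
  obtains B where "orthonormal B" "span B = S" "plane_measure S = frame_measure B"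
proof -
  obtain B where "orthonormal_basis S B"
    using subspace_orthonormal_basis[OF assms] orthonormal_basis_iff by metis
  then have "orthonormal_basis S (SOME B. orthonormal_basis S B)" by (rule someI)
  then show ?thesis using that by (auto simp: orthonormal_basis_iff plane_measure_def)
qed

text \<open>
  The density on the whole space, supported in the slab of points within distance 1 of \<open>S\<close> and of total mass 1
  on each fibre of the orthogonal projection to \<open>S\<close>.
\<close>

definition slab_weight :: "'a::euclidean_space set \<Rightarrow> 'a \<Rightarrow> real" where
  "slab_weight S y =
     indicator (cball 0 1) (y - closest_point S y) / unit_ball_vol (real (DIM('a) - dim S))"

lemma slab_weight_nonneg: "0 \<le> slab_weight S y"
  by (simp add: slab_weight_def)

lemma borel_measurable_slab_weight:
  fixes S :: "'a::euclidean_space set"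
  assumes "subspace S"
  shows "slab_weight S \<in> borel_measurable borel"
proof -
  have [measurable]: "closest_point S \<in> borel_measurable borel"
    by (rule borel_measurable_closest_point[OF assms])
  have [measurable]: "(indicator (cball 0 1) :: 'a \<Rightarrow> real) \<in> borel_measurable borel"
    by (intro borel_measurable_indicator) simp
  show ?thesis unfolding slab_weight_def[abs_def] by measurable
qed

lemma frame_measure_slab:
  fixes B :: "'a::euclidean_space set"
  assumes B: "orthonormal B" and S: "span B = S"
  shows "frame_measure B = distr (density lborel (\<lambda>y. ennreal (slab_weight S y))) borel (closest_point S)"
proof (rule measure_eqI)
  fix E assume "E \<in> sets (frame_measure B)"
  then have [measurable]: "E \<in> sets borel" by simp
  have sub: "subspace S" using S by (metis subspace_span)
  let ?w = "unit_ball_vol (real (DIM('a) - dim S))"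
  have [measurable]: "closest_point S \<in> borel_measurable borel" "slab_weight S \<in> borel_measurable borel"
    by (simp_all add: borel_measurable_closest_point borel_measurable_slab_weight sub)
  have [measurable]: "(indicator (cball 0 1) :: 'a \<Rightarrow> ennreal) \<in> borel_measurable borel"
    by (intro borel_measurable_indicator) simp
  have "emeasure (distr (density lborel (\<lambda>y. ennreal (slab_weight S y))) borel (closest_point S)) E
    = (\<integral>\<^sup>+y. indicator E y \<partial>distr (density lborel (\<lambda>y. ennreal (slab_weight S y))) borel (closest_point S))"
    by simp
  also have "\<dots> = (\<integral>\<^sup>+y. ennreal (slab_weight S y) * indicator E (closest_point S y) \<partial>lborel)"
    by (subst nn_integral_distr, simp, simp, subst nn_integral_density) simp_all
  also have "\<dots> = (\<integral>\<^sup>+y. ennreal (1 / ?w) * (indicator E (closest_point S y) * indicator (cball 0 1) (y - closest_point S y)) \<partial>lborel)"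
    by (intro nn_integral_cong) (auto simp: slab_weight_def indicator_def)
  also have "\<dots> = ennreal (1 / ?w) * (ennreal ?w * (\<integral>\<^sup>+x. indicator E x \<partial>frame_measure B))"
    by (subst nn_integral_cmult) (simp_all add: nn_integral_frame_measure_slab[OF B S] del: nn_integral_indicator)
  also have "\<dots> = emeasure (frame_measure B) E"
    by (simp add: mult.assoc[symmetric] flip: ennreal_mult)
  finally show "emeasure (frame_measure B) E
    = emeasure (distr (density lborel (\<lambda>y. ennreal (slab_weight S y))) borel (closest_point S)) E" ..
qed simp

text \<open>
  The right-hand side mentions no basis. Hence so does everything derived from it: basis independence,
  orthogonal covariance and measurable dependence on the subspace.
\<close>

lemma plane_measure_slab:
  assumes "subspace S"
  shows "plane_measure S = distr (density lborel (\<lambda>y. ennreal (slab_weight S y))) borel (closest_point S)"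
  using plane_measure_frame[OF assms] frame_measure_slab by metis

lemma plane_measure_eq_frame_measure:
  assumes "orthonormal B" "span B = S"
  shows "plane_measure S = frame_measure B"
  using assms plane_measure_slab[of S] frame_measure_slab[OF assms] subspace_span by metis

lemma sigma_finite_plane_measure: "subspace S \<Longrightarrow> sigma_finite_measure (plane_measure S)"
  using plane_measure_frame sigma_finite_frame_measure by metis

lemma emeasure_plane_measure_cball:
  assumes "subspace S" "r > 0"
  shows "emeasure (plane_measure S) (cball 0 r) = ennreal (unit_ball_vol (real (dim S)) * r ^ dim S)"
  using plane_measure_frame[OF assms(1)] emeasure_frame_measure_cball[OF _ assms(2)] orthonormal_card by metis

lemma plane_measure_UNIV: "plane_measure UNIV = lborel"
  using plane_measure_frame[of UNIV] frame_measure_whole_space by (metis subspace_UNIV)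

lemma plane_measure_translation:
  assumes "subspace S" "u \<in> S"
  shows "distr (plane_measure S) borel ((+) u) = plane_measure S"
  using plane_measure_frame[OF assms(1)] frame_measure_translation assms(2) by metis

text \<open>
  Frames of orthogonal subspaces unite to a frame of their sum.
\<close>

lemma plane_measure_sum:
  fixes U T :: "'a::euclidean_space set"
  assumes U: "subspace U" and T: "subspace T" and orth: "T \<subseteq> U\<^sup>\<bottom>"
  shows "plane_measure (U + T) = distr (plane_measure U \<Otimes>\<^sub>M plane_measure T) borel (\<lambda>(x, y). x + y)"
proof -
  obtain B where B: "orthonormal B" "span B = U" "plane_measure U = frame_measure B"
    using plane_measure_frame[OF U] by metis
  obtain C where C: "orthonormal C" "span C = T" "plane_measure T = frame_measure C"
    using plane_measure_frame[OF T] by metis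
  have BC: "orthonormal (B \<union> C)" "B \<inter> C = {}"
    using orthonormal_Un[OF B(1) C(1)] B(2) C(2) orth by auto
  have "span (B \<union> C) = U + T"
    unfolding span_Un B C set_plus_def by auto
  then have "plane_measure (U + T) = frame_measure (B \<union> C)"
    by (rule plane_measure_eq_frame_measure[OF BC(1)])
  then show ?thesis
    by (simp add: frame_measure_Un B C BC)
qed

lemma closest_point_orthogonal_image:
  fixes S :: "'a::euclidean_space set" and T :: "'a \<Rightarrow> 'a"
  assumes T: "orthogonal_transformation T" and S: "subspace S"
  shows "closest_point (T ` S) (T y) = T (closest_point S y)"
proof -
  have lin: "linear T" using T by (rule orthogonal_transformation_linear)
  have TS: "subspace (T ` S)" using lin S by (rule linear_subspace_image)
  show ?thesis
  proof (rule closest_point_subspaceI[OF TS])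
    show "T (closest_point S y) \<in> T ` S" using closest_point_in_subspace[OF S] by blast
    show "T y - T (closest_point S y) \<in> (T ` S)\<^sup>\<bottom>"
      using diff_closest_point_orthogonal[OF S, of y] T
      by (auto simp: orthogonal_comp_def orthogonal_orthogonal_transformation simp flip: linear_diff[OF lin])
  qed
qed

text \<open>
  An orthogonal map carries the slab of \<open>S\<close> to the slab of its image and preserves Lebesgue measure.
\<close>

lemma plane_measure_orthogonal_image:
  fixes S :: "'a::euclidean_space set" and T :: "'a \<Rightarrow> 'a"
  assumes T: "orthogonal_transformation T" and S: "subspace S"
  shows "plane_measure (T ` S) = distr (plane_measure S) borel T"
proof -
  have lin: "linear T" using T by (rule orthogonal_transformation_linear)
  have TS: "subspace (T ` S)" using lin S by (rule linear_subspace_image)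
  have dim: "dim (T ` S) = dim S"
    using T by (intro dim_image_eq lin) (auto intro: orthogonal_transformation_inj inj_on_subset)
  have [measurable]: "T \<in> borel_measurable borel"
    using lin by (intro borel_measurable_continuous_onI linear_continuous_on linear_conv_bounded_linear[THEN iffD1])
  have [measurable]: "closest_point S \<in> borel_measurable borel" "slab_weight S \<in> borel_measurable borel"
    "closest_point (T ` S) \<in> borel_measurable borel" "slab_weight (T ` S) \<in> borel_measurable borel"
    by (simp_all add: borel_measurable_closest_point borel_measurable_slab_weight S TS)
  have weight: "slab_weight (T ` S) (T y) = slab_weight S y" for y
    by (simp add: slab_weight_def dim closest_point_orthogonal_image[OF T S] indicator_def
        orthogonal_transformation_norm[OF T] flip: linear_diff[OF lin])
  have "plane_measure (T ` S)
      = distr (density (distr lborel borel T) (\<lambda>y. ennreal (slab_weight (T ` S) y))) borel (closest_point (T ` S))"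
    by (simp add: plane_measure_slab[OF TS] lborel_isometry[OF T])
  also have "\<dots> = distr (distr (density lborel (\<lambda>y. ennreal (slab_weight S y))) borel T) borel (closest_point (T ` S))"
    by (subst density_distr) (simp_all add: weight)
  also have "\<dots> = distr (density lborel (\<lambda>y. ennreal (slab_weight S y))) borel (\<lambda>y. T (closest_point S y))"
    by (subst distr_distr) (simp_all add: comp_def closest_point_orthogonal_image[OF T S])
  also have "\<dots> = distr (plane_measure S) borel T"
    unfolding plane_measure_slab[OF S] by (subst distr_distr) (simp_all add: comp_def)
  finally show ?thesis .
qed

section \<open>Polar coordinates\<close>

text \<open>
  The volumes of the balls determine the distribution of the norm; the density is the derivative
  of the volume in the radius.
\<close>

lemma distr_norm_radial:
  fixes M :: "'a::euclidean_space measure"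
  assumes sets_M[measurable_cong]: "sets M = sets borel" and d: "d > 0" and w: "w \<ge> 0"
    and balls: "\<And>r. r > 0 \<Longrightarrow> emeasure M (cball 0 r) = ennreal (w * r ^ d)"
  shows "distr M borel norm = density lborel (\<lambda>r. ennreal (real d * w * r ^ (d - 1)) * indicator {0..} r)"
    (is "?M = ?N")
proof (rule measure_eqI_generator_eq[where E = "range atMost" and \<Omega> = UNIV and A = "\<lambda>i. {..real i}"])
  have space_M: "space M = UNIV" using sets_eq_imp_space_eq[OF sets_M] by simp
  have M_pos: "emeasure ?M {..r} = ennreal (w * r ^ d)" if "r > 0" for r
  proof -
    have "norm -` {..r} = cball (0::'a) r" by auto
    then show ?thesis by (subst emeasure_distr) (simp_all add: balls that space_M)
  qed
  have N: "emeasure ?N {..r} = ennreal (w * r ^ d)" if "r \<ge> 0" for r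
  proof -
    have "emeasure ?N {..r} = (\<integral>\<^sup>+x. ennreal (real d * w * x ^ (d - 1)) * indicator {0..r} x \<partial>lborel)"
      by (subst emeasure_density, simp, simp, intro nn_integral_cong) (auto simp: indicator_def)
    also have "\<dots> = ennreal (w * r ^ d - w * 0 ^ d)"
      by (rule nn_integral_FTC_Icc)
        (use that w in \<open>auto intro!: derivative_eq_intros mult_nonneg_nonneg simp: field_simps\<close>)
    finally show ?thesis using d by (simp add: power_0_left)
  qed
  have M_neg: "emeasure ?M {..r} = 0" and N_neg: "emeasure ?N {..r} = 0" if "r < 0" for r
  proof -
    have "norm -` {..r} = ({} :: 'a set)" using that by (auto simp: vimage_def) (smt (verit) norm_ge_zero)
    then show "emeasure ?M {..r} = 0" by (subst emeasure_distr) simp_all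
    have "emeasure ?N {..r} = (\<integral>\<^sup>+x. 0 \<partial>(lborel :: real measure))"
      using that by (subst emeasure_density, simp, simp, intro nn_integral_cong) (auto simp: indicator_def)
    then show "emeasure ?N {..r} = 0" by simp
  qed
  have M_0: "emeasure ?M {..0} = 0"
  proof -
    \<comment> \<open>The origin is a null set because the balls around it shrink to volume 0; here \<open>d > 0\<close> enters.\<close>
    have small: "emeasure ?M {..0} \<le> ennreal e" if "e > 0" for e :: real
    proof -
      have "((\<lambda>r. w * r ^ d) \<longlongrightarrow> w * 0 ^ d) (at_right 0)" by (intro tendsto_intros)
      then have "eventually (\<lambda>r. w * r ^ d < e) (at_right 0)"
        by (rule order_tendstoD(2)) (use d that in \<open>simp add: power_0_left\<close>)
      then have "eventually (\<lambda>r. 0 < r \<and> w * r ^ d < e) (at_right 0)"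
        using eventually_at_right_less[of "0::real"] by (rule eventually_conj[rotated])
      then obtain r where r: "r > 0" "w * r ^ d < e"
        using eventually_happens'[OF trivial_limit_at_right_real] by blast
      have "emeasure ?M {..0} \<le> emeasure ?M {..r}" using r by (intro emeasure_mono) auto
      also have "\<dots> \<le> ennreal e" using r by (simp add: M_pos ennreal_leI)
      finally show ?thesis .
    qed
    have "emeasure ?M {..0} \<le> 0"
    proof (rule ennreal_le_epsilon)
      fix e :: real assume "0 < e"
      then show "emeasure ?M {..0} \<le> 0 + ennreal e" unfolding add_0 by (rule small)
    qed
    then show ?thesis by simp
  qed
  have M: "emeasure ?M {..r} = ennreal (w * r ^ d)" if "r \<ge> 0" for r
    using that M_0 M_pos[of r] d by (cases "r = 0") (auto simp: power_0_left)
  show "emeasure ?M X = emeasure ?N X" if X: "X \<in> range atMost" for X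
  proof -
    obtain r where "X = {..r}" using X by blast
    then show ?thesis using M[of r] N[of r] M_neg[of r] N_neg[of r] by (cases "r < 0") auto
  qed
  show "Int_stable (range (atMost :: real \<Rightarrow> real set))" by (auto simp: Int_stable_def)
  show "(\<Union>i. {..real i}) = UNIV" by (auto intro: real_arch_simple)
  show "emeasure ?M {..real i} \<noteq> \<infinity>" for i by (simp add: M)
qed (auto simp: borel_eq_atMost)

text \<open>
  The surface area of the unit sphere in dimension \<open>m\<close> divided by the one in dimension \<open>n\<close>: the area of
  a unit sphere is the dimension times the volume of the ball.
\<close>

definition sphere_ratio :: "nat \<Rightarrow> nat \<Rightarrow> real" where
  "sphere_ratio m n = (real m * unit_ball_vol (real m)) / (real n * unit_ball_vol (real n))"

text \<open>
  On \<open>S\<close> and on the whole space the norm has densities proportional to \<open>r^(dim S - 1)\<close> and \<open>r^(n - 1)\<close>; the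
  weight on the right is their quotient.
\<close>

lemma nn_integral_plane_measure_radial:
  fixes S :: "'a::euclidean_space set"
  assumes S: "subspace S" and m: "dim S > 0" and [measurable]: "\<phi> \<in> borel_measurable borel"
  shows "(\<integral>\<^sup>+z. \<phi> (norm z) \<partial>plane_measure S)
    = (\<integral>\<^sup>+z. ennreal (sphere_ratio (dim S) DIM('a) * norm z powr (real (dim S) - real DIM('a))) * \<phi> (norm z) \<partial>(lborel :: 'a measure))"
proof -
  let ?m = "dim S" and ?n = "DIM('a)"
  let ?d = "\<lambda>d r. ennreal (real d * unit_ball_vol (real d) * r ^ (d - 1)) * indicator {0..} r"
  have n: "?n > 0" by simp
  have radial: "(\<integral>\<^sup>+z. \<psi> (norm z) \<partial>plane_measure T) = (\<integral>\<^sup>+r. ?d (dim T) r * \<psi> r \<partial>lborel)"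
    if T: "subspace T" "dim T > 0" and [measurable]: "\<psi> \<in> borel_measurable borel" for T :: "'a set" and \<psi>
  proof -
    have "(\<integral>\<^sup>+z. \<psi> (norm z) \<partial>plane_measure T) = (\<integral>\<^sup>+r. \<psi> r \<partial>distr (plane_measure T) borel norm)"
      by (subst nn_integral_distr) simp_all
    also have "\<dots> = (\<integral>\<^sup>+r. ?d (dim T) r * \<psi> r \<partial>lborel)"
      by (subst distr_norm_radial[OF _ T(2) _ emeasure_plane_measure_cball[OF T(1)]], simp, simp, simp)
        (subst nn_integral_density, simp_all)
    finally show ?thesis .
  qed
  have pointwise: "?d ?m r * \<phi> r
      = ?d ?n r * (ennreal (sphere_ratio ?m ?n * r powr (real ?m - real ?n)) * \<phi> r)" if "r \<noteq> 0" for r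
  proof (cases "r < 0")
    case False
    with that have r: "r > 0" by simp
    have "r powr (real ?m - real ?n) * r ^ (?n - 1) = r powr (real ?m - real ?n + real (?n - 1))"
      using r by (simp only: powr_add powr_realpow)
    also have "real ?m - real ?n + real (?n - 1) = real (?m - 1)"
      using m n by (subst (1 2) of_nat_diff) auto
    finally have "r powr (real ?m - real ?n) * r ^ (?n - 1) = r ^ (?m - 1)"
      using r by (simp add: powr_realpow)
    then have "real ?m * unit_ball_vol (real ?m) * r ^ (?m - 1)
      = (real ?n * unit_ball_vol (real ?n) * r ^ (?n - 1)) * (sphere_ratio ?m ?n * r powr (real ?m - real ?n))"
      by (simp add: sphere_ratio_def field_simps)
    moreover have "sphere_ratio ?m ?n \<ge> 0" by (simp add: sphere_ratio_def)
    ultimately show ?thesis using r by (simp add: ennreal_mult mult.assoc)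
  qed (simp add: indicator_def)
  have "(\<integral>\<^sup>+z. \<phi> (norm z) \<partial>plane_measure S) = (\<integral>\<^sup>+r. ?d ?m r * \<phi> r \<partial>lborel)"
    using radial[OF S m] by simp
  also have "\<dots> = (\<integral>\<^sup>+r. ?d ?n r * (ennreal (sphere_ratio ?m ?n * r powr (real ?m - real ?n)) * \<phi> r) \<partial>lborel)"
    by (intro nn_integral_cong_AE eventually_mono[OF AE_lborel_singleton[of "0::real"]] pointwise)
  also have "\<dots> = (\<integral>\<^sup>+z. ennreal (sphere_ratio ?m ?n * norm z powr (real ?m - real ?n)) * \<phi> (norm z) \<partial>plane_measure (UNIV :: 'a set))"
    using radial[OF subspace_UNIV, of "\<lambda>r. ennreal (sphere_ratio ?m ?n * r powr (real ?m - real ?n)) * \<phi> r", symmetric]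
    by (simp add: dim_UNIV)
  finally show ?thesis by (simp add: plane_measure_UNIV)
qed

section \<open>Matrices as a normed algebra\<close>

text \<open>
  The norm on matrices is the Frobenius norm, so this is the Cauchy-Schwarz inequality applied to
  each entry of the product.
\<close>

lemma norm_matrix_matrix_mult_le:
  fixes A B :: "real^'n^'n"
  shows "norm (A ** B) \<le> norm A * norm B"
proof -
  have row: "norm ((A ** B) $ i) \<le> norm (A $ i) * norm B" for i
  proof -
    have B: "norm B = norm (transpose B)"
      unfolding norm_eq_sqrt_inner inner_vec_def transpose_def
      by (simp add: sum.swap[of "\<lambda>i j. (B $ i $ j) * (B $ i $ j)"])
    have "norm ((A ** B) $ i) = L2_set (\<lambda>j. \<bar>(A $ i) \<bullet> (transpose B $ j)\<bar>) UNIV"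
      by (simp add: norm_vec_def matrix_matrix_mult_def inner_vec_def transpose_def)
    also have "\<dots> \<le> L2_set (\<lambda>j. norm (A $ i) * norm (transpose B $ j)) UNIV"
      by (intro L2_set_mono Cauchy_Schwarz_ineq2) auto
    also have "\<dots> = norm (A $ i) * norm (transpose B)"
      by (simp add: norm_vec_def[of "transpose B"] L2_set_right_distrib)
    finally show ?thesis using B by simp
  qed
  have "norm (A ** B) = L2_set (\<lambda>i. norm ((A ** B) $ i)) UNIV" by (simp add: norm_vec_def)
  also have "\<dots> \<le> L2_set (\<lambda>i. norm (A $ i) * norm B) UNIV"
    by (intro L2_set_mono row) auto
  also have "\<dots> = norm A * norm B"
    by (simp add: norm_vec_def[of A] L2_set_left_distrib)
  finally show ?thesis .
qed

lemma bounded_bilinear_matrix_mult: "bounded_bilinear ((**) :: real^'n^'n \<Rightarrow> real^'n^'n \<Rightarrow> real^'n^'n)"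
proof
  show "\<exists>K. \<forall>(A :: real^'n^'n) (B :: real^'n^'n). norm (A ** B) \<le> norm A * norm B * K"
    using norm_matrix_matrix_mult_le by (intro exI[of _ 1]) auto
qed (simp_all add: matrix_matrix_mult_def vec_eq_iff sum.distrib algebra_simps sum_distrib_left)

interpretation matrix_mult: bounded_bilinear "(**) :: real^'n^'n \<Rightarrow> real^'n^'n \<Rightarrow> real^'n^'n"
  by (rule bounded_bilinear_matrix_mult)

lemma bounded_linear_transpose: "bounded_linear (transpose :: real^'n^'n \<Rightarrow> real^'n^'n)"
  by (intro linear_conv_bounded_linear[THEN iffD1] linearI) (simp_all add: transpose_def vec_eq_iff)

lemmas transpose_add = linear_add[OF bounded_linear.linear[OF bounded_linear_transpose]]
  and transpose_diff = linear_diff[OF bounded_linear.linear[OF bounded_linear_transpose]]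
  and transpose_scaleR = linear_cmul[OF bounded_linear.linear[OF bounded_linear_transpose]]

lemma borel_measurable_matrix_mult [measurable]:
  fixes f g :: "'a \<Rightarrow> real^'n^'n"
  assumes "f \<in> borel_measurable M" "g \<in> borel_measurable M"
  shows "(\<lambda>x. f x ** g x) \<in> borel_measurable M"
  using assms by (rule borel_measurable_continuous_Pair) (intro matrix_mult.continuous_on continuous_intros)

lemma borel_measurable_matrix_vector_mult [measurable]:
  fixes f :: "'a \<Rightarrow> real^'n^'n" and g :: "'a \<Rightarrow> real^'n"
  assumes [measurable]: "f \<in> borel_measurable M" "g \<in> borel_measurable M"
  shows "(\<lambda>x. f x *v g x) \<in> borel_measurable M"
  using assms by (rule borel_measurable_continuous_Pair)
    (unfold matrix_vector_mult_def, intro continuous_intros)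

lemma borel_measurable_transpose [measurable]:
  fixes f :: "'a \<Rightarrow> real^'n^'n"
  assumes "f \<in> borel_measurable M"
  shows "(\<lambda>x. transpose (f x)) \<in> borel_measurable M"
  using borel_measurable_continuous_onI[OF linear_continuous_on[OF bounded_linear_transpose]] assms
  by (rule measurable_compose[rotated])

lemma norm_matrix_power2: "(norm (B :: real^'n^'n))\<^sup>2 = trace (transpose B ** B)"
proof -
  have "(norm B)\<^sup>2 = (\<Sum>i\<in>UNIV. \<Sum>j\<in>UNIV. B $ i $ j * B $ i $ j)"
    by (simp add: power2_norm_eq_inner inner_vec_def)
  also have "\<dots> = (\<Sum>j\<in>UNIV. \<Sum>i\<in>UNIV. B $ i $ j * B $ i $ j)" by (rule sum.swap)
  finally show ?thesis by (simp add: trace_def matrix_matrix_mult_def transpose_def)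
qed

lemma orthogonal_groupD:
  "A \<in> orthogonal_group \<Longrightarrow> transpose A ** A = mat 1"
  "A \<in> orthogonal_group \<Longrightarrow> A ** transpose A = mat 1"
  by (simp_all add: orthogonal_group_def orthogonal_matrix_def)

lemma orthogonal_group_closed:
  shows mat_1_orthogonal_group: "mat 1 \<in> orthogonal_group"
    and mult_orthogonal_group: "A \<in> orthogonal_group \<Longrightarrow> B \<in> orthogonal_group \<Longrightarrow> A ** B \<in> orthogonal_group"
    and transpose_orthogonal_group: "A \<in> orthogonal_group \<Longrightarrow> transpose A \<in> orthogonal_group"
  by (simp_all add: orthogonal_group_def orthogonal_matrix_id orthogonal_matrix_mul orthogonal_matrix_transpose)

lemma orthogonal_group_transformation:
  "A \<in> orthogonal_group \<Longrightarrow> orthogonal_transformation ((*v) A)"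
  by (simp add: orthogonal_group_def orthogonal_transformation_matrix)

text \<open>
  Thus left multiplication by \<open>A\<close> preserves Lebesgue measure on the space of matrices.
\<close>

lemma orthogonal_transformation_left_mult:
  assumes "A \<in> orthogonal_group"
  shows "orthogonal_transformation ((**) A :: real^'n^'n \<Rightarrow> real^'n^'n)"
proof -
  have "(norm (A ** B))\<^sup>2 = (norm B)\<^sup>2" for B :: "real^'n^'n"
  proof -
    have "transpose (A ** B) ** (A ** B) = transpose B ** (transpose A ** A) ** B"
      by (simp add: matrix_transpose_mul matrix_mul_assoc)
    then show ?thesis by (simp add: norm_matrix_power2 orthogonal_groupD[OF assms])
  qed
  then show ?thesis
    unfolding orthogonal_transformation
    by (auto intro: matrix_mult.bounded_linear_right bounded_linear.linear)
qed

section \<open>The orthogonal polar factor of a matrix\<close>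

text \<open>
  The defect measures the failure of orthogonality. It is unchanged under multiplication by orthogonal matrices from the
  left, hence everything built from \<open>B\<close> and \<open>gram_defect B\<close> is equivariant under it.
\<close>

definition gram_defect :: "real^'n^'n \<Rightarrow> real^'n^'n" where
  "gram_defect B = mat 1 - transpose B ** B"

text \<open>
  The Newton-Schulz step \<open>B (3 - B\<^sup>T B) / 2\<close> towards the orthogonal polar factor \<open>B (B\<^sup>T B)\<^sup>-\<^sup>1\<^sup>/\<^sup>2\<close>. It needs
  neither inverses nor square roots, so equivariance, commutation and measurability are immediate.
\<close>

definition newton_polar :: "real^'n^'n \<Rightarrow> real^'n^'n" where
  "newton_polar B = B ** (mat 1 + (1/2) *\<^sub>R gram_defect B)"

lemma gram_defect_left_mult:
  assumes "A \<in> orthogonal_group"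
  shows "gram_defect (A ** B) = gram_defect B"
proof -
  have "transpose (A ** B) ** (A ** B) = transpose B ** (transpose A ** A) ** B"
    by (simp add: matrix_transpose_mul matrix_mul_assoc)
  then show ?thesis by (simp add: gram_defect_def orthogonal_groupD[OF assms])
qed

lemma newton_polar_left_mult:
  "A \<in> orthogonal_group \<Longrightarrow> newton_polar (A ** B) = A ** newton_polar B"
  by (simp add: newton_polar_def gram_defect_left_mult matrix_mul_assoc)

text \<open>
  With \<open>F\<close> half the defect, \<open>B\<^sup>T B = 1 - 2 F\<close> and the new Gram matrix is \<open>(1 + F) (1 - 2 F) (1 + F)\<close>; the
  terms linear in \<open>F\<close> cancel.
\<close>

lemma gram_defect_newton_polar:
  "gram_defect (newton_polar B)
    = (3/4) *\<^sub>R (gram_defect B ** gram_defect B)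
      + (1/4) *\<^sub>R (gram_defect B ** gram_defect B ** gram_defect B)"
proof -
  define F where "F = (1/2) *\<^sub>R gram_defect B"
  have F: "transpose F = F"
    by (simp add: F_def gram_defect_def transpose_scaleR transpose_diff matrix_transpose_mul transpose_mat)
  have gram: "transpose B ** B = mat 1 - 2 *\<^sub>R F"
    by (simp add: F_def gram_defect_def)
  have "transpose (newton_polar B) ** newton_polar B
      = (mat 1 + F) ** (transpose B ** B) ** (mat 1 + F)"
    unfolding newton_polar_def F_def[symmetric]
    by (simp add: matrix_transpose_mul transpose_add F transpose_mat matrix_mul_assoc)
  also have "\<dots> = mat 1 - 3 *\<^sub>R (F ** F) - 2 *\<^sub>R (F ** F ** F)"
    unfolding gram
    by (simp add: matrix_mult.add_left matrix_mult.add_right matrix_mult.diff_left matrix_mult.diff_right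
        matrix_mult.scaleR_left matrix_mult.scaleR_right matrix_mul_assoc)
      (simp add: vec_eq_iff)
  finally have "gram_defect (newton_polar B) = 3 *\<^sub>R (F ** F) + 2 *\<^sub>R (F ** F ** F)"
    by (simp add: gram_defect_def)
  then show ?thesis
    by (simp add: F_def matrix_mult.scaleR_left matrix_mult.scaleR_right)
qed

lemma norm_gram_defect_newton_polar:
  assumes "norm (gram_defect B) \<le> 1/2"
  shows "norm (gram_defect (newton_polar B)) \<le> norm (gram_defect B) / 2"
proof -
  let ?E = "gram_defect B"
  have 2: "norm (?E ** ?E) \<le> norm ?E * (1/2)"
    using norm_matrix_matrix_mult_le[of ?E ?E] assms
    by (smt (verit) mult_left_mono norm_ge_zero)
  have 3: "norm (?E ** ?E ** ?E) \<le> norm ?E * (1/2)"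
  proof -
    have "norm (?E ** ?E ** ?E) \<le> norm (?E ** ?E) * norm ?E" by (rule norm_matrix_matrix_mult_le)
    also have "\<dots> \<le> norm (?E ** ?E) * 1" using assms by (intro mult_left_mono) auto
    finally show ?thesis using 2 by simp
  qed
  have "norm (gram_defect (newton_polar B)) \<le> 3/4 * norm (?E ** ?E) + 1/4 * norm (?E ** ?E ** ?E)"
    unfolding gram_defect_newton_polar by (rule norm_triangle_le) simp
  also have "\<dots> \<le> norm ?E / 2" using 2 3 by simp
  finally show ?thesis .
qed

text \<open>
  The squared Frobenius norm is the trace of the Gram matrix. A crude bound that is uniform along
  the iteration is all that convergence requires.
\<close>

lemma norm_le_gram_defect:
  fixes B :: "real^'n^'n"
  assumes "norm (gram_defect B) \<le> 1"
  shows "norm B \<le> 2 * real CARD('n)"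
proof -
  have entry: "\<bar>gram_defect B $ i $ i\<bar> \<le> 1" for i
    using assms Finite_Cartesian_Product.norm_nth_le[of "gram_defect B" i]
      Finite_Cartesian_Product.norm_nth_le[of "gram_defect B $ i" i] by (simp add: real_norm_def)
  have "(norm B)\<^sup>2 = (\<Sum>i\<in>UNIV. 1 - gram_defect B $ i $ i)"
    by (simp add: norm_matrix_power2 trace_def gram_defect_def mat_def)
  also have "\<dots> \<le> (\<Sum>i\<in>(UNIV::'n set). 2)"
    using entry by (intro sum_mono) (smt (verit))
  also have "\<dots> \<le> (2 * real CARD('n))\<^sup>2"
  proof -
    have "1 \<le> real CARD('n)" by (simp add: Suc_leI)
    then have "real CARD('n) * 1 \<le> real CARD('n) * real CARD('n)" by (intro mult_left_mono) auto
    then have "real CARD('n) * 2 \<le> 4 * (real CARD('n) * real CARD('n))" by linarith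
    moreover have "(2 * real CARD('n))\<^sup>2 = 4 * (real CARD('n) * real CARD('n))"
      by (simp add: power2_eq_square)
    ultimately show ?thesis by (simp only: sum_constant)
  qed
  finally show ?thesis by (rule power2_le_imp_le) simp
qed

definition polar :: "real^'n^'n \<Rightarrow> real^'n^'n" where
  "polar B = lim (\<lambda>k. (newton_polar ^^ k) B)"

lemma norm_gram_defect_iterate:
  assumes "norm (gram_defect B) \<le> 1/2"
  shows "norm (gram_defect ((newton_polar ^^ k) B)) \<le> (1/2) ^ Suc k"
proof (induction k)
  case (Suc k)
  have "norm (gram_defect ((newton_polar ^^ k) B)) \<le> 1/2"
    using Suc power_le_one[of "1/2::real" k] by simp
  from norm_gram_defect_newton_polar[OF this] Suc show ?case by simp
qed (use assms in simp)

text \<open>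
  Each step at least halves the defect, so the increments are dominated by a geometric series.
\<close>

lemma newton_polar_converges:
  fixes B :: "real^'n^'n"
  assumes B: "norm (gram_defect B) \<le> 1/2"
  shows "(\<lambda>k. (newton_polar ^^ k) B) \<longlonglongrightarrow> polar B"
proof -
  let ?B = "\<lambda>k. (newton_polar ^^ k) B"
  let ?c = "2 * real CARD('n)"
  have step: "norm (?B (Suc k) - ?B k) \<le> ?c * (1/2) ^ k" for k
  proof -
    have e: "norm (gram_defect (?B k)) \<le> (1/2) ^ Suc k" by (rule norm_gram_defect_iterate[OF B])
    have pow: "(1/2::real) ^ Suc k \<le> 1" by (rule power_le_one) auto
    have "?B (Suc k) - ?B k = ?B k ** ((1/2) *\<^sub>R gram_defect (?B k))"
      by (simp add: newton_polar_def matrix_mult.add_right)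
    then have "norm (?B (Suc k) - ?B k) \<le> norm (?B k) * norm ((1/2) *\<^sub>R gram_defect (?B k))"
      by (metis norm_matrix_matrix_mult_le)
    also have "\<dots> \<le> ?c * (1/2) ^ k"
    proof (intro mult_mono)
      show "norm (?B k) \<le> ?c" using e pow by (intro norm_le_gram_defect) linarith
      have "(1/2::real) ^ Suc k \<le> 2 * (1/2) ^ k" by simp
      with e have "norm (gram_defect (?B k)) \<le> 2 * (1/2) ^ k" by linarith
      then show "norm ((1/2) *\<^sub>R gram_defect (?B k)) \<le> (1/2) ^ k" by simp
    qed auto
    finally show ?thesis .
  qed
  have "summable (\<lambda>k. ?c * (1/2::real) ^ k)" by (intro summable_mult summable_geometric) simp
  then have "summable (\<lambda>k. ?B (Suc k) - ?B k)"
    by (rule summable_comparison_test'[where N = 0]) (rule step)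
  then have "convergent (\<lambda>n. \<Sum>k<n. ?B (Suc k) - ?B k)"
    by (simp add: summable_iff_convergent)
  then have "convergent (\<lambda>n. ?B n - ?B 0)" by (simp only: sum_lessThan_telescope[of ?B])
  then have "convergent (\<lambda>n. (?B n - ?B 0) + ?B 0)"
    by (rule convergent_add) (rule convergent_const)
  then show ?thesis by (simp add: polar_def convergent_LIMSEQ_iff)
qed

lemma polar_orthogonal:
  assumes B: "norm (gram_defect B) \<le> 1/2"
  shows "polar B \<in> orthogonal_group"
proof -
  let ?B = "\<lambda>k. (newton_polar ^^ k) B"
  have "(\<lambda>k. gram_defect (?B k)) \<longlonglongrightarrow> gram_defect (polar B)"
    unfolding gram_defect_def
    by (intro tendsto_intros matrix_mult.tendsto bounded_linear.tendsto[OF bounded_linear_transpose] newton_polar_converges[OF B])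
  moreover have "(\<lambda>k. gram_defect (?B k)) \<longlonglongrightarrow> 0"
  proof (rule Lim_null_comparison)
    show "\<forall>\<^sub>F k in sequentially. norm (gram_defect (?B k)) \<le> (1/2) ^ Suc k"
      using norm_gram_defect_iterate[OF B] by auto
    show "(\<lambda>k. (1/2::real) ^ Suc k) \<longlonglongrightarrow> 0"
      by (intro LIMSEQ_Suc LIMSEQ_power_zero) simp
  qed
  ultimately have "gram_defect (polar B) = 0" by (rule LIMSEQ_unique)
  then have "transpose (polar B) ** polar B = mat 1" by (simp add: gram_defect_def)
  then show ?thesis by (simp add: orthogonal_group_def orthogonal_matrix)
qed

lemma polar_left_mult:
  assumes A: "A \<in> orthogonal_group" and B: "norm (gram_defect B) \<le> 1/2"
  shows "polar (A ** B) = A ** polar B"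
proof -
  have iter: "(newton_polar ^^ k) (A ** B) = A ** (newton_polar ^^ k) B" for k
    by (induction k) (simp_all add: newton_polar_left_mult[OF A])
  have "(\<lambda>k. A ** (newton_polar ^^ k) B) \<longlonglongrightarrow> A ** polar B"
    by (intro matrix_mult.tendsto tendsto_const newton_polar_converges[OF B])
  then show ?thesis unfolding polar_def[of "A ** B"] iter by (rule limI)
qed

text \<open>
  The iteration consists of sums and products of \<open>B\<close> and its transpose, and the transpose commutes with
  a symmetric \<open>P\<close> when \<open>B\<close> does.
\<close>

lemma polar_commute:
  assumes P: "transpose P = P" and BP: "B ** P = P ** B" and B: "norm (gram_defect B) \<le> 1/2"
  shows "polar B ** P = P ** polar B"
proof -
  have step: "newton_polar C ** P = P ** newton_polar C" if C: "C ** P = P ** C" for C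
  proof -
    have CT: "P ** transpose C = transpose C ** P"
      using arg_cong[OF C, of transpose] by (simp add: matrix_transpose_mul P)
    have "transpose C ** C ** P = P ** (transpose C ** C)"
      by (metis C CT matrix_mul_assoc)
    then have "gram_defect C ** P = P ** gram_defect C"
      by (simp add: gram_defect_def matrix_mult.diff_left matrix_mult.diff_right)
    then have "(mat 1 + (1/2) *\<^sub>R gram_defect C) ** P = P ** (mat 1 + (1/2) *\<^sub>R gram_defect C)"
      by (simp add: matrix_mult.add_left matrix_mult.add_right matrix_mult.scaleR_left matrix_mult.scaleR_right)
    then show ?thesis unfolding newton_polar_def by (metis C matrix_mul_assoc)
  qed
  have iter: "(newton_polar ^^ k) B ** P = P ** (newton_polar ^^ k) B" for k
    by (induction k) (simp_all add: BP step)
  have "(\<lambda>k. (newton_polar ^^ k) B ** P) \<longlonglongrightarrow> polar B ** P"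
    "(\<lambda>k. P ** (newton_polar ^^ k) B) \<longlonglongrightarrow> P ** polar B"
    by (intro matrix_mult.tendsto tendsto_const newton_polar_converges[OF B])+
  then show ?thesis unfolding iter by (rule LIMSEQ_unique)
qed

lemma borel_measurable_gram_defect [measurable]: "gram_defect \<in> borel_measurable borel"
  unfolding gram_defect_def[abs_def] by measurable

lemma borel_measurable_newton_polar [measurable]: "newton_polar \<in> borel_measurable borel"
  unfolding newton_polar_def[abs_def] by measurable

lemma borel_measurable_polar [measurable]: "polar \<in> borel_measurable borel"
proof -
  have [measurable]: "(\<lambda>B. (newton_polar ^^ k) B) \<in> borel_measurable borel" for k
    by (induction k) (simp_all add: comp_def)
  show ?thesis unfolding polar_def[abs_def] by (rule borel_measurable_lim_metric) measurable
qed

declare transpose_matrix_vector [simp del]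

section \<open>Rotations that preserve a subspace\<close>

definition proj_matrix :: "(real^'n) set \<Rightarrow> real^'n^'n" where
  "proj_matrix X = matrix (closest_point X)"

lemma proj_matrix_mult_vec:
  "subspace X \<Longrightarrow> proj_matrix X *v x = closest_point X x"
  by (simp add: proj_matrix_def linear_closest_point matrix_works)

lemma proj_matrix_idempotent:
  assumes "subspace X"
  shows "proj_matrix X ** proj_matrix X = proj_matrix X"
  unfolding matrix_eq
  by (simp add: proj_matrix_mult_vec assms closest_point_self closest_point_in_subspace
      flip: matrix_vector_mul_assoc)

lemma proj_matrix_symmetric:
  fixes X :: "(real^'n) set"
  assumes X: "subspace X"
  shows "transpose (proj_matrix X) = proj_matrix X"
proof -
  let ?p = "closest_point X"
  have "?p x \<bullet> y = x \<bullet> ?p y" for x y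
  proof -
    have "?p x \<bullet> (y - ?p y) = 0" "?p y \<bullet> (x - ?p x) = 0"
      using closest_point_in_subspace[OF X] diff_closest_point_orthogonal[OF X]
      by (auto simp: orthogonal_comp_def orthogonal_def)
    then show ?thesis by (simp add: inner_diff_right inner_commute)
  qed
  then have "z \<bullet> (transpose (proj_matrix X) *v y) = z \<bullet> (proj_matrix X *v y)" for y z
    by (metis X dot_lmul_matrix inner_commute proj_matrix_mult_vec transpose_matrix_vector)
  then have "transpose (proj_matrix X) *v y = proj_matrix X *v y" for y
    by (metis vector_eq_ldot)
  then show ?thesis by (simp add: matrix_eq)
qed

lemma mult_vec_image_compose: "(*v) (A ** B) ` X = (*v) A ` ((*v) B ` X)"
  by (simp add: image_image matrix_vector_mul_assoc)

lemma subspace_mult_vec_image: "subspace X \<Longrightarrow> subspace ((*v) A ` X)"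
  for A :: "real^'n^'m"
  by (intro linear_subspace_image matrix_vector_mul_linear)

lemma proj_matrix_orthogonal_image:
  fixes X :: "(real^'n) set"
  assumes A: "A \<in> orthogonal_group" and X: "subspace X"
  shows "proj_matrix ((*v) A ` X) = A ** proj_matrix X ** transpose A"
  unfolding matrix_eq
proof
  fix y
  have y: "y = A *v (transpose A *v y)"
    by (simp add: matrix_vector_mul_assoc orthogonal_groupD[OF A])
  have "proj_matrix ((*v) A ` X) *v y = closest_point ((*v) A ` X) (A *v (transpose A *v y))"
    using y by (simp add: proj_matrix_mult_vec[OF subspace_mult_vec_image[OF X]])
  also have "\<dots> = A *v closest_point X (transpose A *v y)"
    by (rule closest_point_orthogonal_image[OF orthogonal_group_transformation[OF A] X])
  finally show "proj_matrix ((*v) A ` X) *v y = A ** proj_matrix X ** transpose A *v y"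
    by (simp add: proj_matrix_mult_vec[OF X] flip: matrix_vector_mul_assoc)
qed

definition stabilizer :: "(real^'n) set \<Rightarrow> (real^'n^'n) set" where
  "stabilizer X = {A \<in> orthogonal_group. (*v) A ` X = X}"

lemma stabilizerD: "A \<in> stabilizer X \<Longrightarrow> A \<in> orthogonal_group" "A \<in> stabilizer X \<Longrightarrow> (*v) A ` X = X"
  by (auto simp: stabilizer_def)

lemma stabilizer_closed:
  shows mat_1_stabilizer: "mat 1 \<in> stabilizer X"
    and mult_stabilizer: "A \<in> stabilizer X \<Longrightarrow> B \<in> stabilizer X \<Longrightarrow> A ** B \<in> stabilizer X"
    and transpose_stabilizer: "A \<in> stabilizer X \<Longrightarrow> transpose A \<in> stabilizer X"
proof -
  show "transpose A \<in> stabilizer X" if A: "A \<in> stabilizer X"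
  proof -
    have "(*v) (transpose A) ` X = (*v) (transpose A) ` ((*v) A ` X)" using A by (simp add: stabilizerD)
    also have "\<dots> = (*v) (transpose A ** A) ` X" by (simp only: mult_vec_image_compose)
    also have "\<dots> = X" using A by (simp add: orthogonal_groupD stabilizerD)
    finally show ?thesis using A by (simp add: stabilizer_def transpose_orthogonal_group)
  qed
qed (simp_all add: stabilizer_def mat_1_orthogonal_group mult_orthogonal_group mult_vec_image_compose)

lemma stabilizer_UNIV: "stabilizer UNIV = orthogonal_group"
  by (auto simp: stabilizer_def dest: orthogonal_group_transformation orthogonal_transformation_surj)

text \<open>
  A characterisation by an algebraic equation, which passes to limits.
\<close>

lemma stabilizer_iff_commute:
  assumes A: "A \<in> orthogonal_group" and X: "subspace X"
  shows "A \<in> stabilizer X \<longleftrightarrow> A ** proj_matrix X = proj_matrix X ** A"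
proof
  assume "A \<in> stabilizer X"
  then have "proj_matrix X ** A = A ** proj_matrix X ** (transpose A ** A)"
    using proj_matrix_orthogonal_image[OF A X] by (simp add: stabilizerD matrix_mul_assoc)
  then show "A ** proj_matrix X = proj_matrix X ** A" by (simp add: orthogonal_groupD[OF A])
next
  have sub: "(*v) C ` X \<subseteq> X" if C: "C ** proj_matrix X = proj_matrix X ** C" for C
  proof
    fix y assume "y \<in> (*v) C ` X"
    then obtain x where x: "x \<in> X" "y = C *v x" by auto
    have "closest_point X x = x"
      using x by (intro closest_point_subspaceI[OF X]) (simp_all add: subspace_0 subspace_orthogonal_comp)
    then have "y = (C ** proj_matrix X) *v x"
      by (simp add: x proj_matrix_mult_vec[OF X] flip: matrix_vector_mul_assoc)
    also have "\<dots> = closest_point X (C *v x)"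
      unfolding C by (simp add: proj_matrix_mult_vec[OF X] flip: matrix_vector_mul_assoc)
    finally show "y \<in> X" using closest_point_in_subspace[OF X] by metis
  qed
  assume AP: "A ** proj_matrix X = proj_matrix X ** A"
  then have "transpose A ** proj_matrix X = proj_matrix X ** transpose A"
    by (metis matrix_transpose_mul proj_matrix_symmetric[OF X])
  then have "(*v) A ` ((*v) (transpose A) ` X) \<subseteq> (*v) A ` X" by (intro image_mono sub)
  then have "X \<subseteq> (*v) A ` X"
    by (simp add: orthogonal_groupD[OF A] flip: mult_vec_image_compose)
  with sub[OF AP] A show "A \<in> stabilizer X" by (auto simp: stabilizer_def)
qed

section \<open>Haar measure on the stabilizer of a subspace\<close>

definition left_invariant_prob :: "(real^'n^'n) set \<Rightarrow> (real^'n^'n) measure \<Rightarrow> bool" where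
  "left_invariant_prob K M \<longleftrightarrow> sets M = sets (restrict_space borel K) \<and> emeasure M (space M) = 1 \<and>
    (\<forall>A\<in>K. distr M M (\<lambda>B. A ** B) = M)"

definition right_invariant_prob :: "(real^'n^'n) set \<Rightarrow> (real^'n^'n) measure \<Rightarrow> bool" where
  "right_invariant_prob K M \<longleftrightarrow> sets M = sets (restrict_space borel K) \<and> emeasure M (space M) = 1 \<and>
    (\<forall>A\<in>K. distr M M (\<lambda>B. B ** A) = M)"

lemma space_matrix_group_measure:
  "sets M = sets (restrict_space borel K) \<Longrightarrow> space M = K"
  by (drule sets_eq_imp_space_eq) (simp add: space_restrict_space)

lemma measurable_from_matrix_group:
  assumes "sets M = sets (restrict_space borel K)"
  shows "(\<lambda>A. A) \<in> borel_measurable M"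
  using measurable_restrict_space1[of "\<lambda>A. A" borel borel K] assms
  by (simp cong: measurable_cong_sets)

lemma measurable_into_matrix_group:
  assumes "sets M = sets (restrict_space borel K)" "f \<in> borel_measurable N" "f \<in> space N \<rightarrow> K"
  shows "f \<in> measurable N M"
  using measurable_restrict_space2[OF assms(3,2)] assms(1) by (simp cong: measurable_cong_sets)

text \<open>
  The measure of \<open>{(B, A). A ** B \<in> E}\<close> under the product is \<open>M(E)\<close> by left invariance of \<open>M\<close> when \<open>B\<close> is
  integrated first, and \<open>N(E)\<close> by right invariance of \<open>N\<close> when \<open>A\<close> is integrated first.
\<close>

lemma left_right_invariant_prob_eq:
  assumes M: "left_invariant_prob K M" and N: "right_invariant_prob K N"
    and K: "\<And>A B. A \<in> K \<Longrightarrow> B \<in> K \<Longrightarrow> A ** B \<in> K"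
  shows "M = N"
proof (rule measure_eqI)
  have sets_M: "sets M = sets (restrict_space borel K)" and sets_N: "sets N = sets (restrict_space borel K)"
    using M N by (auto simp: left_invariant_prob_def right_invariant_prob_def)
  note spaces = space_matrix_group_measure[OF sets_M] space_matrix_group_measure[OF sets_N]
  have one: "emeasure M (space M) = 1" "emeasure N (space N) = 1"
    using M N by (auto simp: left_invariant_prob_def right_invariant_prob_def)
  show "sets M = sets N" by (simp add: sets_M sets_N)
  fix E assume E: "E \<in> sets M"
  then have EN: "E \<in> sets N" by (simp add: sets_M sets_N)
  interpret M: finite_measure M by (rule finite_measureI) (simp add: one)
  interpret N: finite_measure N by (rule finite_measureI) (simp add: one)
  interpret pair_sigma_finite M N ..
  have [measurable]: "(\<lambda>A. A) \<in> borel_measurable M" "(\<lambda>A. A) \<in> borel_measurable N"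
    by (rule measurable_from_matrix_group, rule sets_M sets_N)+
  have mult: "(\<lambda>(B, A). A ** B) \<in> M \<Otimes>\<^sub>M N \<rightarrow>\<^sub>M M"
    by (rule measurable_into_matrix_group[OF sets_M])
       (measurable, auto simp: space_pair_measure spaces intro: K)
  have left: "(\<lambda>B. A ** B) \<in> M \<rightarrow>\<^sub>M M" if "A \<in> K" for A
    by (rule measurable_into_matrix_group[OF sets_M]) (measurable, auto simp: spaces intro: K that)
  have right: "(\<lambda>A. A ** B) \<in> N \<rightarrow>\<^sub>M N" if "B \<in> K" for B
    by (rule measurable_into_matrix_group[OF sets_N]) (measurable, auto simp: spaces intro: K that)
  have int_left: "(\<integral>\<^sup>+B. indicator E (A ** B) \<partial>M) = emeasure M E" if A: "A \<in> K" for A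
  proof -
    have "emeasure M E = (\<integral>\<^sup>+B. indicator E B \<partial>distr M M (\<lambda>B. A ** B))"
      using M A E by (simp add: left_invariant_prob_def)
    also have "\<dots> = (\<integral>\<^sup>+B. indicator E (A ** B) \<partial>M)"
      by (rule nn_integral_distr[OF left[OF A]]) (use E in simp)
    finally show ?thesis ..
  qed
  have int_right: "(\<integral>\<^sup>+A. indicator E (A ** B) \<partial>N) = emeasure N E" if B: "B \<in> K" for B
  proof -
    have "emeasure N E = (\<integral>\<^sup>+A. indicator E A \<partial>distr N N (\<lambda>A. A ** B))"
      using N B EN by (simp add: right_invariant_prob_def)
    also have "\<dots> = (\<integral>\<^sup>+A. indicator E (A ** B) \<partial>N)"
      by (rule nn_integral_distr[OF right[OF B]]) (use EN in simp)
    finally show ?thesis ..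
  qed
  have ind: "(\<lambda>(B, A). indicator E (A ** B) :: ennreal) \<in> borel_measurable (M \<Otimes>\<^sub>M N)"
    using measurable_compose[OF mult, of "indicator E :: _ \<Rightarrow> ennreal" borel] E
    by (simp add: case_prod_unfold)
  have "emeasure M E = (\<integral>\<^sup>+A. emeasure M E \<partial>N)" by (simp add: one)
  also have "\<dots> = (\<integral>\<^sup>+A. (\<integral>\<^sup>+B. indicator E (A ** B) \<partial>M) \<partial>N)"
    by (intro nn_integral_cong) (simp add: int_left spaces)
  also have "\<dots> = (\<integral>\<^sup>+B. (\<integral>\<^sup>+A. indicator E (A ** B) \<partial>N) \<partial>M)"
    using Fubini'[OF ind] by simp
  also have "\<dots> = (\<integral>\<^sup>+B. emeasure N E \<partial>M)"
    by (intro nn_integral_cong) (simp add: int_right spaces)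
  also have "\<dots> = emeasure N E" by (simp add: one)
  finally show "emeasure M E = emeasure N E" .
qed

text \<open>
  Transposition reverses products; on orthogonal matrices it is the inversion of the group.
\<close>

lemma right_invariant_prob_transpose:
  assumes M: "left_invariant_prob K M" and K: "\<And>A. A \<in> K \<Longrightarrow> transpose A \<in> K"
    "\<And>A B. A \<in> K \<Longrightarrow> B \<in> K \<Longrightarrow> A ** B \<in> K"
  shows "right_invariant_prob K (distr M M transpose)"
proof -
  have sets_M: "sets M = sets (restrict_space borel K)" and one: "emeasure M (space M) = 1"
    using M by (auto simp: left_invariant_prob_def)
  note space_M = space_matrix_group_measure[OF sets_M]
  have [measurable]: "(\<lambda>A. A) \<in> borel_measurable M" by (rule measurable_from_matrix_group[OF sets_M])
  have tr [measurable]: "transpose \<in> M \<rightarrow>\<^sub>M M"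
    by (rule measurable_into_matrix_group[OF sets_M]) (measurable, auto simp: space_M intro: K)
  have left [measurable]: "(\<lambda>B. A ** B) \<in> M \<rightarrow>\<^sub>M M" if "A \<in> K" for A
    by (rule measurable_into_matrix_group[OF sets_M]) (measurable, auto simp: space_M intro: K that)
  have right [measurable]: "(\<lambda>B. B ** A) \<in> M \<rightarrow>\<^sub>M M" if "A \<in> K" for A
    by (rule measurable_into_matrix_group[OF sets_M]) (measurable, auto simp: space_M intro: K that)
  have "distr (distr M M transpose) (distr M M transpose) (\<lambda>B. B ** A) = distr M M transpose"
    if A: "A \<in> K" for A
  proof -
    have At: "transpose A \<in> K" by (rule K(1)[OF A])
    have "distr (distr M M transpose) (distr M M transpose) (\<lambda>B. B ** A)
        = distr M M (\<lambda>B. transpose B ** A)"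
      using right[OF A] tr by (subst distr_distr) (auto simp: comp_def cong: distr_cong)
    also have "\<dots> = distr (distr M M (\<lambda>B. transpose A ** B)) M transpose"
      using left[OF At] tr by (subst distr_distr) (auto simp: comp_def matrix_transpose_mul)
    also have "\<dots> = distr M M transpose"
      using M At by (simp add: left_invariant_prob_def)
    finally show ?thesis .
  qed
  moreover have "emeasure (distr M M transpose) (space (distr M M transpose)) = 1"
  proof -
    have "transpose -` space M \<inter> space M = space M" using K(1) by (auto simp: space_M)
    then show ?thesis using emeasure_distr[OF tr sets.top] one by simp
  qed
  ultimately show ?thesis by (simp add: right_invariant_prob_def sets_M)
qed

text \<open>
  The block diagonal part of \<open>B\<close> with respect to \<open>X\<close> and \<open>X\<^sup>\<bottom>\<close>. It carries arbitrary matrices to matrices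
  commuting with the projection to \<open>X\<close>, equivariantly for the rotations preserving \<open>X\<close>.
\<close>

definition block_part :: "(real^'n) set \<Rightarrow> real^'n^'n \<Rightarrow> real^'n^'n" where
  "block_part X B = proj_matrix X ** B ** proj_matrix X
     + (mat 1 - proj_matrix X) ** B ** (mat 1 - proj_matrix X)"

lemma block_part_commute:
  assumes "subspace X"
  shows "block_part X B ** proj_matrix X = proj_matrix X ** block_part X B"
proof -
  let ?P = "proj_matrix X"
  have PP: "?P ** ?P = ?P" by (rule proj_matrix_idempotent[OF assms])
  have "block_part X B ** ?P = ?P ** B ** (?P ** ?P) + (mat 1 - ?P) ** B ** ((mat 1 - ?P) ** ?P)"
    "?P ** block_part X B = (?P ** ?P) ** B ** ?P + (?P ** (mat 1 - ?P)) ** B ** (mat 1 - ?P)"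
    by (simp_all only: block_part_def matrix_mult.add_left matrix_mult.add_right matrix_mul_assoc)
  moreover have "(mat 1 - ?P) ** ?P = 0" "?P ** (mat 1 - ?P) = 0"
    by (simp_all add: matrix_mult.diff_left matrix_mult.diff_right PP)
  ultimately show ?thesis
    by (simp add: PP matrix_mult.zero_left matrix_mult.zero_right)
qed

lemma block_part_left_mult:
  assumes "A ** proj_matrix X = proj_matrix X ** A"
  shows "block_part X (A ** B) = A ** block_part X B"
proof -
  let ?P = "proj_matrix X"
  have "?P ** (A ** B) = A ** (?P ** B)" by (metis assms matrix_mul_assoc)
  moreover have "(mat 1 - ?P) ** (A ** B) = A ** ((mat 1 - ?P) ** B)"
  proof -
    have "(mat 1 - ?P) ** A = A ** (mat 1 - ?P)"
      using assms by (simp add: matrix_mult.diff_left matrix_mult.diff_right)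
    then show ?thesis by (metis matrix_mul_assoc)
  qed
  ultimately show ?thesis by (simp only: block_part_def matrix_mult.add_right matrix_mul_assoc)
qed

lemma block_part_mat_1:
  "subspace X \<Longrightarrow> block_part X (mat 1) = mat 1"
  by (simp add: block_part_def matrix_mult.diff_left matrix_mult.diff_right proj_matrix_idempotent)

lemma continuous_on_block_part: "continuous_on UNIV (block_part X)"
  unfolding block_part_def[abs_def] by (intro continuous_intros matrix_mult.continuous_on)

text \<open>
  The polar factor of the block diagonal part of a matrix lies in the stabilizer and depends
  equivariantly on the matrix. The set \<open>U\<close> of matrices of bounded norm whose block diagonal part has a small defect is open,
  nonempty and invariant under the stabilizer, so the uniform distribution on \<open>U\<close> is an invariant
  probability, and its image under the polar factor is one on the stabilizer.
\<close>

lemma left_invariant_prob_exists: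
  fixes X :: "(real^'n) set"
  assumes X: "subspace X"
  shows "\<exists>M. left_invariant_prob (stabilizer X) M"
proof -
  let ?K = "stabilizer X"
  define D where "D = {B. norm (gram_defect (block_part X B)) < 1/2}"
  define U where "U = D \<inter> ball 0 (norm (mat 1 :: real^'n^'n) + 1)"
  have "continuous_on UNIV (\<lambda>B. norm (gram_defect (block_part X B)))"
    unfolding gram_defect_def
    by (intro continuous_intros matrix_mult.continuous_on bounded_linear.continuous_on[OF bounded_linear_transpose]
        continuous_on_block_part)
  then have D: "open D" unfolding D_def by (intro open_Collect_less continuous_on_const)
  then have U: "open U" by (simp add: U_def open_Int)
  have "mat 1 \<in> U"
    by (simp add: U_def D_def block_part_mat_1[OF X] gram_defect_def transpose_mat)
  have U_pos: "emeasure lborel U \<noteq> 0"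
    using open_not_negligible[OF U] \<open>mat 1 \<in> U\<close> U
    by (auto simp: negligible_iff_null_sets null_sets_completion_iff null_sets_def)
  have U_fin: "emeasure lborel U \<noteq> \<infinity>"
    using emeasure_mono[of U "ball 0 (norm (mat 1 :: real^'n^'n) + 1)" lborel]
      emeasure_lborel_ball_finite[of "0::real^'n^'n" "norm (mat 1 :: real^'n^'n) + 1"]
    by (auto simp: U_def top_unique)
  have [measurable]: "U \<in> sets borel" "D \<in> sets borel" using U D by auto
  have [measurable]: "block_part X \<in> borel_measurable borel"
    by (rule borel_measurable_continuous_onI[OF continuous_on_block_part])
  define N where "N = uniform_measure lborel U"
  have sets_N [measurable_cong]: "sets N = sets borel" and space_N: "space N = UNIV"
    by (simp_all add: N_def)
  have N1: "emeasure N UNIV = 1"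
    using U_pos U_fin by (simp add: N_def divide_eq_1_ennreal)
  \<comment> \<open>Outside \<open>D\<close> the iteration may diverge. The default value breaks equivariance there, but \<open>U\<close> lies in \<open>D\<close>.\<close>
  define \<Phi> where "\<Phi> B = (if B \<in> D then polar (block_part X B) else mat 1)" for B
  have \<Phi>_K: "\<Phi> B \<in> ?K" for B
  proof (cases "B \<in> D")
    case True
    then have small: "norm (gram_defect (block_part X B)) \<le> 1/2" by (simp add: D_def)
    show ?thesis
      using polar_commute[OF proj_matrix_symmetric[OF X] block_part_commute[OF X] small]
        stabilizer_iff_commute[OF polar_orthogonal[OF small] X] True
      by (simp add: \<Phi>_def)
  qed (simp add: \<Phi>_def mat_1_stabilizer)
  define M where "M = distr N (restrict_space borel ?K) \<Phi>"
  have sets_M: "sets M = sets (restrict_space borel ?K)" by (simp add: M_def)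
  have space_M: "space M = ?K" by (rule space_matrix_group_measure[OF sets_M])
  have \<Phi>_meas [measurable]: "\<Phi> \<in> N \<rightarrow>\<^sub>M restrict_space borel ?K"
  proof (rule measurable_restrict_space2)
    show "\<Phi> \<in> borel_measurable N" unfolding \<Phi>_def[abs_def] by measurable
  qed (use \<Phi>_K in simp)
  have "distr M M (\<lambda>B. A ** B) = M" if A: "A \<in> ?K" for A
  proof -
    have orth: "A \<in> orthogonal_group" using A by (rule stabilizerD)
    have comm: "A ** proj_matrix X = proj_matrix X ** A"
      using A stabilizer_iff_commute[OF orth X] by simp
    have D_A: "A ** B \<in> D \<longleftrightarrow> B \<in> D" for B
      by (simp add: D_def block_part_left_mult[OF comm] gram_defect_left_mult[OF orth])
    have norm_A: "norm (A ** B) = norm B" for B :: "real^'n^'n"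
      by (rule orthogonal_transformation_norm[OF orthogonal_transformation_left_mult[OF orth]])
    have U_A: "A ** B \<in> U \<longleftrightarrow> B \<in> U" for B by (simp add: U_def D_A norm_A)
    have mult_K [measurable]: "(\<lambda>B. A ** B) \<in> restrict_space borel ?K \<rightarrow>\<^sub>M restrict_space borel ?K"
      by (rule measurable_into_matrix_group[OF refl])
        (use measurable_from_matrix_group[OF refl, of ?K] A in
          \<open>auto simp: space_restrict_space intro!: mult_stabilizer\<close>)
    have N_A: "distr N borel (\<lambda>B. A ** B) = N"
    proof -
      have "uniform_measure (distr lborel borel (\<lambda>B. A ** B)) U
          = distr (uniform_measure lborel U) borel (\<lambda>B. A ** B)"
      proof (rule measure_eqI)
        fix E assume "E \<in> sets (uniform_measure (distr lborel borel (\<lambda>B. A ** B)) U)"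
        then have [measurable]: "E \<in> sets borel" by simp
        have [measurable]: "(\<lambda>B. A ** B) -` E \<in> sets borel"
          by (rule measurable_sets_borel[where M = borel]) measurable
        have "(\<lambda>B. A ** B) -` U = U" using U_A by auto
        then show "emeasure (uniform_measure (distr lborel borel (\<lambda>B. A ** B)) U) E
          = emeasure (distr (uniform_measure lborel U) borel (\<lambda>B. A ** B)) E"
          by (simp add: emeasure_distr vimage_Int)
      qed simp
      then show ?thesis
        by (simp add: N_def lborel_isometry[OF orthogonal_transformation_left_mult[OF orth]])
    qed
    have "distr M M (\<lambda>B. A ** B) = distr N (restrict_space borel ?K) (\<lambda>B. A ** \<Phi> B)"
      unfolding M_def by (subst distr_distr) (auto simp: comp_def cong: distr_cong)
    also have "\<dots> = distr N (restrict_space borel ?K) (\<lambda>B. \<Phi> (A ** B))"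
    proof (rule distr_cong_AE)
      show "AE B in N. A ** \<Phi> B = \<Phi> (A ** B)"
        unfolding N_def
      proof (rule AE_uniform_measureI)
        show "AE B in lborel. B \<in> U \<longrightarrow> A ** \<Phi> B = \<Phi> (A ** B)"
        proof (intro AE_I2 impI)
          fix B assume "B \<in> U"
          then have "B \<in> D" by (simp add: U_def)
          then show "A ** \<Phi> B = \<Phi> (A ** B)"
            by (simp add: \<Phi>_def D_A block_part_left_mult[OF comm] polar_left_mult[OF orth])
              (simp add: D_def polar_left_mult[OF orth])
        qed
      qed simp
    qed (simp_all, measurable)
    also have "\<dots> = distr (distr N borel (\<lambda>B. A ** B)) (restrict_space borel ?K) \<Phi>"
      using \<Phi>_meas by (subst distr_distr) (auto simp: comp_def sets_N cong: measurable_cong_sets)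
    also have "\<dots> = M" by (simp add: N_A M_def)
    finally show ?thesis .
  qed
  moreover have "emeasure M (space M) = 1"
  proof -
    have "\<Phi> -` ?K = UNIV" using \<Phi>_K by auto
    then show ?thesis
      using emeasure_distr[OF \<Phi>_meas, of ?K] N1 space_M sets.top[of M]
      by (simp add: M_def space_N)
  qed
  ultimately show ?thesis
    unfolding left_invariant_prob_def using sets_M by (intro exI[of _ M]) auto
qed

definition stabilizer_haar :: "(real^'n) set \<Rightarrow> (real^'n^'n) measure" where
  "stabilizer_haar X = (SOME M. left_invariant_prob (stabilizer X) M)"

lemma stabilizer_haar:
  assumes "subspace X"
  shows left_invariant_stabilizer_haar: "left_invariant_prob (stabilizer X) (stabilizer_haar X)"
    and right_invariant_stabilizer_haar: "right_invariant_prob (stabilizer X) (stabilizer_haar X)"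
proof -
  show L: "left_invariant_prob (stabilizer X) (stabilizer_haar X)"
    unfolding stabilizer_haar_def using left_invariant_prob_exists[OF assms] by (rule someI_ex)
  have R: "right_invariant_prob (stabilizer X) (distr (stabilizer_haar X) (stabilizer_haar X) transpose)"
    by (rule right_invariant_prob_transpose[OF L transpose_stabilizer mult_stabilizer])
  with left_right_invariant_prob_eq[OF L R mult_stabilizer]
  show "right_invariant_prob (stabilizer X) (stabilizer_haar X)" by simp
qed

lemma haar_prob_eq: "haar_prob = completion (stabilizer_haar (UNIV :: (real^'n) set))"
proof -
  have iff: "is_haar_prob M \<longleftrightarrow> left_invariant_prob (stabilizer UNIV) M" for M :: "(real^'n^'n) measure"
    by (simp add: is_haar_prob_def left_invariant_prob_def stabilizer_UNIV)
  have "(THE M :: (real^'n^'n) measure. is_haar_prob M) = stabilizer_haar UNIV"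
    unfolding iff
    using left_invariant_stabilizer_haar[OF subspace_UNIV]
      left_right_invariant_prob_eq[OF _ right_invariant_stabilizer_haar[OF subspace_UNIV] mult_stabilizer]
    by (intro the_equality) auto
  then show ?thesis by (simp add: haar_prob_def)
qed

section \<open>Invariant measures on Grassmannians\<close>

lemma grassmannianD:
  assumes "\<xi> \<in> grassmannian m X"
  shows "subspace \<xi>" "\<xi> \<subseteq> X" "dim \<xi> = m"
  using assms by (auto simp: grassmannian_def)

lemma dim_orthogonal_image:
  fixes X :: "(real^'n) set"
  assumes "A \<in> orthogonal_group"
  shows "dim ((*v) A ` X) = dim X"
  using orthogonal_group_transformation[OF assms]
  by (intro dim_image_eq) (auto intro: orthogonal_transformation_inj inj_on_subset)

lemma grassmannian_image:
  assumes "A \<in> orthogonal_group" "\<xi> \<in> grassmannian m X"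
  shows "(*v) A ` \<xi> \<in> grassmannian m ((*v) A ` X)"
  using assms grassmannianD[OF assms(2)]
  by (auto simp: grassmannian_def subspace_mult_vec_image dim_orthogonal_image)

text \<open>
  Glue an isometry from \<open>\<xi>\<close> to \<open>\<xi>'\<close>, one between their orthogonal complements in \<open>X\<close>, and the identity on
  \<open>X\<^sup>\<bottom>\<close>.
\<close>

lemma stabilizer_transitive:
  assumes X: "subspace X" and \<xi>: "\<xi> \<in> grassmannian m X" and \<xi>': "\<xi>' \<in> grassmannian m X"
  shows "\<exists>A\<in>stabilizer X. (*v) A ` \<xi> = \<xi>'"
proof -
  define W where "W \<zeta> = X \<inter> \<zeta>\<^sup>\<bottom>" for \<zeta>
  have W: "subspace (W \<zeta>)" for \<zeta>
    unfolding W_def by (intro subspace_inter X subspace_orthogonal_comp)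
  have dim_W: "dim (W \<zeta>) + m = dim X" if "\<zeta> \<in> grassmannian m X" for \<zeta>
  proof -
    have "W \<zeta> = {y \<in> X. \<forall>x\<in>\<zeta>. orthogonal x y}"
      by (auto simp: W_def orthogonal_comp_def)
    then show ?thesis
      using dim_subspace_orthogonal_to_vectors[of \<zeta> X] grassmannianD[OF that] X by simp
  qed
  obtain f where f: "linear f" "f ` \<xi> = \<xi>'" "\<And>x. x \<in> \<xi> \<Longrightarrow> norm (f x) = norm x"
    using isometries_subspaces[of \<xi> \<xi>'] grassmannianD[OF \<xi>] grassmannianD[OF \<xi>'] by metis
  obtain g where g: "linear g" "g ` W \<xi> = W \<xi>'" "\<And>x. x \<in> W \<xi> \<Longrightarrow> norm (g x) = norm x"
  proof -
    have "dim (W \<xi>) = dim (W \<xi>')" using dim_W[OF \<xi>] dim_W[OF \<xi>'] by simp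
    then show ?thesis using isometries_subspaces[OF W[of \<xi>] W[of \<xi>']] that by metis
  qed
  note sub = grassmannianD(1)[OF \<xi>]
  let ?p = "closest_point \<xi>" and ?w = "closest_point (W \<xi>)" and ?x = "closest_point X"
  define T where "T y = f (?p y) + g (?w y) + (y - ?x y)" for y
  have in_sub: "?p y \<in> \<xi>" "?w y \<in> W \<xi>" "y - ?x y \<in> X\<^sup>\<bottom>" "?x y \<in> X" for y
    by (simp_all add: closest_point_in_subspace diff_closest_point_orthogonal sub W X)
  have split: "?x y = ?p y + ?w y" for y
  proof -
    have p_X: "?p y \<in> X" using in_sub(1) grassmannianD(2)[OF \<xi>] by blast
    have "X\<^sup>\<bottom> \<subseteq> \<xi>\<^sup>\<bottom>" using grassmannianD(2)[OF \<xi>] by (auto simp: orthogonal_comp_def)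
    then have "(y - ?p y) - (y - ?x y) \<in> \<xi>\<^sup>\<bottom>"
      using subspace_diff[OF subspace_orthogonal_comp diff_closest_point_orthogonal[OF sub, of y]]
        in_sub(3)[of y] by blast
    then have "?x y - ?p y \<in> W \<xi>"
      using subspace_diff[OF X in_sub(4)[of y] p_X] by (simp add: W_def)
    moreover have "y - (?x y - ?p y) \<in> (W \<xi>)\<^sup>\<bottom>"
    proof -
      have "?p y \<in> (W \<xi>)\<^sup>\<bottom>" "y - ?x y \<in> (W \<xi>)\<^sup>\<bottom>"
        using in_sub(1,3)[of y] by (auto simp: orthogonal_comp_def W_def orthogonal_commute)
      then have "?p y + (y - ?x y) \<in> (W \<xi>)\<^sup>\<bottom>" by (intro subspace_add subspace_orthogonal_comp)
      then show ?thesis by (simp add: algebra_simps)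
    qed
    ultimately have "?w y = ?x y - ?p y" by (rule closest_point_subspaceI[OF W])
    then show ?thesis by simp
  qed
  have Pyth: "(norm (a + b + c))\<^sup>2 = (norm a)\<^sup>2 + (norm b)\<^sup>2 + (norm c)\<^sup>2"
    if "a \<in> \<zeta>" "b \<in> W \<zeta>" "c \<in> X\<^sup>\<bottom>" "\<zeta> \<in> grassmannian m X" for a b c \<zeta>
  proof -
    have "orthogonal a b" "orthogonal a c" "orthogonal b c"
      using that grassmannianD(2)[OF that(4)] by (auto simp: W_def orthogonal_comp_def)
    then show ?thesis by (simp add: norm_add_Pythagorean orthogonal_clauses)
  qed
  have T_norm: "norm (T y) = norm y" for y
  proof -
    have "(norm (T y))\<^sup>2 = (norm (f (?p y)))\<^sup>2 + (norm (g (?w y)))\<^sup>2 + (norm (y - ?x y))\<^sup>2"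
      unfolding T_def using in_sub f(2) g(2) by (intro Pyth[OF _ _ _ \<xi>']) auto
    also have "\<dots> = (norm (?p y))\<^sup>2 + (norm (?w y))\<^sup>2 + (norm (y - ?x y))\<^sup>2"
      by (simp add: f g in_sub)
    also have "\<dots> = (norm (?p y + ?w y + (y - ?x y)))\<^sup>2"
      by (rule Pyth[OF in_sub(1-3) \<xi>, symmetric])
    finally show ?thesis by (simp add: split)
  qed
  have T_lin: "linear T"
  proof -
    note lin = linear_closest_point[OF sub] linear_closest_point[OF W[of \<xi>]] linear_closest_point[OF X] f(1) g(1)
    show ?thesis
      by (rule linearI) (simp_all add: T_def lin[THEN linear_add] lin[THEN linear_cmul] algebra_simps)
  qed
  have T: "orthogonal_transformation T"
    unfolding orthogonal_transformation using T_lin T_norm by simp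
  define A where "A = matrix T"
  have A_T: "(*v) A = T" using T_lin by (simp add: A_def matrix_works fun_eq_iff)
  have A: "A \<in> orthogonal_group"
    using T by (simp add: A_def orthogonal_group_def orthogonal_transformation_matrix)
  have T_\<xi>: "T x = f x" if "x \<in> \<xi>" for x
  proof -
    have "?p x = x" "?x x = x"
      using that grassmannianD[OF \<xi>] by (auto intro!: closest_point_self)
    moreover from this have "?w x = 0" using split[of x] by simp
    ultimately show ?thesis by (simp add: T_def linear_0[OF g(1)])
  qed
  have T_X: "T ` X = X"
  proof (rule subspace_dim_equal)
    show "T ` X \<subseteq> X"
    proof
      fix y assume "y \<in> T ` X"
      then obtain x where x: "x \<in> X" "y = T x" by auto
      have "f (?p x) \<in> X" "g (?w x) \<in> X"
        using in_sub f(2) g(2) grassmannianD(2)[OF \<xi>'] by (auto simp: W_def)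
      moreover have "?x x = x" using x by (auto intro!: closest_point_self)
      ultimately show "y \<in> X" by (simp add: x T_def subspace_add[OF X])
    qed
    show "dim X \<le> dim (T ` X)" using dim_orthogonal_image[OF A, of X] by (simp add: A_T)
  qed (use X T_lin in \<open>auto intro: linear_subspace_image\<close>)
  have "(*v) A ` \<xi> = \<xi>'" using T_\<xi> f(2) by (simp add: A_T cong: image_cong)
  moreover have "A \<in> stabilizer X" using A T_X by (simp add: stabilizer_def A_T)
  ultimately show ?thesis by blast
qed

lemma space_grassmannian_borel [simp]: "space (grassmannian_borel m X) = grassmannian m X"
  by (simp add: grassmannian_borel_def space_vimage_algebra)

lemma measurable_proj_matrix [measurable]:
  "proj_matrix \<in> borel_measurable (grassmannian_borel m X)"
  unfolding grassmannian_borel_def proj_matrix_def[abs_def]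
  by (rule measurable_vimage_algebra1) simp

lemma measurable_into_grassmannian:
  assumes "f \<in> space N \<rightarrow> grassmannian m X" "(\<lambda>x. proj_matrix (f x)) \<in> borel_measurable N"
  shows "f \<in> N \<rightarrow>\<^sub>M grassmannian_borel m X"
  using assms unfolding grassmannian_borel_def proj_matrix_def
  by (rule measurable_vimage_algebra2)

lemma stabilizer_haar_space:
  fixes X :: "(real^'n) set"
  assumes "subspace X"
  shows "sets (stabilizer_haar X) = sets (restrict_space borel (stabilizer X))"
    and "space (stabilizer_haar X) = stabilizer X"
    and "emeasure (stabilizer_haar X) (stabilizer X) = 1"
    and "(\<lambda>A. A) \<in> borel_measurable (stabilizer_haar X)"
    and "finite_measure (stabilizer_haar X)"
proof -
  show sets: "sets (stabilizer_haar X) = sets (restrict_space borel (stabilizer X))"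
    using left_invariant_stabilizer_haar[OF assms] by (simp add: left_invariant_prob_def)
  show space: "space (stabilizer_haar X) = stabilizer X"
    by (rule space_matrix_group_measure[OF sets])
  show one: "emeasure (stabilizer_haar X) (stabilizer X) = 1"
    using left_invariant_stabilizer_haar[OF assms] by (simp add: left_invariant_prob_def space)
  show "(\<lambda>A. A) \<in> borel_measurable (stabilizer_haar X)" by (rule measurable_from_matrix_group[OF sets])
  show "finite_measure (stabilizer_haar X)" by (rule finite_measureI) (simp add: space one)
qed

lemma measurable_orbit_map:
  fixes X :: "(real^'n) set"
  assumes X: "subspace X" and \<rho>: "\<rho> \<in> orthogonal_group" and \<xi>: "\<xi> \<in> grassmannian m X"
  shows "(\<lambda>A. (*v) (\<rho> ** A) ` \<xi>) \<in> stabilizer_haar X \<rightarrow>\<^sub>M grassmannian_borel m ((*v) \<rho> ` X)"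
proof (rule measurable_into_grassmannian)
  note [measurable] = stabilizer_haar_space(4)[OF X]
  have orth: "\<rho> ** A \<in> orthogonal_group" if "A \<in> stabilizer X" for A
    by (rule mult_orthogonal_group[OF \<rho> stabilizerD(1)[OF that]])
  show "(\<lambda>A. (*v) (\<rho> ** A) ` \<xi>) \<in> space (stabilizer_haar X) \<rightarrow> grassmannian m ((*v) \<rho> ` X)"
    using grassmannian_image[OF orth \<xi>]
    by (auto simp: stabilizer_haar_space[OF X] mult_vec_image_compose stabilizerD(2))
  show "(\<lambda>A. proj_matrix ((*v) (\<rho> ** A) ` \<xi>)) \<in> borel_measurable (stabilizer_haar X)"
  proof (subst measurable_cong)
    show "(\<lambda>A. \<rho> ** A ** proj_matrix \<xi> ** transpose (\<rho> ** A)) \<in> borel_measurable (stabilizer_haar X)"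
      by measurable
  qed (simp add: stabilizer_haar_space[OF X] proj_matrix_orthogonal_image[OF orth grassmannianD(1)[OF \<xi>]])
qed

text \<open>
  Average the identity \<open>M(A\<^sup>-\<^sup>1 E) = M(E)\<close> over the stabilizer and exchange the integrals. The inner
  average over \<open>A\<close> of \<open>indicator E (A \<zeta>)\<close> is the same for all \<open>\<zeta>\<close>, by transitivity and right invariance.
\<close>

lemma invariant_prob_unique:
  fixes X :: "(real^'n) set"
  assumes X: "subspace X" and M: "is_invariant_prob m X M" and \<xi>: "\<xi> \<in> grassmannian m X"
  shows "M = distr (stabilizer_haar X) (grassmannian_borel m X) (\<lambda>A. (*v) A ` \<xi>)"
proof (rule measure_eqI)
  let ?H = "stabilizer_haar X"
  note H = stabilizer_haar_space[OF X]
  note [measurable] = H(4)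
  have sets_M: "sets M = sets (grassmannian_borel m X)" and one: "emeasure M (space M) = 1"
    and inv: "\<And>A. A \<in> stabilizer X \<Longrightarrow> distr M M (\<lambda>\<xi>. (*v) A ` \<xi>) = M"
    using M by (auto simp: is_invariant_prob_def stabilizer_def)
  have space_M: "space M = grassmannian m X" using sets_eq_imp_space_eq[OF sets_M] by simp
  show "sets M = sets (distr ?H (grassmannian_borel m X) (\<lambda>A. (*v) A ` \<xi>))" by (simp add: sets_M)
  fix E assume E: "E \<in> sets M"
  interpret M: finite_measure M by (rule finite_measureI) (simp add: one)
  interpret H: finite_measure ?H by (rule H(5))
  interpret pair_sigma_finite M ?H ..
  have proj [measurable]: "proj_matrix \<in> borel_measurable M"
    using measurable_proj_matrix[of m X] by (simp cong: measurable_cong_sets add: sets_M)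
  have image: "(*v) A ` \<zeta> \<in> grassmannian m X" if "A \<in> stabilizer X" "\<zeta> \<in> grassmannian m X" for A \<zeta>
    using grassmannian_image[OF stabilizerD(1)[OF that(1)] that(2)] by (simp add: stabilizerD(2)[OF that(1)])
  have act: "(\<lambda>(\<zeta>, A). (*v) A ` \<zeta>) \<in> M \<Otimes>\<^sub>M ?H \<rightarrow>\<^sub>M M"
  proof -
    have "(\<lambda>(\<zeta>, A). (*v) A ` \<zeta>) \<in> M \<Otimes>\<^sub>M ?H \<rightarrow>\<^sub>M grassmannian_borel m X"
    proof (rule measurable_into_grassmannian)
      show "(\<lambda>z. proj_matrix (case z of (\<zeta>, A) \<Rightarrow> (*v) A ` \<zeta>)) \<in> borel_measurable (M \<Otimes>\<^sub>M ?H)"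
      proof (subst measurable_cong)
        show "(\<lambda>(\<zeta>, A). A ** proj_matrix \<zeta> ** transpose A) \<in> borel_measurable (M \<Otimes>\<^sub>M ?H)"
          by measurable
      qed (auto simp: space_pair_measure space_M H proj_matrix_orthogonal_image[OF stabilizerD(1)] grassmannianD)
    qed (auto simp: space_pair_measure space_M H image)
    then show ?thesis by (simp cong: measurable_cong_sets add: sets_M)
  qed
  have act_A: "(\<lambda>\<zeta>. (*v) A ` \<zeta>) \<in> M \<rightarrow>\<^sub>M M" if "A \<in> stabilizer X" for A
    using measurable_compose[OF measurable_Pair2'[of A ?H M] act] that by (auto simp: H)
  have act_\<zeta>: "(\<lambda>A. (*v) A ` \<zeta>) \<in> ?H \<rightarrow>\<^sub>M M" if "\<zeta> \<in> grassmannian m X" for \<zeta>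
    using measurable_compose[OF measurable_Pair1'[of \<zeta> M ?H] act] that by (simp add: space_M)
  have by_M: "(\<integral>\<^sup>+\<zeta>. indicator E ((*v) A ` \<zeta>) \<partial>M) = emeasure M E" if A: "A \<in> stabilizer X" for A
  proof -
    have "emeasure M E = (\<integral>\<^sup>+\<zeta>. indicator E \<zeta> \<partial>distr M M (\<lambda>\<zeta>. (*v) A ` \<zeta>))"
      using E by (simp add: inv[OF A])
    also have "\<dots> = (\<integral>\<^sup>+\<zeta>. indicator E ((*v) A ` \<zeta>) \<partial>M)"
      by (rule nn_integral_distr[OF act_A[OF A]]) (use E in simp)
    finally show ?thesis ..
  qed
  have by_H: "(\<integral>\<^sup>+A. indicator E ((*v) A ` \<zeta>) \<partial>?H) = (\<integral>\<^sup>+A. indicator E ((*v) A ` \<xi>) \<partial>?H)"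
    if \<zeta>: "\<zeta> \<in> grassmannian m X" for \<zeta>
  proof -
    obtain B where B: "B \<in> stabilizer X" "(*v) B ` \<xi> = \<zeta>"
      using stabilizer_transitive[OF X \<xi> \<zeta>] by auto
    have right: "(\<lambda>A. A ** B) \<in> ?H \<rightarrow>\<^sub>M ?H"
      by (rule measurable_into_matrix_group[OF H(1)]) (measurable, auto simp: H intro: mult_stabilizer B)
    have ind: "(\<lambda>A. indicator E ((*v) A ` \<xi>) :: ennreal) \<in> borel_measurable ?H"
      by (rule measurable_compose[OF act_\<zeta>[OF \<xi>]]) (use E in simp)
    have "(\<integral>\<^sup>+A. indicator E ((*v) A ` \<xi>) \<partial>?H) = (\<integral>\<^sup>+A. indicator E ((*v) A ` \<xi>) \<partial>distr ?H ?H (\<lambda>A. A ** B))"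
      using right_invariant_stabilizer_haar[OF X] B(1) by (simp add: right_invariant_prob_def)
    also have "\<dots> = (\<integral>\<^sup>+A. indicator E ((*v) (A ** B) ` \<xi>) \<partial>?H)"
      by (rule nn_integral_distr[OF right]) (simp add: ind)
    finally show ?thesis by (simp add: mult_vec_image_compose B(2))
  qed
  have ind: "(\<lambda>(\<zeta>, A). indicator E ((*v) A ` \<zeta>) :: ennreal) \<in> borel_measurable (M \<Otimes>\<^sub>M ?H)"
    using measurable_compose[OF act, of "indicator E :: _ \<Rightarrow> ennreal" borel] E by (simp add: case_prod_unfold)
  have "emeasure M E = (\<integral>\<^sup>+A. emeasure M E \<partial>?H)" by (simp add: H)
  also have "\<dots> = (\<integral>\<^sup>+A. (\<integral>\<^sup>+\<zeta>. indicator E ((*v) A ` \<zeta>) \<partial>M) \<partial>?H)"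
    by (intro nn_integral_cong) (simp add: by_M H)
  also have "\<dots> = (\<integral>\<^sup>+\<zeta>. (\<integral>\<^sup>+A. indicator E ((*v) A ` \<zeta>) \<partial>?H) \<partial>M)"
    using Fubini'[OF ind] by simp
  also have "\<dots> = (\<integral>\<^sup>+\<zeta>. (\<integral>\<^sup>+A. indicator E ((*v) A ` \<xi>) \<partial>?H) \<partial>M)"
    by (intro nn_integral_cong by_H) (simp add: space_M)
  also have "\<dots> = (\<integral>\<^sup>+A. indicator E ((*v) A ` \<xi>) \<partial>?H)" by (simp add: one)
  also have "\<dots> = (\<integral>\<^sup>+\<zeta>. indicator E \<zeta> \<partial>distr ?H M (\<lambda>A. (*v) A ` \<xi>))"
    by (rule nn_integral_distr[OF act_\<zeta>[OF \<xi>], symmetric]) (use E in simp)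
  also have "\<dots> = emeasure (distr ?H (grassmannian_borel m X) (\<lambda>A. (*v) A ` \<xi>)) E"
    using E by (simp add: sets_M cong: distr_cong)
  finally show "emeasure M E = emeasure (distr ?H (grassmannian_borel m X) (\<lambda>A. (*v) A ` \<xi>)) E" .
qed

text \<open>
  A rotation \<open>B\<close> preserving \<open>\<rho> X\<close> moves past \<open>\<rho>\<close> at the price of conjugating it to a rotation preserving
  \<open>X\<close>, which left invariance absorbs. Admitting \<open>\<rho>\<close> makes it possible to use one and the same probability
  space for all the subspaces \<open>\<rho> X\<close>.
\<close>

lemma invariant_prob_orbit:
  fixes X :: "(real^'n) set"
  assumes X: "subspace X" and \<rho>: "\<rho> \<in> orthogonal_group" and \<xi>: "\<xi> \<in> grassmannian m X"
  shows "is_invariant_prob m ((*v) \<rho> ` X)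
    (distr (stabilizer_haar X) (grassmannian_borel m ((*v) \<rho> ` X)) (\<lambda>A. (*v) (\<rho> ** A) ` \<xi>))"
    (is "is_invariant_prob m ?Y ?D")
proof -
  let ?H = "stabilizer_haar X"
  note H = stabilizer_haar_space[OF X]
  note [measurable] = H(4)
  note orbit = measurable_orbit_map[OF X \<rho> \<xi>]
  have "distr ?D ?D (\<lambda>\<zeta>. (*v) B ` \<zeta>) = ?D" if B: "B \<in> stabilizer ?Y" for B
  proof -
    define C where "C = transpose \<rho> ** B ** \<rho>"
    have \<rho>C: "\<rho> ** C = B ** \<rho>"
      by (simp add: C_def matrix_mul_assoc orthogonal_groupD[OF \<rho>])
    have C: "C \<in> stabilizer X"
    proof -
      have "(*v) C ` X = (*v) (transpose \<rho>) ` ((*v) B ` ?Y)"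
        by (simp only: C_def mult_vec_image_compose)
      also have "\<dots> = (*v) (transpose \<rho> ** \<rho>) ` X"
        by (simp only: stabilizerD(2)[OF B] mult_vec_image_compose)
      finally have "(*v) C ` X = X" by (simp add: orthogonal_groupD[OF \<rho>])
      then show ?thesis
        using stabilizerD(1)[OF B] \<rho>
        by (simp add: stabilizer_def C_def mult_orthogonal_group transpose_orthogonal_group)
    qed
    have act: "(\<lambda>\<zeta>. (*v) B ` \<zeta>) \<in> grassmannian_borel m ?Y \<rightarrow>\<^sub>M grassmannian_borel m ?Y"
    proof (rule measurable_into_grassmannian)
      show "(\<lambda>\<zeta>. proj_matrix ((*v) B ` \<zeta>)) \<in> borel_measurable (grassmannian_borel m ?Y)"
      proof (subst measurable_cong)
        show "(\<lambda>\<zeta>. B ** proj_matrix \<zeta> ** transpose B) \<in> borel_measurable (grassmannian_borel m ?Y)"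
          by measurable
      qed (simp add: proj_matrix_orthogonal_image[OF stabilizerD(1)[OF B]] grassmannianD)
      show "(\<lambda>\<zeta>. (*v) B ` \<zeta>) \<in> space (grassmannian_borel m ?Y) \<rightarrow> grassmannian m ?Y"
        using grassmannian_image[OF stabilizerD(1)[OF B], of _ m ?Y] by (auto simp: stabilizerD(2)[OF B])
    qed
    have left: "(\<lambda>A. C ** A) \<in> ?H \<rightarrow>\<^sub>M ?H"
      by (rule measurable_into_matrix_group[OF H(1)]) (measurable, auto simp: H intro: mult_stabilizer C)
    have "distr ?D ?D (\<lambda>\<zeta>. (*v) B ` \<zeta>) = distr ?D (grassmannian_borel m ?Y) (\<lambda>\<zeta>. (*v) B ` \<zeta>)"
      by (rule distr_cong) simp_all
    also have "\<dots> = distr ?H (grassmannian_borel m ?Y) (\<lambda>A. (*v) (\<rho> ** (C ** A)) ` \<xi>)"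
      by (subst distr_distr[OF act orbit])
        (simp add: comp_def matrix_mul_assoc \<rho>C flip: mult_vec_image_compose)
    also have "\<dots> = distr (distr ?H ?H (\<lambda>A. C ** A)) (grassmannian_borel m ?Y) (\<lambda>A. (*v) (\<rho> ** A) ` \<xi>)"
      by (subst distr_distr[OF orbit left]) (simp add: comp_def)
    also have "distr ?H ?H (\<lambda>A. C ** A) = ?H"
      using left_invariant_stabilizer_haar[OF X] C by (simp add: left_invariant_prob_def)
    finally show ?thesis .
  qed
  moreover have "emeasure ?D (space ?D) = 1"
  proof -
    have "(\<lambda>A. (*v) (\<rho> ** A) ` \<xi>) -` grassmannian m ?Y \<inter> space ?H = space ?H"
      using measurable_space[OF orbit] by auto
    then show ?thesis using emeasure_distr[OF orbit sets.top] H(2,3) by simp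
  qed
  ultimately show ?thesis by (auto simp: is_invariant_prob_def stabilizer_def)
qed

lemma grassmannian_prob_orbit:
  fixes X :: "(real^'n) set"
  assumes X: "subspace X" and \<rho>: "\<rho> \<in> orthogonal_group" and \<xi>: "\<xi> \<in> grassmannian m X"
  shows "grassmannian_prob m ((*v) \<rho> ` X) =
    completion (distr (stabilizer_haar X) (grassmannian_borel m ((*v) \<rho> ` X)) (\<lambda>A. (*v) (\<rho> ** A) ` \<xi>))"
proof -
  have Y: "subspace ((*v) \<rho> ` X)" using X by (rule subspace_mult_vec_image)
  have \<rho>\<xi>: "(*v) \<rho> ` \<xi> \<in> grassmannian m ((*v) \<rho> ` X)" by (rule grassmannian_image[OF \<rho> \<xi>])
  note inv = invariant_prob_orbit[OF X \<rho> \<xi>]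
  have "(THE M. is_invariant_prob m ((*v) \<rho> ` X) M)
    = distr (stabilizer_haar X) (grassmannian_borel m ((*v) \<rho> ` X)) (\<lambda>A. (*v) (\<rho> ** A) ` \<xi>)"
    using inv invariant_prob_unique[OF Y _ \<rho>\<xi>] by (intro the_equality) metis+
  then show ?thesis by (simp add: grassmannian_prob_def)
qed

section \<open>Integration with respect to a completed measure\<close>

lemma borel_measurable_completion_AE:
  fixes F :: "'a \<Rightarrow> 'b::topological_space"
  assumes G: "G \<in> borel_measurable M" and eq: "AE x in M. F x = G x"
  shows "F \<in> borel_measurable (completion M)"
proof (rule measurableI)
  fix E :: "'b set" assume E: "E \<in> sets borel"
  have G': "G \<in> borel_measurable (completion M)" using G by (rule measurable_completion)
  have [measurable]: "Measurable.pred (completion M) (\<lambda>x. F x \<noteq> G x)"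
    using eq by (intro sets_completion_AE) auto
  have "Measurable.pred (completion M) (\<lambda>x. \<not> F x \<noteq> G x)" by measurable
  then have [measurable]: "Measurable.pred (completion M) (\<lambda>x. F x = G x)" by simp
  have [measurable]: "Measurable.pred (completion M) (\<lambda>x. F x \<in> E \<and> F x \<noteq> G x)"
    using eq by (intro sets_completion_AE) auto
  have [measurable]: "Measurable.pred (completion M) (\<lambda>x. G x \<in> E)"
    using G' E by measurable
  have "Measurable.pred (completion M) (\<lambda>x. (G x \<in> E \<and> F x = G x) \<or> (F x \<in> E \<and> F x \<noteq> G x))"
    by measurable
  moreover have "{x \<in> space (completion M). (G x \<in> E \<and> F x = G x) \<or> (F x \<in> E \<and> F x \<noteq> G x)}
      = F -` E \<inter> space (completion M)" by auto
  ultimately show "F -` E \<inter> space (completion M) \<in> sets (completion M)"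
    by (simp add: pred_def)
qed simp

text \<open>
  The function \<open>F\<close> is constrained only almost everywhere: this is what the iterated integrals of a
  Lebesgue measurable function provide.
\<close>

lemma integral_completion_AE:
  fixes F :: "'a \<Rightarrow> 'b::{banach, second_countable_topology}"
  assumes G: "G \<in> borel_measurable M" and eq: "AE x in M. F x = G x"
  shows "integral\<^sup>L (completion M) F = integral\<^sup>L M G"
proof -
  have "integral\<^sup>L (completion M) F = integral\<^sup>L (completion M) G"
    by (intro integral_cong_AE borel_measurable_completion_AE[OF G eq] measurable_completion G AE_completion eq)
  then show ?thesis by (simp add: integral_completion G)
qed

lemma completion_ex_borel_measurable_complex:
  fixes F :: "'a \<Rightarrow> complex"
  assumes F: "F \<in> borel_measurable (completion M)"
  obtains G where "G \<in> borel_measurable M" "AE x in M. F x = G x"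
proof -
  have "(\<lambda>x. Re (F x)) \<in> borel_measurable (completion M)" "(\<lambda>x. Im (F x)) \<in> borel_measurable (completion M)"
    using F by measurable
  then obtain a b where ab: "a \<in> borel_measurable M" "AE x in M. Re (F x) = a x"
    "b \<in> borel_measurable M" "AE x in M. Im (F x) = b x"
    using completion_ex_borel_measurable_real by metis
  show ?thesis
  proof (rule that[of "\<lambda>x. Complex (a x) (b x)"])
    show "(\<lambda>x. Complex (a x) (b x)) \<in> borel_measurable M"
      using ab unfolding Complex_eq by measurable
    show "AE x in M. F x = Complex (a x) (b x)"
      using ab(2,4) by eventually_elim (simp add: complex_eq_iff)
  qed
qed

section \<open>Integrals over a variable subspace\<close>

lemma subspace_set_sum:
  fixes U T :: "'a::real_vector set"
  assumes "subspace U" "subspace T"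
  shows "subspace (U + T)"
proof -
  have "U + T = {x + y |x y. x \<in> U \<and> y \<in> T}" by (auto simp: set_plus_def)
  then show ?thesis using subspace_sums[OF assms] by simp
qed

lemma dim_orthogonal_sum:
  fixes U T :: "'a::euclidean_space set"
  assumes U: "subspace U" and T: "subspace T" and orth: "T \<subseteq> U\<^sup>\<bottom>"
  shows "dim (U + T) = dim U + dim T"
proof -
  have "U \<inter> T \<subseteq> {0}"
    using orth by (auto simp: orthogonal_comp_def) (use orthogonal_self in blast)
  then have "dim (U \<inter> T) = 0" by simp
  moreover have "U + T = {x + y |x y. x \<in> U \<and> y \<in> T}" by (auto simp: set_plus_def)
  ultimately show ?thesis using dim_sums_Int[OF U T] by (simp only: add_0_right)
qed

lemma proj_matrix_sum:
  fixes U T :: "(real^'n) set"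
  assumes U: "subspace U" and T: "subspace T" and orth: "T \<subseteq> U\<^sup>\<bottom>"
  shows "closest_point (U + T) y = (proj_matrix U + proj_matrix T) *v y"
proof -
  let ?u = "closest_point U y" and ?t = "closest_point T y"
  have in_sub: "?u \<in> U" "?t \<in> T" "y - ?u \<in> U\<^sup>\<bottom>" "y - ?t \<in> T\<^sup>\<bottom>"
    by (simp_all add: closest_point_in_subspace diff_closest_point_orthogonal U T)
  have "closest_point (U + T) y = ?u + ?t"
  proof (rule closest_point_subspaceI[OF subspace_set_sum[OF U T]])
    show "?u + ?t \<in> U + T" using in_sub by (simp add: set_plus_intro)
    have "(a + b) \<bullet> (y - (?u + ?t)) = 0" if ab: "a \<in> U" "b \<in> T" for a b
    proof -
      have "a \<bullet> (y - ?u) = 0" "b \<bullet> (y - ?t) = 0" "a \<bullet> ?t = 0" "?u \<bullet> b = 0"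
        using in_sub orth ab by (auto simp: orthogonal_comp_def orthogonal_def)
      then show ?thesis by (simp add: inner_simps inner_commute)
    qed
    then show "y - (?u + ?t) \<in> (U + T)\<^sup>\<bottom>"
      by (auto simp: orthogonal_comp_def orthogonal_def set_plus_def)
  qed
  then show ?thesis
    by (simp add: matrix_vector_mult_add_rdistrib proj_matrix_mult_vec U T)
qed

text \<open>
  Indicator of the slab around the range of a projection matrix \<open>R\<close>, meaningful and jointly measurable
  for arbitrary matrices \<open>R\<close>.
\<close>

definition slab_ind :: "real^'n^'n \<Rightarrow> real^'n \<Rightarrow> real" where
  "slab_ind R y = indicator (cball 0 1) (y - R *v y)"

lemma borel_measurable_slab_ind [measurable]:
  fixes f :: "'a \<Rightarrow> real^'n^'n"
  assumes [measurable]: "f \<in> borel_measurable M" "h \<in> borel_measurable M"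
  shows "(\<lambda>z. slab_ind (f z) (h z)) \<in> borel_measurable M"
proof -
  have [measurable]: "(indicator (cball 0 1) :: real^'n \<Rightarrow> real) \<in> borel_measurable borel"
    by (intro borel_measurable_indicator) simp
  show ?thesis unfolding slab_ind_def by measurable
qed

lemma slab_weight_sum:
  fixes y :: "real^'n"
  assumes \<eta>: "subspace \<eta>" and Q: "Q \<in> grassmannian q (\<eta>\<^sup>\<bottom>)"
  shows "slab_weight (\<eta> + Q) y =
    slab_ind (proj_matrix \<eta> + proj_matrix Q) y / unit_ball_vol (real (CARD('n) - (dim \<eta> + q)))"
  using grassmannianD[OF Q]
  by (simp add: slab_weight_def slab_ind_def proj_matrix_sum[OF \<eta>] dim_orthogonal_sum[OF \<eta>])

text \<open>
  In the slab form the subspace enters only through its projection matrix, and the projection matrix of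
  \<open>\<eta> + Q\<close> is the sum of those of \<open>\<eta>\<close> and \<open>Q\<close>.
\<close>

lemma measurable_nn_integral_plane_measure_sum:
  fixes \<eta> :: "(real^'n) set"
  assumes \<eta>: "subspace \<eta>" and [measurable]: "h \<in> borel_measurable borel"
  shows "(\<lambda>Q. \<integral>\<^sup>+z. h z \<partial>plane_measure (\<eta> + Q)) \<in> borel_measurable (grassmannian_borel q (\<eta>\<^sup>\<bottom>))"
proof (subst measurable_cong)
  let ?R = "\<lambda>Q. proj_matrix \<eta> + proj_matrix Q"
  let ?w = "unit_ball_vol (real (CARD('n) - (dim \<eta> + q)))"
  show "(\<lambda>Q. \<integral>\<^sup>+y. ennreal (slab_ind (?R Q) y / ?w) * h (?R Q *v y) \<partial>lborel)
    \<in> borel_measurable (grassmannian_borel q (\<eta>\<^sup>\<bottom>))" by measurable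
  fix Q assume "Q \<in> space (grassmannian_borel q (\<eta>\<^sup>\<bottom>))"
  then have Q: "Q \<in> grassmannian q (\<eta>\<^sup>\<bottom>)" by simp
  note Q' = grassmannianD[OF Q]
  have S: "subspace (\<eta> + Q)" by (rule subspace_set_sum[OF \<eta> Q'(1)])
  have [measurable]: "closest_point (\<eta> + Q) \<in> borel_measurable borel" "slab_weight (\<eta> + Q) \<in> borel_measurable borel"
    by (simp_all add: borel_measurable_closest_point borel_measurable_slab_weight S)
  have "(\<integral>\<^sup>+z. h z \<partial>plane_measure (\<eta> + Q))
      = (\<integral>\<^sup>+y. ennreal (slab_weight (\<eta> + Q) y) * h (closest_point (\<eta> + Q) y) \<partial>lborel)"
    unfolding plane_measure_slab[OF S]
    by (subst nn_integral_distr, simp, simp, subst nn_integral_density) simp_all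
  then show "(\<integral>\<^sup>+z. h z \<partial>plane_measure (\<eta> + Q))
      = (\<integral>\<^sup>+y. ennreal (slab_ind (?R Q) y / ?w) * h (?R Q *v y) \<partial>lborel)"
    by (simp add: slab_weight_sum[OF \<eta> Q] proj_matrix_sum[OF \<eta> Q'(1,2)])
qed

lemma measurable_integral_plane_measure_sum:
  fixes \<eta> :: "(real^'n) set" and g :: "real^'n \<Rightarrow> complex"
  assumes \<eta>: "subspace \<eta>" and [measurable]: "g \<in> borel_measurable borel"
  shows "(\<lambda>Q. \<integral>z. g z \<partial>plane_measure (\<eta> + Q)) \<in> borel_measurable (grassmannian_borel q (\<eta>\<^sup>\<bottom>))"
proof (subst measurable_cong)
  let ?R = "\<lambda>Q. proj_matrix \<eta> + proj_matrix Q"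
  let ?w = "unit_ball_vol (real (CARD('n) - (dim \<eta> + q)))"
  show "(\<lambda>Q. \<integral>y. (slab_ind (?R Q) y / ?w) *\<^sub>R g (?R Q *v y) \<partial>lborel)
    \<in> borel_measurable (grassmannian_borel q (\<eta>\<^sup>\<bottom>))" by measurable
  fix Q assume "Q \<in> space (grassmannian_borel q (\<eta>\<^sup>\<bottom>))"
  then have Q: "Q \<in> grassmannian q (\<eta>\<^sup>\<bottom>)" by simp
  note Q' = grassmannianD[OF Q]
  have S: "subspace (\<eta> + Q)" by (rule subspace_set_sum[OF \<eta> Q'(1)])
  have [measurable]: "closest_point (\<eta> + Q) \<in> borel_measurable borel" "slab_weight (\<eta> + Q) \<in> borel_measurable borel"
    by (simp_all add: borel_measurable_closest_point borel_measurable_slab_weight S)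
  have "(\<integral>z. g z \<partial>plane_measure (\<eta> + Q))
      = (\<integral>y. slab_weight (\<eta> + Q) y *\<^sub>R g (closest_point (\<eta> + Q) y) \<partial>lborel)"
    unfolding plane_measure_slab[OF S]
    by (subst integral_distr, simp, simp, subst integral_density) (simp_all add: slab_weight_nonneg)
  then show "(\<integral>z. g z \<partial>plane_measure (\<eta> + Q))
      = (\<integral>y. (slab_ind (?R Q) y / ?w) *\<^sub>R g (?R Q *v y) \<partial>lborel)"
    by (simp add: slab_weight_sum[OF \<eta> Q] proj_matrix_sum[OF \<eta> Q'(1,2)])
qed

section \<open>Averages over rotations\<close>

lemma nn_integral_haar_right_mult:
  fixes h :: "real^'n^'n \<Rightarrow> ennreal"
  assumes [measurable]: "h \<in> borel_measurable borel" and B: "B \<in> orthogonal_group"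
  shows "(\<integral>\<^sup>+\<rho>. h (\<rho> ** B) \<partial>stabilizer_haar UNIV) = (\<integral>\<^sup>+\<rho>. h \<rho> \<partial>stabilizer_haar UNIV)"
proof -
  let ?H = "stabilizer_haar (UNIV :: (real^'n) set)"
  note H = stabilizer_haar_space[OF subspace_UNIV, where 'n = 'n]
  note [measurable] = H(4)
  have B': "B \<in> stabilizer UNIV" using B by (simp add: stabilizer_UNIV)
  have right: "(\<lambda>A. A ** B) \<in> ?H \<rightarrow>\<^sub>M ?H"
    by (rule measurable_into_matrix_group[OF H(1)]) (measurable, auto simp: H intro: mult_stabilizer B')
  have h: "h \<in> borel_measurable ?H"
    using measurable_compose[OF H(4) assms(1)] .
  have "right_invariant_prob (stabilizer UNIV) ?H"
    by (rule right_invariant_stabilizer_haar[OF subspace_UNIV])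
  then have "distr ?H ?H (\<lambda>A. A ** B) = ?H" using B' by (simp add: right_invariant_prob_def)
  then have "(\<integral>\<^sup>+\<rho>. h \<rho> \<partial>?H) = (\<integral>\<^sup>+\<rho>. h \<rho> \<partial>distr ?H ?H (\<lambda>A. A ** B))"
    by simp
  also have "\<dots> = (\<integral>\<^sup>+\<rho>. h (\<rho> ** B) \<partial>?H)"
    by (rule nn_integral_distr[OF right]) (simp add: h)
  finally show ?thesis ..
qed

text \<open>
  The average \<open>\<phi>\<close> of \<open>h (\<rho> z)\<close> over \<open>\<rho>\<close> depends only on the norm of \<open>z\<close>, so polar coordinates turn its
  integral over \<open>S\<close> into a weighted one over the whole space. There the rotation \<open>\<rho>\<close> disappears by the
  invariance of Lebesgue measure.
\<close>

lemma haar_average_plane_measure: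
  fixes S :: "(real^'n) set" and h :: "real^'n \<Rightarrow> ennreal"
  assumes S: "subspace S" and m: "dim S > 0" and [measurable]: "h \<in> borel_measurable borel"
  shows "(\<integral>\<^sup>+\<rho>. (\<integral>\<^sup>+z. h (\<rho> *v z) \<partial>plane_measure S) \<partial>stabilizer_haar UNIV)
    = (\<integral>\<^sup>+z. ennreal (sphere_ratio (dim S) CARD('n) * norm z powr (real (dim S) - real CARD('n))) * h z \<partial>lborel)"
proof -
  let ?H = "stabilizer_haar (UNIV :: (real^'n) set)"
  note H = stabilizer_haar_space[OF subspace_UNIV, where 'n = 'n]
  note [measurable] = H(4)
  let ?k = "\<lambda>z :: real^'n. ennreal (sphere_ratio (dim S) CARD('n) * norm z powr (real (dim S) - real CARD('n)))"
  interpret H: finite_measure ?H by (rule H(5))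
  interpret S: sigma_finite_measure "plane_measure S" by (rule sigma_finite_plane_measure[OF S])
  interpret HS: pair_sigma_finite ?H "plane_measure S" ..
  interpret HL: pair_sigma_finite ?H lborel ..
  \<comment> \<open>Any unit vector serves as the reference direction.\<close>
  define e :: "real^'n" where "e = axis undefined 1"
  have e: "norm e = 1" by (simp add: e_def)
  define \<phi> where "\<phi> r = (\<integral>\<^sup>+\<rho>. h (\<rho> *v (r *\<^sub>R e)) \<partial>?H)" for r
  have [measurable]: "\<phi> \<in> borel_measurable borel" unfolding \<phi>_def[abs_def] by measurable
  have radial: "(\<integral>\<^sup>+\<rho>. h (\<rho> *v z) \<partial>?H) = \<phi> (norm z)" for z
  proof -
    have "norm (norm z *\<^sub>R e) = norm z" by (simp add: e)
    then obtain T where T: "orthogonal_transformation T" "T (norm z *\<^sub>R e) = z"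
      using orthogonal_transformation_exists by metis
    define B where "B = matrix T"
    have lin: "linear T" using T(1) by (rule orthogonal_transformation_linear)
    have B: "B \<in> orthogonal_group" "B *v (norm z *\<^sub>R e) = z"
      using T lin by (simp_all add: B_def orthogonal_group_def orthogonal_transformation_matrix matrix_works)
    have "\<phi> (norm z) = (\<integral>\<^sup>+\<rho>. h ((\<rho> ** B) *v (norm z *\<^sub>R e)) \<partial>?H)"
      unfolding \<phi>_def by (rule nn_integral_haar_right_mult[OF _ B(1), symmetric]) measurable
    then show ?thesis by (simp add: B(2) flip: matrix_vector_mul_assoc)
  qed
  have rotate: "(\<integral>\<^sup>+z. ?k z * h (\<rho> *v z) \<partial>lborel) = (\<integral>\<^sup>+z. ?k z * h z \<partial>lborel)"
    if "\<rho> \<in> orthogonal_group" for \<rho>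
  proof -
    note orth = orthogonal_group_transformation[OF that]
    have "(\<integral>\<^sup>+z. ?k z * h z \<partial>lborel) = (\<integral>\<^sup>+z. ?k z * h z \<partial>distr lborel borel ((*v) \<rho>))"
      by (simp add: lborel_isometry[OF orth])
    also have "\<dots> = (\<integral>\<^sup>+z. ?k (\<rho> *v z) * h (\<rho> *v z) \<partial>lborel)"
      by (subst nn_integral_distr) simp_all
    finally show ?thesis by (simp add: orthogonal_transformation_norm[OF orth])
  qed
  have "(\<integral>\<^sup>+\<rho>. (\<integral>\<^sup>+z. h (\<rho> *v z) \<partial>plane_measure S) \<partial>?H)
      = (\<integral>\<^sup>+z. (\<integral>\<^sup>+\<rho>. h (\<rho> *v z) \<partial>?H) \<partial>plane_measure S)"
    by (rule HS.Fubini'[symmetric]) measurable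
  also have "\<dots> = (\<integral>\<^sup>+z. \<phi> (norm z) \<partial>plane_measure S)" by (simp add: radial)
  also have "\<dots> = (\<integral>\<^sup>+z. ?k z * \<phi> (norm z) \<partial>lborel)"
    using nn_integral_plane_measure_radial[OF S m, of \<phi>] by simp
  also have "\<dots> = (\<integral>\<^sup>+z. (\<integral>\<^sup>+\<rho>. ?k z * h (\<rho> *v z) \<partial>?H) \<partial>lborel)"
    by (subst nn_integral_cmult) (simp_all add: radial)
  also have "\<dots> = (\<integral>\<^sup>+\<rho>. (\<integral>\<^sup>+z. ?k z * h (\<rho> *v z) \<partial>lborel) \<partial>?H)"
    by (rule HL.Fubini') measurable
  also have "\<dots> = (\<integral>\<^sup>+\<rho>. (\<integral>\<^sup>+z. ?k z * h z \<partial>lborel) \<partial>?H)"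
    by (intro nn_integral_cong rotate) (simp add: H stabilizer_UNIV)
  also have "\<dots> = (\<integral>\<^sup>+z. ?k z * h z \<partial>lborel)" by (simp add: H)
  finally show ?thesis .
qed

section \<open>The Strichartz transform of a plane transform\<close>

lemma affine_plane_coordinates:
  fixes \<eta> :: "(real^'n) set"
  assumes \<eta>: "\<eta> \<in> grassmannian m UNIV"
  shows "(+) x ` \<eta> \<in> affine_grassmannian m" "plane_direction ((+) x ` \<eta>) = \<eta>"
    "\<exists>e\<in>\<eta>. plane_foot ((+) x ` \<eta>) = x + e"
proof -
  note sub = grassmannianD(1)[OF \<eta>]
  let ?p = "closest_point \<eta> x"
  have v: "x - ?p \<in> \<eta>\<^sup>\<bottom>" by (rule diff_closest_point_orthogonal[OF sub])
  have p: "?p \<in> \<eta>" by (rule closest_point_in_subspace[OF sub])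
  have eq: "(+) x ` \<eta> = (+) (x - ?p) ` \<eta>"
  proof (intro equalityI subsetI)
    fix y assume "y \<in> (+) x ` \<eta>"
    then obtain a where "a \<in> \<eta>" "y = x + a" by auto
    then have "y = (x - ?p) + (?p + a)" "?p + a \<in> \<eta>" using p by (auto intro: subspace_add sub)
    then show "y \<in> (+) (x - ?p) ` \<eta>" by blast
  next
    fix y assume "y \<in> (+) (x - ?p) ` \<eta>"
    then obtain a where "a \<in> \<eta>" "y = x - ?p + a" by auto
    then have "y = x + (a - ?p)" "a - ?p \<in> \<eta>" using p by (auto intro: subspace_diff sub)
    then show "y \<in> (+) x ` \<eta>" by blast
  qed
  show "(+) x ` \<eta> \<in> affine_grassmannian m"
    unfolding affine_grassmannian_iff eq using \<eta> v by blast
  show "plane_direction ((+) x ` \<eta>) = \<eta>"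
    unfolding eq by (rule plane_coordinates(1)[OF sub v])
  have "plane_foot ((+) x ` \<eta>) = x + - ?p"
    unfolding eq using plane_coordinates(2)[OF sub v] by simp
  then show "\<exists>e\<in>\<eta>. plane_foot ((+) x ` \<eta>) = x + e"
    using subspace_neg[OF sub p] by blast
qed

lemma AE_plane_measure_translation:
  assumes "subspace T" "t \<in> T" "AE w in plane_measure T. P w"
  shows "AE w in plane_measure T. P (t + w)"
proof -
  have "AE w in distr (plane_measure T) borel ((+) t). P w"
    using assms(3) by (simp only: plane_measure_translation[OF assms(1,2)])
  then show ?thesis by (rule AE_distrD[rotated]) simp
qed

lemma integral_plane_measure_translation:
  fixes g :: "'a::euclidean_space \<Rightarrow> 'b::{banach, second_countable_topology}"
  assumes "subspace T" "t \<in> T" and g: "g \<in> borel_measurable borel"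
  shows "(\<integral>w. g (t + w) \<partial>plane_measure T) = (\<integral>w. g w \<partial>plane_measure T)"
proof -
  have "(\<integral>w. g w \<partial>plane_measure T) = (\<integral>w. g w \<partial>distr (plane_measure T) borel ((+) t))"
    using assms by (simp add: plane_measure_translation)
  also have "\<dots> = (\<integral>w. g (t + w) \<partial>plane_measure T)"
    by (rule integral_distr) (simp_all add: g)
  finally show ?thesis ..
qed

text \<open>
  The base point \<open>y\<close> need not be the foot of the plane: the two differ by a vector of \<open>T\<close>.
\<close>

lemma plane_transform_eq:
  fixes T :: "(real^'n) set"
  assumes T: "T \<in> grassmannian m UNIV" and [measurable]: "g \<in> borel_measurable borel"
    and eq: "AE w in plane_measure T. f (y + w) = g w"
  shows "plane_transform m f ((+) y ` T) = (\<integral>w. g w \<partial>plane_measure T)"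
proof -
  note sub = grassmannianD(1)[OF T]
  obtain e where e: "e \<in> T" "plane_foot ((+) y ` T) = y + e"
    using affine_plane_coordinates(3)[OF T] by blast
  have "plane_transform m f ((+) y ` T) = (\<integral>w. f (w + (y + e)) \<partial>subspace_lebesgue T)"
    using affine_plane_coordinates(1,2)[OF T] by (simp add: plane_transform_def e)
  also have "\<dots> = (\<integral>w. g (e + w) \<partial>plane_measure T)"
    unfolding subspace_lebesgue_plane_measure
  proof (rule integral_completion_AE)
    show "AE w in plane_measure T. f (w + (y + e)) = g (e + w)"
      using AE_plane_measure_translation[OF sub e(1) eq] by (simp add: add_ac)
  qed measurable
  also have "\<dots> = (\<integral>w. g w \<partial>plane_measure T)"
    by (rule integral_plane_measure_translation[OF sub e(1)]) simp
  finally show ?thesis .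
qed

text \<open>
  \<open>\<eta> + Q\<close> is the orthogonal sum of \<open>U = P\<^sup>\<bottom> \<inter> \<eta>\<close> and \<open>T = P + Q\<close>, so its integral is an iterated one, over \<open>U\<close> of
  plane transforms over \<open>T\<close>. The offset \<open>e\<close> between \<open>x\<close> and the foot of \<open>x + \<eta>\<close> splits into components along
  \<open>T\<close> and \<open>U\<close>, and each is absorbed by translation invariance.
\<close>

lemma strichartz_inner_integral:
  fixes f :: "real^'n \<Rightarrow> complex"
  assumes \<eta>: "\<eta> \<in> grassmannian k UNIV" and Q: "Q \<in> grassmannian q (\<eta>\<^sup>\<bottom>)" and P: "P \<in> grassmannian p \<eta>"
    and g [measurable]: "g \<in> borel_measurable borel"
    and eq: "AE z in plane_measure (\<eta> + Q). f (x + z) = g z"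
    and int: "integrable (plane_measure (\<eta> + Q)) g" and e: "e \<in> \<eta>"
  shows "(\<integral>u. plane_transform (p + q) f ((+) (u + (x + e)) ` (P + Q)) \<partial>subspace_lebesgue (P\<^sup>\<bottom> \<inter> \<eta>))
    = (\<integral>z. g z \<partial>plane_measure (\<eta> + Q))"
proof -
  note sub = grassmannianD(1)[OF \<eta>] grassmannianD(1)[OF P] grassmannianD(1)[OF Q]
  define U where "U = P\<^sup>\<bottom> \<inter> \<eta>"
  define T where "T = P + Q"
  have U: "subspace U" unfolding U_def by (intro subspace_inter subspace_orthogonal_comp sub)
  have T: "subspace T" unfolding T_def by (intro subspace_set_sum sub)
  have PQ: "Q \<subseteq> P\<^sup>\<bottom>"
    using grassmannianD(2)[OF P] grassmannianD(2)[OF Q] by (auto simp: orthogonal_comp_def)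
  have T_G: "T \<in> grassmannian (p + q) UNIV"
    using T dim_orthogonal_sum[OF sub(2,3) PQ] grassmannianD(3)[OF P] grassmannianD(3)[OF Q]
    by (simp add: grassmannian_def T_def)
  have TU: "T \<subseteq> U\<^sup>\<bottom>"
  proof
    fix t assume "t \<in> T"
    then obtain a b where ab: "a \<in> P" "b \<in> Q" "t = a + b" by (auto simp: T_def set_plus_def)
    have "orthogonal u t" if "u \<in> U" for u
    proof -
      have "orthogonal u a" using that ab(1) by (auto simp: U_def orthogonal_comp_def orthogonal_commute)
      moreover have "orthogonal u b" using that ab(2) grassmannianD(2)[OF Q] by (auto simp: U_def orthogonal_comp_def)
      ultimately show ?thesis by (simp add: ab(3) orthogonal_clauses)
    qed
    then show "t \<in> U\<^sup>\<bottom>" by (simp add: orthogonal_comp_def)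
  qed
  have split: "closest_point P a \<in> P" "a - closest_point P a \<in> U" if "a \<in> \<eta>" for a
  proof -
    show p: "closest_point P a \<in> P" by (rule closest_point_in_subspace[OF sub(2)])
    then show "a - closest_point P a \<in> U"
      using diff_closest_point_orthogonal[OF sub(2), of a] grassmannianD(2)[OF P] that
      by (auto simp: U_def intro!: subspace_diff[OF sub(1)])
  qed
  have UT: "U + T = \<eta> + Q"
  proof (intro equalityI subsetI)
    fix z assume "z \<in> U + T"
    then obtain u a b where z: "u \<in> U" "a \<in> P" "b \<in> Q" "z = u + (a + b)"
      by (auto simp: T_def set_plus_def)
    then have "u + a \<in> \<eta>" using grassmannianD(2)[OF P] by (auto simp: U_def intro: subspace_add[OF sub(1)])
    then have "(u + a) + b \<in> \<eta> + Q" using z(3) by (rule set_plus_intro)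
    then show "z \<in> \<eta> + Q" by (simp add: z(4) add_ac)
  next
    fix z assume "z \<in> \<eta> + Q"
    then obtain a b where z: "a \<in> \<eta>" "b \<in> Q" "z = a + b" by (auto simp: set_plus_def)
    then have "(a - closest_point P a) + (closest_point P a + b) \<in> U + T"
      unfolding T_def by (intro set_plus_intro split)
    then show "z \<in> U + T" by (simp add: z(3))
  qed
  interpret T: sigma_finite_measure "plane_measure T" by (rule sigma_finite_plane_measure[OF T])
  interpret U: sigma_finite_measure "plane_measure U" by (rule sigma_finite_plane_measure[OF U])
  interpret pair_sigma_finite "plane_measure U" "plane_measure T" ..
  have S: "plane_measure (\<eta> + Q) = distr (plane_measure U \<Otimes>\<^sub>M plane_measure T) borel (\<lambda>(u, w). u + w)"
    using plane_measure_sum[OF U T TU] by (simp add: UT)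
  define G where "G u = (\<integral>w. g (u + w) \<partial>plane_measure T)" for u
  have [measurable]: "G \<in> borel_measurable borel" unfolding G_def by measurable
  have "AE uw in plane_measure U \<Otimes>\<^sub>M plane_measure T. f (x + (fst uw + snd uw)) = g (fst uw + snd uw)"
    using AE_distrD[OF _ eq[unfolded S]] by (simp add: case_prod_unfold)
  then have inner_eq: "AE u in plane_measure U. AE w in plane_measure T. f (x + (u + w)) = g (u + w)"
    by (auto dest: AE_pair)
  have "integrable (plane_measure U \<Otimes>\<^sub>M plane_measure T) (\<lambda>uw. g (fst uw + snd uw))"
    using int unfolding S by (subst (asm) integrable_distr_eq) (auto simp: case_prod_unfold)
  from integral_fst'[OF this] have "(\<integral>u. G u \<partial>plane_measure U)
      = (\<integral>uw. g (fst uw + snd uw) \<partial>(plane_measure U \<Otimes>\<^sub>M plane_measure T))"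
    by (simp add: G_def)
  also have "\<dots> = (\<integral>z. g z \<partial>plane_measure (\<eta> + Q))"
    unfolding S by (subst integral_distr) (auto simp: case_prod_unfold)
  finally have outer: "(\<integral>u. G u \<partial>plane_measure U) = (\<integral>z. g z \<partial>plane_measure (\<eta> + Q))" .
  \<comment> \<open>The components of the offset along \<open>T\<close> and \<open>U\<close>.\<close>
  define e1 where "e1 = closest_point P e"
  define e2 where "e2 = e - e1"
  have e12: "e1 \<in> T" "e2 \<in> U" "e = e1 + e2"
    using split[OF e] set_zero_plus2[of Q P] subspace_0[OF sub(3)]
    by (auto simp: e1_def e2_def T_def add.commute[of P])
  have "AE u in plane_measure U. plane_transform (p + q) f ((+) (u + (x + e)) ` T) = G (e2 + u)"
    using AE_plane_measure_translation[OF U e12(2) inner_eq]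
  proof eventually_elim
    case (elim u)
    have "AE w in plane_measure T. f (u + (x + e) + w) = g ((e2 + u) + (e1 + w))"
      using AE_plane_measure_translation[OF T e12(1) elim] by (simp add: e12(3) add_ac)
    then have "plane_transform (p + q) f ((+) (u + (x + e)) ` T) = (\<integral>w. g ((e2 + u) + (e1 + w)) \<partial>plane_measure T)"
      by (intro plane_transform_eq[OF T_G]) measurable
    also have "\<dots> = G (e2 + u)"
      unfolding G_def by (rule integral_plane_measure_translation[OF T e12(1)]) measurable
    finally show ?case .
  qed
  then have "(\<integral>u. plane_transform (p + q) f ((+) (u + (x + e)) ` T) \<partial>subspace_lebesgue U)
      = (\<integral>u. G (e2 + u) \<partial>plane_measure U)"
    unfolding subspace_lebesgue_plane_measure by (intro integral_completion_AE) measurable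
  also have "\<dots> = (\<integral>u. G u \<partial>plane_measure U)"
    by (rule integral_plane_measure_translation[OF U e12(2)]) simp
  also note outer
  finally show ?thesis by (simp only: U_def T_def)
qed

lemma grassmannian_prob_space:
  fixes X :: "(real^'n) set"
  assumes X: "subspace X" and m: "m \<le> dim X"
  shows "space (grassmannian_prob m X) = grassmannian m X"
    "emeasure (grassmannian_prob m X) (grassmannian m X) = 1"
proof -
  obtain \<xi> where "subspace \<xi>" "\<xi> \<subseteq> span X" "dim \<xi> = m"
    using choose_subspace_of_subspace[OF m] by metis
  then have \<xi>: "\<xi> \<in> grassmannian m X" using span_eq_iff[THEN iffD2, OF X] by (simp add: grassmannian_def)
  show "space (grassmannian_prob m X) = grassmannian m X"
    using grassmannian_prob_orbit[OF X mat_1_orthogonal_group \<xi>] by simp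
  show "emeasure (grassmannian_prob m X) (grassmannian m X) = 1"
    using grassmannian_prob_orbit[OF X mat_1_orthogonal_group \<xi>] invariant_prob_orbit[OF X mat_1_orthogonal_group \<xi>]
      sets.top[of "grassmannian_borel m X"]
    by (simp add: is_invariant_prob_def)
qed

text \<open>
  The value of the innermost integral does not involve \<open>P\<close>, and the \<open>P\<close> are averaged with a probability.
\<close>

lemma strichartz_plane_transform_eq:
  fixes f :: "real^'n \<Rightarrow> complex"
  assumes \<eta>: "\<eta> \<in> grassmannian k UNIV" and p: "p \<le> k"
    and D: "grassmannian_prob q (\<eta>\<^sup>\<bottom>) = completion D"
      "sets D = sets (grassmannian_borel q (\<eta>\<^sup>\<bottom>))"
    and g [measurable]: "g \<in> borel_measurable borel"
    and good: "AE Q in D. integrable (plane_measure (\<eta> + Q)) g \<and>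
      (AE z in plane_measure (\<eta> + Q). f (x + z) = g z)"
  shows "strichartz k p q (plane_transform (p + q) f) ((+) x ` \<eta>)
    = (\<integral>Q. (\<integral>z. g z \<partial>plane_measure (\<eta> + Q)) \<partial>D)"
proof -
  note sub = grassmannianD(1)[OF \<eta>]
  have space_D: "space D = grassmannian q (\<eta>\<^sup>\<bottom>)" using sets_eq_imp_space_eq[OF D(2)] by simp
  obtain e where e: "e \<in> \<eta>" "plane_foot ((+) x ` \<eta>) = x + e"
    using affine_plane_coordinates(3)[OF \<eta>] by blast
  have P_prob: "space (grassmannian_prob p \<eta>) = grassmannian p \<eta>"
    "measure (grassmannian_prob p \<eta>) (grassmannian p \<eta>) = 1"
    using grassmannian_prob_space[OF sub, of p] p grassmannianD(3)[OF \<eta>] by (simp_all add: measure_def)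
  have "strichartz k p q (plane_transform (p + q) f) ((+) x ` \<eta>)
    = (\<integral>Q. (\<integral>P. (\<integral>u. plane_transform (p + q) f ((+) (u + (x + e)) ` (P + Q))
        \<partial>subspace_lebesgue (P\<^sup>\<bottom> \<inter> \<eta>)) \<partial>grassmannian_prob p \<eta>) \<partial>completion D)"
    using affine_plane_coordinates(1,2)[OF \<eta>] by (simp add: strichartz_def e(2) Let_def D(1))
  also have "\<dots> = (\<integral>Q. (\<integral>z. g z \<partial>plane_measure (\<eta> + Q)) \<partial>D)"
  proof (rule integral_completion_AE)
    show "(\<lambda>Q. \<integral>z. g z \<partial>plane_measure (\<eta> + Q)) \<in> borel_measurable D"
      using measurable_integral_plane_measure_sum[OF sub g] by (simp cong: measurable_cong_sets add: D(2))
    show "AE Q in D. (\<integral>P. (\<integral>u. plane_transform (p + q) f ((+) (u + (x + e)) ` (P + Q))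
        \<partial>subspace_lebesgue (P\<^sup>\<bottom> \<inter> \<eta>)) \<partial>grassmannian_prob p \<eta>) = (\<integral>z. g z \<partial>plane_measure (\<eta> + Q))"
      using good AE_space
    proof eventually_elim
      case (elim Q)
      then have Q: "Q \<in> grassmannian q (\<eta>\<^sup>\<bottom>)" by (simp add: space_D)
      have "(\<integral>P. (\<integral>u. plane_transform (p + q) f ((+) (u + (x + e)) ` (P + Q))
          \<partial>subspace_lebesgue (P\<^sup>\<bottom> \<inter> \<eta>)) \<partial>grassmannian_prob p \<eta>)
        = (\<integral>P. (\<integral>z. g z \<partial>plane_measure (\<eta> + Q)) \<partial>grassmannian_prob p \<eta>)"
        using elim e(1)
        by (intro Bochner_Integration.integral_cong refl strichartz_inner_integral[OF \<eta> Q]) (auto simp: P_prob)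
      then show ?case by (simp add: P_prob)
    qed
  qed
  finally show ?thesis .
qed

lemma orthogonal_comp_orthogonal_image:
  fixes X :: "(real^'n) set"
  assumes A: "A \<in> orthogonal_group"
  shows "((*v) A ` X)\<^sup>\<bottom> = (*v) A ` (X\<^sup>\<bottom>)"
proof -
  note T = orthogonal_group_transformation[OF A]
  have "y \<in> ((*v) A ` X)\<^sup>\<bottom> \<longleftrightarrow> y \<in> (*v) A ` (X\<^sup>\<bottom>)" for y
  proof -
    obtain z where "y = A *v z" using orthogonal_transformation_surj[OF T] by (metis surjD)
    then show ?thesis
      using orthogonal_transformation_inj[OF T]
      by (auto simp: orthogonal_comp_def orthogonal_orthogonal_transformation[OF T] inj_image_mem_iff)
  qed
  then show ?thesis by blast
qed

lemma stabilizer_orthogonal_comp: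
  assumes X: "subspace X" and A: "A \<in> stabilizer (X\<^sup>\<bottom>)"
  shows "A \<in> stabilizer X"
proof -
  have "(*v) A ` X = (*v) A ` ((X\<^sup>\<bottom>)\<^sup>\<bottom>)" using X by (simp add: orthogonal_comp_self)
  also have "\<dots> = (X\<^sup>\<bottom>)\<^sup>\<bottom>"
    using orthogonal_comp_orthogonal_image[OF stabilizerD(1)[OF A], of "X\<^sup>\<bottom>"] by (simp add: stabilizerD(2)[OF A])
  finally show ?thesis
    using X stabilizerD(1)[OF A] by (simp add: stabilizer_def orthogonal_comp_self)
qed


lemma image_set_plus_linear:
  assumes "linear L"
  shows "L ` (U + T) = L ` U + L ` T"
proof (intro equalityI subsetI)
  fix y assume "y \<in> L ` (U + T)"
  then obtain a b where "a \<in> U" "b \<in> T" "y = L a + L b"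
    by (auto simp: set_plus_def linear_add[OF assms])
  then show "y \<in> L ` U + L ` T" by (auto intro: set_plus_intro)
next
  fix y assume "y \<in> L ` U + L ` T"
  then obtain a b where "a \<in> U" "b \<in> T" "y = L (a + b)"
    by (auto simp: set_plus_def linear_add[OF assms])
  then show "y \<in> L ` (U + T)" by (auto intro: set_plus_intro)
qed

lemma plane_measure_orthogonal_group_image:
  fixes S :: "(real^'n) set"
  assumes "A \<in> orthogonal_group" "subspace S"
  shows "plane_measure ((*v) A ` S) = distr (plane_measure S) borel ((*v) A)"
  by (rule plane_measure_orthogonal_image[OF orthogonal_group_transformation[OF assms(1)] assms(2)])

text \<open>
  For fixed \<open>A\<close> the product \<open>\<rho> A\<close> is again Haar distributed.
\<close>

lemma nn_integral_haar_stabilizer_plane_measure: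
  fixes S X :: "(real^'n) set" and h :: "real^'n \<Rightarrow> ennreal"
  assumes X: "subspace X" and S: "subspace S" and m: "dim S > 0" and [measurable]: "h \<in> borel_measurable borel"
  shows "(\<integral>\<^sup>+\<rho>. (\<integral>\<^sup>+A. (\<integral>\<^sup>+z. h ((\<rho> ** A) *v z) \<partial>plane_measure S) \<partial>stabilizer_haar X) \<partial>stabilizer_haar UNIV)
    = (\<integral>\<^sup>+z. ennreal (sphere_ratio (dim S) CARD('n) * norm z powr (real (dim S) - real CARD('n))) * h z \<partial>lborel)"
proof -
  let ?H = "stabilizer_haar (UNIV :: (real^'n) set)" and ?K = "stabilizer_haar X"
  note H = stabilizer_haar_space[OF subspace_UNIV, where 'n = 'n]
  note K = stabilizer_haar_space[OF X]
  note [measurable] = H(4) K(4)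
  interpret H: finite_measure ?H by (rule H(5))
  interpret K: finite_measure ?K by (rule K(5))
  interpret S: sigma_finite_measure "plane_measure S" by (rule sigma_finite_plane_measure[OF S])
  interpret HK: pair_sigma_finite ?K ?H ..
  have "(\<integral>\<^sup>+\<rho>. (\<integral>\<^sup>+A. (\<integral>\<^sup>+z. h ((\<rho> ** A) *v z) \<partial>plane_measure S) \<partial>?K) \<partial>?H)
      = (\<integral>\<^sup>+A. (\<integral>\<^sup>+\<rho>. (\<integral>\<^sup>+z. h ((\<rho> ** A) *v z) \<partial>plane_measure S) \<partial>?H) \<partial>?K)"
    by (rule HK.Fubini') measurable
  also have "\<dots> = (\<integral>\<^sup>+A. (\<integral>\<^sup>+\<rho>. (\<integral>\<^sup>+z. h (\<rho> *v z) \<partial>plane_measure S) \<partial>?H) \<partial>?K)"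
  proof (rule nn_integral_cong)
    fix A assume "A \<in> space ?K"
    then have A: "A \<in> orthogonal_group" using K(2) stabilizerD(1) by blast
    show "(\<integral>\<^sup>+\<rho>. (\<integral>\<^sup>+z. h ((\<rho> ** A) *v z) \<partial>plane_measure S) \<partial>?H)
      = (\<integral>\<^sup>+\<rho>. (\<integral>\<^sup>+z. h (\<rho> *v z) \<partial>plane_measure S) \<partial>?H)"
      by (rule nn_integral_haar_right_mult[OF _ A]) measurable
  qed
  also have "\<dots> = (\<integral>\<^sup>+\<rho>. (\<integral>\<^sup>+z. h (\<rho> *v z) \<partial>plane_measure S) \<partial>?H)"
    by (simp add: K)
  finally show ?thesis by (simp add: haar_average_plane_measure[OF S m])
qed

section \<open>The composition as a Riesz potential\<close>

text \<open>
  All integrals are collected on the product \<open>\<Omega>\<close> of the Haar measure, the Haar measure of the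
  stabilizer and Lebesgue measure on \<open>S = \<eta>\<^sub>0 + Q\<^sub>0\<close>, along the map \<open>\<tau> (\<rho>, A, z) = \<rho> A z\<close>. The image of \<open>\<Omega>\<close>
  is Lebesgue measure weighted by a multiple of \<open>|z|^(m-n)\<close>. Hence \<open>g \<circ> \<tau>\<close> is integrable and \<open>\<tau>\<close> avoids the exceptional
  null set almost surely, and Fubini passes both facts on to almost every plane.
\<close>

lemma dual_strichartz_plane_transform:
  fixes f g :: "real^'n \<Rightarrow> complex" and \<eta>\<^sub>0 :: "(real^'n) set"
  assumes \<eta>\<^sub>0: "\<eta>\<^sub>0 \<in> grassmannian k UNIV" and p: "p \<le> k" and q: "k + q \<le> CARD('n)" "0 < k + q"
    and g [measurable]: "g \<in> borel_measurable borel"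
    and eq: "AE z in lborel. f (x + z) = g z"
    and int: "integrable lborel (\<lambda>z. (norm z powr (real (k + q) - real CARD('n))) *\<^sub>R g z)"
  shows "dual_plane_transform \<eta>\<^sub>0 (strichartz k p q (plane_transform (p + q) f)) x
    = sphere_ratio (k + q) CARD('n) *\<^sub>R (\<integral>z. (norm z powr (real (k + q) - real CARD('n))) *\<^sub>R g z \<partial>lborel)"
proof -
  let ?m = "k + q" and ?n = "CARD('n)"
  note sub = grassmannianD(1)[OF \<eta>\<^sub>0]
  define X where "X = \<eta>\<^sub>0\<^sup>\<bottom>"
  have X: "subspace X" unfolding X_def by (rule subspace_orthogonal_comp)
  have "dim X + k = ?n"
  proof -
    have "X = {y \<in> UNIV. \<forall>a\<in>\<eta>\<^sub>0. orthogonal a y}" by (auto simp: X_def orthogonal_comp_def)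
    then show ?thesis
      using dim_subspace_orthogonal_to_vectors[OF sub subspace_UNIV] grassmannianD(3)[OF \<eta>\<^sub>0] by (simp add: dim_UNIV)
  qed
  then have "q \<le> dim X" using q by simp
  then obtain Q\<^sub>0 where Q\<^sub>0: "Q\<^sub>0 \<in> grassmannian q X"
    using choose_subspace_of_subspace[of q X] span_eq_iff[THEN iffD2, OF X] by (auto simp: grassmannian_def)
  define S where "S = \<eta>\<^sub>0 + Q\<^sub>0"
  have S: "subspace S" unfolding S_def by (intro subspace_set_sum sub grassmannianD(1)[OF Q\<^sub>0])
  have dim_S: "dim S = ?m"
    using dim_orthogonal_sum[OF sub grassmannianD(1)[OF Q\<^sub>0]] grassmannianD[OF Q\<^sub>0] grassmannianD(3)[OF \<eta>\<^sub>0]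
    by (simp add: S_def X_def)
  let ?H = "stabilizer_haar (UNIV :: (real^'n) set)" and ?K = "stabilizer_haar X" and ?M = "plane_measure S"
  note H = stabilizer_haar_space[OF subspace_UNIV, where 'n = 'n]
  note K = stabilizer_haar_space[OF X]
  note [measurable] = H(4) K(4)
  interpret H: finite_measure ?H by (rule H(5))
  interpret K: finite_measure ?K by (rule K(5))
  interpret M: sigma_finite_measure ?M by (rule sigma_finite_plane_measure[OF S])
  interpret KM: pair_sigma_finite ?K ?M ..
  interpret HKM: pair_sigma_finite ?H "?K \<Otimes>\<^sub>M ?M" ..
  define \<Omega> where "\<Omega> = ?H \<Otimes>\<^sub>M (?K \<Otimes>\<^sub>M ?M)"
  define \<tau> where "\<tau> = (\<lambda>(\<rho> :: real^'n^'n, A :: real^'n^'n, z :: real^'n). (\<rho> ** A) *v z)"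
  define w where "w z = sphere_ratio ?m ?n * norm z powr (real ?m - real ?n)" for z :: "real^'n"
  have w_nonneg: "w z \<ge> 0" for z by (simp add: w_def sphere_ratio_def)
  have [measurable]: "w \<in> borel_measurable borel" unfolding w_def[abs_def] by measurable
  have \<tau> [measurable]: "\<tau> \<in> borel_measurable \<Omega>" unfolding \<tau>_def \<Omega>_def by measurable
  have \<Lambda>: "distr \<Omega> borel \<tau> = density lborel (\<lambda>z. ennreal (w z))"
  proof (rule measure_eqI)
    fix E assume "E \<in> sets (distr \<Omega> borel \<tau>)"
    then have [measurable]: "E \<in> sets borel" by simp
    have "emeasure (distr \<Omega> borel \<tau>) E = (\<integral>\<^sup>+z. indicator E z \<partial>distr \<Omega> borel \<tau>)" by simp
    also have "\<dots> = (\<integral>\<^sup>+\<omega>. indicator E (\<tau> \<omega>) \<partial>\<Omega>)"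
      by (rule nn_integral_distr) simp_all
    also have "\<dots> = (\<integral>\<^sup>+\<rho>. (\<integral>\<^sup>+Az. indicator E (\<tau> (\<rho>, Az)) \<partial>(?K \<Otimes>\<^sub>M ?M)) \<partial>?H)"
      unfolding \<Omega>_def by (rule KM.nn_integral_fst[symmetric]) (use \<tau> in \<open>simp add: \<Omega>_def\<close>)
    also have "\<dots> = (\<integral>\<^sup>+\<rho>. (\<integral>\<^sup>+A. (\<integral>\<^sup>+z. indicator E ((\<rho> ** A) *v z) \<partial>?M) \<partial>?K) \<partial>?H)"
      unfolding \<tau>_def by (subst M.nn_integral_fst[symmetric]) simp_all
    also have "\<dots> = (\<integral>\<^sup>+z. ennreal (w z) * indicator E z \<partial>lborel)"
      using nn_integral_haar_stabilizer_plane_measure[OF X S, of "indicator E"] q(2) by (simp add: dim_S w_def)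
    finally show "emeasure (distr \<Omega> borel \<tau>) E = emeasure (density lborel (\<lambda>z. ennreal (w z))) E"
      by (simp add: emeasure_density)
  qed simp
  obtain N where N: "N \<in> null_sets lborel" "\<And>z. z \<notin> N \<Longrightarrow> f (x + z) = g z"
    using AE_E3[OF eq] by auto
  have [measurable]: "N \<in> sets borel" using N(1) by auto
  have int_w: "integrable lborel (\<lambda>z. w z *\<^sub>R g z)"
    using integrable_scaleR_right[OF int, of "sphere_ratio ?m ?n"] by (simp add: w_def)
  have "integrable (distr \<Omega> borel \<tau>) g"
    unfolding \<Lambda> using int_w by (subst integrable_density) (simp_all add: w_nonneg)
  then have int_\<tau>: "integrable (?H \<Otimes>\<^sub>M (?K \<Otimes>\<^sub>M ?M)) (\<lambda>\<omega>. g (\<tau> \<omega>))"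
    by (subst (asm) integrable_distr_eq) (simp_all add: \<Omega>_def[symmetric])
  have "AE z in distr \<Omega> borel \<tau>. z \<notin> N"
    unfolding \<Lambda> using AE_not_in[OF N(1)] by (subst AE_density) (auto elim: eventually_mono)
  then have "AE \<omega> in ?H \<Otimes>\<^sub>M (?K \<Otimes>\<^sub>M ?M). \<tau> \<omega> \<notin> N"
    using AE_distrD[OF \<tau>] unfolding \<Omega>_def by blast
  then have null: "AE \<rho> in ?H. AE Az in ?K \<Otimes>\<^sub>M ?M. \<tau> (\<rho>, Az) \<notin> N"
    by (rule HKM.AE_pair)
  have total: "(\<integral>\<rho>. (\<integral>Az. g (\<tau> (\<rho>, Az)) \<partial>(?K \<Otimes>\<^sub>M ?M)) \<partial>?H) = (\<integral>z. w z *\<^sub>R g z \<partial>lborel)"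
  proof -
    have "(\<integral>\<rho>. (\<integral>Az. g (\<tau> (\<rho>, Az)) \<partial>(?K \<Otimes>\<^sub>M ?M)) \<partial>?H) = (\<integral>\<omega>. g (\<tau> \<omega>) \<partial>\<Omega>)"
      unfolding \<Omega>_def by (rule HKM.integral_fst'[OF int_\<tau>])
    also have "\<dots> = (\<integral>z. g z \<partial>distr \<Omega> borel \<tau>)" by (rule integral_distr[symmetric]) simp_all
    also have "\<dots> = (\<integral>z. w z *\<^sub>R g z \<partial>lborel)"
      unfolding \<Lambda> by (rule integral_density) (simp_all add: w_nonneg)
    finally show ?thesis .
  qed
  have fiber: "strichartz k p q (plane_transform (p + q) f) ((+) x ` (*v) \<rho> ` \<eta>\<^sub>0)
      = (\<integral>Az. g (\<tau> (\<rho>, Az)) \<partial>(?K \<Otimes>\<^sub>M ?M))"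
    if \<rho>: "\<rho> \<in> orthogonal_group" and int_\<rho>: "integrable (?K \<Otimes>\<^sub>M ?M) (\<lambda>Az. g (\<tau> (\<rho>, Az)))"
      and null_\<rho>: "AE Az in ?K \<Otimes>\<^sub>M ?M. \<tau> (\<rho>, Az) \<notin> N" for \<rho>
  proof -
    define \<eta> where "\<eta> = (*v) \<rho> ` \<eta>\<^sub>0"
    have \<eta>: "\<eta> \<in> grassmannian k UNIV"
      using grassmannian_image[OF \<rho> \<eta>\<^sub>0] by (auto simp: \<eta>_def grassmannian_def)
    have sub_\<eta>: "subspace \<eta>" using \<eta> by (rule grassmannianD)
    have Y: "\<eta>\<^sup>\<bottom> = (*v) \<rho> ` X"
      unfolding \<eta>_def X_def by (rule orthogonal_comp_orthogonal_image[OF \<rho>])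
    let ?Q = "\<lambda>A. (*v) (\<rho> ** A) ` Q\<^sub>0"
    let ?\<Gamma> = "grassmannian_borel q (\<eta>\<^sup>\<bottom>)"
    have orbit [measurable]: "?Q \<in> ?K \<rightarrow>\<^sub>M ?\<Gamma>"
      using measurable_orbit_map[OF X \<rho> Q\<^sub>0] by (simp add: Y)
    have plane: "plane_measure (\<eta> + ?Q A) = distr ?M borel (\<lambda>z. (\<rho> ** A) *v z)" if "A \<in> space ?K" for A
    proof -
      have A: "A \<in> stabilizer (\<eta>\<^sub>0\<^sup>\<bottom>)" using that by (simp add: K flip: X_def)
      have "(*v) (\<rho> ** A) ` S = (*v) (\<rho> ** A) ` \<eta>\<^sub>0 + ?Q A"
        unfolding S_def by (rule image_set_plus_linear) simp
      also have "(*v) (\<rho> ** A) ` \<eta>\<^sub>0 = \<eta>"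
        by (simp only: mult_vec_image_compose stabilizerD(2)[OF stabilizer_orthogonal_comp[OF sub A]] \<eta>_def)
      finally show ?thesis
        using plane_measure_orthogonal_group_image[OF mult_orthogonal_group[OF \<rho> stabilizerD(1)[OF A]] S] by simp
    qed
    define D where "D = distr ?K ?\<Gamma> ?Q"
    have int_A: "AE A in ?K. integrable ?M (\<lambda>z. g ((\<rho> ** A) *v z))"
      using KM.AE_integrable_fst'[OF int_\<rho>] by (simp add: \<tau>_def)
    have null_A: "AE A in ?K. AE z in ?M. (\<rho> ** A) *v z \<notin> N"
      using KM.AE_pair[OF null_\<rho>] by (simp add: \<tau>_def)
    have [measurable]: "(\<lambda>Q. \<integral>\<^sup>+z. indicator N z \<partial>plane_measure (\<eta> + Q)) \<in> borel_measurable ?\<Gamma>"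
      "(\<lambda>Q. \<integral>\<^sup>+z. ennreal (norm (g z)) \<partial>plane_measure (\<eta> + Q)) \<in> borel_measurable ?\<Gamma>"
      by (rule measurable_nn_integral_plane_measure_sum[OF sub_\<eta>], measurable)+
    \<comment> \<open>The condition on \<open>Q\<close> is phrased by two measurable functions of \<open>Q\<close>, so that it can be tested along the orbit map.\<close>
    have "AE Q in D. (\<integral>\<^sup>+z. indicator N z \<partial>plane_measure (\<eta> + Q)) = 0 \<and>
        (\<integral>\<^sup>+z. ennreal (norm (g z)) \<partial>plane_measure (\<eta> + Q)) < \<infinity>"
      unfolding D_def
    proof (subst AE_distr_iff[OF orbit])
      show "AE A in ?K. (\<integral>\<^sup>+z. indicator N z \<partial>plane_measure (\<eta> + ?Q A)) = 0 \<and>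
          (\<integral>\<^sup>+z. ennreal (norm (g z)) \<partial>plane_measure (\<eta> + ?Q A)) < \<infinity>"
        using int_A null_A AE_space
      proof eventually_elim
        case (elim A)
        have "(\<integral>\<^sup>+z. indicator N z \<partial>distr ?M borel (\<lambda>z. (\<rho> ** A) *v z))
            = (\<integral>\<^sup>+z. indicator N ((\<rho> ** A) *v z) \<partial>?M)"
          by (rule nn_integral_distr) simp_all
        also have "\<dots> = (\<integral>\<^sup>+z. 0 \<partial>?M)"
          using elim(2) by (intro nn_integral_cong_AE) (auto elim: eventually_mono)
        finally have "(\<integral>\<^sup>+z. indicator N z \<partial>plane_measure (\<eta> + ?Q A)) = 0"
          using plane[OF elim(3)] by simp
        moreover have "(\<integral>\<^sup>+z. ennreal (norm (g z)) \<partial>plane_measure (\<eta> + ?Q A)) < \<infinity>"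
          using elim(1) unfolding plane[OF elim(3)]
          by (subst nn_integral_distr) (simp_all add: integrable_iff_bounded)
        ultimately show ?case by simp
      qed
    qed measurable
    then have good: "AE Q in D. integrable (plane_measure (\<eta> + Q)) g \<and>
        (AE z in plane_measure (\<eta> + Q). f (x + z) = g z)"
    proof eventually_elim
      case (elim Q)
      have "N \<in> null_sets (plane_measure (\<eta> + Q))"
        using elim by (intro null_setsI) simp_all
      then have "AE z in plane_measure (\<eta> + Q). z \<notin> N" by (rule AE_not_in)
      then have "AE z in plane_measure (\<eta> + Q). f (x + z) = g z" by eventually_elim (rule N(2))
      moreover have "integrable (plane_measure (\<eta> + Q)) g"
        using elim by (simp add: integrable_iff_bounded)
      ultimately show ?case by simp
    qed
    have "strichartz k p q (plane_transform (p + q) f) ((+) x ` \<eta>) = (\<integral>Q. (\<integral>z. g z \<partial>plane_measure (\<eta> + Q)) \<partial>D)"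
    proof (rule strichartz_plane_transform_eq[OF \<eta> p _ _ g good])
      show "grassmannian_prob q (\<eta>\<^sup>\<bottom>) = completion D"
        using grassmannian_prob_orbit[OF X \<rho> Q\<^sub>0] by (simp add: D_def Y)
    qed (simp add: D_def)
    also have "\<dots> = (\<integral>A. (\<integral>z. g z \<partial>plane_measure (\<eta> + ?Q A)) \<partial>?K)"
      unfolding D_def by (rule integral_distr[OF orbit measurable_integral_plane_measure_sum[OF sub_\<eta> g]])
    also have "\<dots> = (\<integral>A. (\<integral>z. g (\<tau> (\<rho>, A, z)) \<partial>?M) \<partial>?K)"
    proof (rule Bochner_Integration.integral_cong[OF refl])
      fix A assume "A \<in> space ?K"
      then show "(\<integral>z. g z \<partial>plane_measure (\<eta> + ?Q A)) = (\<integral>z. g (\<tau> (\<rho>, A, z)) \<partial>?M)"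
        unfolding \<tau>_def by (simp add: plane integral_distr)
    qed
    also have "\<dots> = (\<integral>Az. g (\<tau> (\<rho>, Az)) \<partial>(?K \<Otimes>\<^sub>M ?M))"
      using KM.integral_fst'[OF int_\<rho>] by simp
    finally show ?thesis by (simp add: \<eta>_def)
  qed
  have "dual_plane_transform \<eta>\<^sub>0 (strichartz k p q (plane_transform (p + q) f)) x
      = (\<integral>\<rho>. (\<integral>Az. g (\<tau> (\<rho>, Az)) \<partial>(?K \<Otimes>\<^sub>M ?M)) \<partial>?H)"
    unfolding dual_plane_transform_def haar_prob_eq
  proof (rule integral_completion_AE)
    have "(\<lambda>\<omega>. g (\<tau> \<omega>)) \<in> borel_measurable (?H \<Otimes>\<^sub>M (?K \<Otimes>\<^sub>M ?M))"
      using int_\<tau> by (rule borel_measurable_integrable)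
    then show "(\<lambda>\<rho>. \<integral>Az. g (\<tau> (\<rho>, Az)) \<partial>(?K \<Otimes>\<^sub>M ?M)) \<in> borel_measurable ?H"
      by (intro KM.borel_measurable_lebesgue_integral) simp
    show "AE \<rho> in ?H. strichartz k p q (plane_transform (p + q) f) ((+) x ` (*v) \<rho> ` \<eta>\<^sub>0)
        = (\<integral>Az. g (\<tau> (\<rho>, Az)) \<partial>(?K \<Otimes>\<^sub>M ?M))"
      using HKM.AE_integrable_fst'[OF int_\<tau>] null AE_space
      by eventually_elim (rule fiber, auto simp: H stabilizer_UNIV)
  qed
  also have "\<dots> = (\<integral>z. w z *\<^sub>R g z \<partial>lborel)" by (rule total)
  also have "\<dots> = sphere_ratio ?m ?n *\<^sub>R (\<integral>z. (norm z powr (real ?m - real ?n)) *\<^sub>R g z \<partial>lborel)"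
    by (simp add: w_def flip: scaleR_scaleR integral_scaleR_right)
  finally show ?thesis .
qed

text \<open>
  The area of the unit sphere in dimension \<open>d\<close> is \<open>2 \<pi>^(d/2) / \<Gamma>(d/2)\<close>; all other factors of \<open>\<gamma>\<^sub>n(m)\<close> cancel.
\<close>

lemma sphere_ratio_riesz_gamma:
  assumes "0 < m" "m < n"
  shows "2 ^ m * pi powr (real m / 2) * Gamma (real n / 2) / Gamma ((real n - real m) / 2)
    * (1 / riesz_gamma n (real m)) = sphere_ratio m n"
proof -
  have sphere: "real d * unit_ball_vol (real d) = 2 * pi powr (real d / 2) / Gamma (real d / 2)"
    if "0 < d" for d :: nat
  proof -
    have "Gamma (real d / 2 + 1) = real d / 2 * Gamma (real d / 2)"
      using that by (intro Gamma_plus1) auto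
    then show ?thesis
      using that Gamma_real_pos[of "real d / 2"] unfolding unit_ball_vol_def by (simp only:) (simp add: field_simps)
  qed
  have pos: "Gamma (real m / 2) > 0" "Gamma (real n / 2) > 0" "Gamma ((real n - real m) / 2) > 0"
    using assms by (auto intro!: Gamma_real_pos)
  have "sphere_ratio m n = (pi powr (real m / 2) * Gamma (real n / 2)) / (pi powr (real n / 2) * Gamma (real m / 2))"
    using assms pos by (simp add: sphere_ratio_def sphere field_simps)
  then show ?thesis
    using pos by (simp add: riesz_gamma_def powr_realpow field_simps)
qed

text \<open>
  The function \<open>g\<close> is recovered from a Borel version of the kernel rather than from \<open>f\<close>: the kernel is
  what is known to be integrable.
\<close>

lemma dual_strichartz_riesz:
  fixes f :: "real^'n \<Rightarrow> complex" and x :: "real^'n" and \<eta>\<^sub>0 :: "(real^'n) set"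
  assumes \<eta>\<^sub>0: "\<eta>\<^sub>0 \<in> grassmannian k UNIV" and p: "p \<le> k"
    and q: "k + q = m" "0 < m" "m < CARD('n)"
    and ex: "riesz_potential_exists (real m) f x"
  shows "dual_plane_transform \<eta>\<^sub>0 (strichartz k p q (plane_transform (p + q) f)) x
    = of_real (2 ^ m * pi powr (real m / 2) * Gamma (real CARD('n) / 2) / Gamma ((real CARD('n) - real m) / 2))
      * riesz_potential (real m) f x"
proof -
  let ?n = "CARD('n)"
  let ?c = "2 ^ m * pi powr (real m / 2) * Gamma (real ?n / 2) / Gamma ((real ?n - real m) / 2)"
  let ?\<kappa> = "riesz_kernel (real m) f x"
  have int_\<kappa>: "integrable lebesgue ?\<kappa>" using ex by (simp add: riesz_potential_exists_def)
  obtain \<kappa> where \<kappa> [measurable]: "\<kappa> \<in> borel_measurable lborel" and AE_\<kappa>: "AE y in lborel. ?\<kappa> y = \<kappa> y"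
    using completion_ex_borel_measurable_complex[OF borel_measurable_integrable[OF int_\<kappa>]] by metis
  have "integrable lebesgue \<kappa>"
    using int_\<kappa> AE_completion[OF AE_\<kappa>] measurable_completion[OF \<kappa>]
    by (subst integrable_cong_AE[symmetric]) auto
  then have "integrable lborel \<kappa>" using \<kappa> by (simp add: integrable_completion)
  then have int_shift: "integrable lborel (\<lambda>z. \<kappa> (x + z))"
    using integrable_distr[of "(+) x" lborel borel \<kappa>] by (simp add: lborel_translation)
  define g where "g z = of_real (norm z powr (real ?n - real m)) * \<kappa> (x + z)" for z
  have [measurable]: "g \<in> borel_measurable borel"
    using \<kappa> unfolding g_def[abs_def] by measurable
  have nonzero: "AE z :: real^'n in lborel. z \<noteq> 0" by (rule AE_lborel_singleton)
  have "AE z in lborel. ?\<kappa> (x + z) = \<kappa> (x + z)"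
    by (rule AE_plane_measure_translation[OF subspace_UNIV UNIV_I, unfolded plane_measure_UNIV, OF AE_\<kappa>])
  then have f_g: "AE z in lborel. f (x + z) = g z"
    using nonzero by eventually_elim (auto simp: g_def riesz_kernel_def nonzero_divide_eq_eq mult.commute)
  have g_\<kappa>: "AE z in lborel. \<kappa> (x + z) = (norm z powr (real m - real ?n)) *\<^sub>R g z"
    using nonzero
  proof eventually_elim
    case (elim z)
    then have "norm z powr (real m - real ?n) * norm z powr (real ?n - real m) = 1"
      by (simp flip: powr_add)
    then show ?case by (simp add: g_def scaleR_conv_of_real mult.assoc[symmetric] flip: of_real_mult)
  qed
  have int_g: "integrable lborel (\<lambda>z. (norm z powr (real m - real ?n)) *\<^sub>R g z)"
    by (rule integrable_cong_AE_imp[OF int_shift _ g_\<kappa>]) simp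
  have "dual_plane_transform \<eta>\<^sub>0 (strichartz k p q (plane_transform (p + q) f)) x
    = sphere_ratio m ?n *\<^sub>R (\<integral>z. (norm z powr (real m - real ?n)) *\<^sub>R g z \<partial>lborel)"
    using dual_strichartz_plane_transform[OF \<eta>\<^sub>0 p _ _ _ f_g, of q] int_g q by simp
  also have "(\<integral>z. (norm z powr (real m - real ?n)) *\<^sub>R g z \<partial>lborel) = (\<integral>z. \<kappa> (x + z) \<partial>lborel)"
    using g_\<kappa> \<kappa> by (intro integral_cong_AE) (auto elim: eventually_mono)
  also have "\<dots> = (\<integral>y. \<kappa> y \<partial>lborel)"
    using integral_plane_measure_translation[OF subspace_UNIV UNIV_I, of \<kappa> x] \<kappa> by (simp add: plane_measure_UNIV)
  also have "\<dots> = (\<integral>y. ?\<kappa> y \<partial>lebesgue)"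
    by (rule integral_completion_AE[OF \<kappa> AE_\<kappa>, symmetric])
  also have "sphere_ratio m ?n *\<^sub>R (\<integral>y. ?\<kappa> y \<partial>lebesgue)
      = of_real (?c * (1 / riesz_gamma ?n (real m))) * (\<integral>y. ?\<kappa> y \<partial>lebesgue)"
    by (simp only: sphere_ratio_riesz_gamma[OF q(2,3)] scaleR_conv_of_real)
  also have "\<dots> = of_real ?c * riesz_potential (real m) f x"
    by (simp only: riesz_potential_def of_real_mult mult.assoc)
  finally show ?thesis .
qed

theorem theorem5p11:
  fixes f :: "real^'n \<Rightarrow> complex" and x :: "real^'n"
    and n p q l j k :: nat and c :: real
    and \<eta>\<^sub>0 \<xi>\<^sub>0 :: "(real^'n) set"
  assumes "n = CARD('n)"
    and "p > 0" and "q > 0" and "l > 0" and "p + q + l < n"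
    and "j = p + q" and "k = p + l"
    and "c = 2 ^ (j + l) * pi powr (real (j + l) / 2) * Gamma (real n / 2)
             / Gamma ((real n - real j - real l) / 2)"
    and "\<eta>\<^sub>0 \<in> grassmannian k UNIV" and "\<xi>\<^sub>0 \<in> grassmannian j UNIV"
    and "riesz_potential_exists (real (k + q)) f x"
  shows
    "(dual_plane_transform \<eta>\<^sub>0 (strichartz k p q (plane_transform j f)) x
        = of_real c * riesz_potential (real (j + l)) f x \<and>
      of_real c * riesz_potential (real (j + l)) f x
        = of_real c * riesz_potential (real (k + q)) f x) \<and>
     (dual_plane_transform \<xi>\<^sub>0 (strichartz j p l (plane_transform k f)) x
        = of_real c * riesz_potential (real (j + l)) f x \<and>
      of_real c * riesz_potential (real (j + l)) f x
        = of_real c * riesz_potential (real (k + q)) f x)"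
proof -
  have m: "k + q = j + l" and dim: "k + q < CARD('n)" and pos: "0 < k + q"
    using assms by auto
  have ex: "riesz_potential_exists (real (j + l)) f x" using assms(11) by (simp only: m)
  have c: "c = 2 ^ (j + l) * pi powr (real (j + l) / 2) * Gamma (real CARD('n) / 2)
      / Gamma ((real CARD('n) - real (j + l)) / 2)"
    using assms by (simp add: diff_diff_eq)
  have "dual_plane_transform \<eta>\<^sub>0 (strichartz k p q (plane_transform (p + q) f)) x
      = of_real c * riesz_potential (real (j + l)) f x"
    unfolding c using assms(6,7,9,10) m dim pos by (intro dual_strichartz_riesz ex) auto
  then have i: "dual_plane_transform \<eta>\<^sub>0 (strichartz k p q (plane_transform j f)) x
      = of_real c * riesz_potential (real (j + l)) f x"
    by (simp only: assms(6))
  have "dual_plane_transform \<xi>\<^sub>0 (strichartz j p l (plane_transform (p + l) f)) x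
      = of_real c * riesz_potential (real (j + l)) f x"
    unfolding c using assms(6,7,9,10) m dim pos by (intro dual_strichartz_riesz ex) auto
  then have ii: "dual_plane_transform \<xi>\<^sub>0 (strichartz j p l (plane_transform k f)) x
      = of_real c * riesz_potential (real (j + l)) f x"
    by (simp only: assms(7))
  show ?thesis unfolding i ii m by blast
qed

end
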